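(* Let $n\ge 1$ and let $\psi\in C^\infty(\mathbf R^n)$ be a real-valued and radially symmetric function such that: (1) there are a constant $C>0$ and a polynomial $P$ such that $$|\partial_r\psi(|x|)|,\ |\partial_r^2\psi(|x|)|,\ |\partial_r^3\psi(|x|)|\le C\,|P(|x|)|\qquad \forall\, |x|\in\mathbf R^+;$$ (2) the limit $\lim_{|x|\to\infty}\partial_r\psi(|x|)=:\psi'(\infty)\in(-\infty,\infty)$ exists. Then for every $f\in\mathcal S(\mathbf R^n)$, denoting by $u(t,x)$ the unique solution to $i\partial_t u+\Delta u=0$, $u(0,x)=f(x)$, $(t,x)\in\mathbf R\times\mathbf R^n$, the limit on the left-hand side below exists and $$\lim_{T\to\infty}\int_{-T}^{T}\int_{\mathbf R^n}\left[\nabla\bar u(t,x)\,D^2\psi(x)\,\nabla u(t,x)-\frac14|u(t,x)|^2\,\Delta^2\psi(x)\right]dx\,dt=2\pi\,\psi'(\infty)\,\|f\|_{\dot H^{1/2}(\mathbf R^n)}^2 .$$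
   Context: $\mathcal S(\mathbf R^n)$ is the Schwartz space. The Fourier transform is normalized as $\hat f(\xi)=\int_{\mathbf R^n}e^{-2\pi i x\cdot\xi}f(x)\,dx$, and the homogeneous Sobolev norm is $\|f\|_{\dot H^{s}(\mathbf R^n)}^2=\int_{\mathbf R^n}|\hat f(\xi)|^2|\xi|^{2s}\,d\xi$. A radially symmetric function $\psi$ is written $\psi(x)=\psi(|x|)$, and $\partial_r$ is the radial derivative. $\nabla$ and $\Delta$ act in the space variable $x$, $D^2\psi=\left(\frac{\partial^2\psi}{\partial x_i\partial x_j}\right)_{i,j=1,\dots,n}$ is the Hessian matrix, $\Delta^2$ is the bilaplacian, and $\nabla\bar u\,D^2\psi\,\nabla u=\sum_{i,j=1}^n\partial_i\bar u\,\frac{\partial^2\psi}{\partial x_i\partial x_j}\,\partial_j u$. The bar denotes complex conjugation. *)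

theory Defs
  imports "HOL-Analysis.Analysis" "HOL-Computational_Algebra.Polynomial"
begin

definition partial :: "'n::finite \<Rightarrow> (real ^ 'n \<Rightarrow> 'b::real_normed_vector) \<Rightarrow> real ^ 'n \<Rightarrow> 'b" where
  "partial i f x = frechet_derivative f (at x) (axis i 1)"

fun partials :: "'n::finite list \<Rightarrow> (real ^ 'n \<Rightarrow> 'b::real_normed_vector) \<Rightarrow> real ^ 'n \<Rightarrow> 'b" where
  "partials [] f = f"
| "partials (i # is) f = partial i (partials is f)"

text \<open>Every iterated partial derivative is required to be Frechet differentiable everywhere;
  hence all of them are continuous, and this is the class of infinitely often continuously
  differentiable functions.\<close>

definition smooth :: "(real ^ 'n::finite \<Rightarrow> 'b::real_normed_vector) \<Rightarrow> bool" where
  "smooth f \<longleftrightarrow> (\<forall>is x. partials is f differentiable (at x))"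

definition laplacian :: "(real ^ 'n::finite \<Rightarrow> 'b::real_normed_vector) \<Rightarrow> real ^ 'n \<Rightarrow> 'b" where
  "laplacian f x = (\<Sum>i\<in>UNIV. partial i (partial i f) x)"

definition hessian :: "(real ^ 'n::finite \<Rightarrow> real) \<Rightarrow> real ^ 'n \<Rightarrow> real ^ 'n ^ 'n" where
  "hessian \<psi> x = (\<chi> i j. partial i (partial j \<psi>) x)"

definition schwartz :: "(real ^ 'n::finite \<Rightarrow> complex) set" where
  "schwartz = {f. smooth f \<and>
     (\<forall>N is. bounded (range (\<lambda>x. (1 + norm x) ^ N * norm (partials is f x))))}"

definition schwartz_seminorm :: "nat \<Rightarrow> 'n::finite list \<Rightarrow> (real ^ 'n \<Rightarrow> complex) \<Rightarrow> real" where
  "schwartz_seminorm N is f = (SUP x. (1 + norm x) ^ N * norm (partials is f x))"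

definition fourier :: "(real ^ 'n::finite \<Rightarrow> complex) \<Rightarrow> real ^ 'n \<Rightarrow> complex" where
  "fourier f \<xi> = (LINT x|lborel. exp (- 2 * of_real pi * \<i> * of_real (x \<bullet> \<xi>)) * f x)"

definition hom_sobolev_norm :: "real \<Rightarrow> (real ^ 'n::finite \<Rightarrow> complex) \<Rightarrow> real" where
  "hom_sobolev_norm s f = sqrt (LINT \<xi>|lborel. (norm (fourier f \<xi>))\<^sup>2 * norm \<xi> powr (2 * s))"

text \<open>Pointwise solutions of the free Schroedinger equation alone are not unique. The class in which
  the solution with Schwartz data is unique is taken to be that of continuous curves (in the
  topology given by the seminorms) in the Schwartz space.\<close>

definition schroedinger_solution ::
    "(real ^ 'n::finite \<Rightarrow> complex) \<Rightarrow> (real \<Rightarrow> real ^ 'n \<Rightarrow> complex) \<Rightarrow> bool" where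
  "schroedinger_solution f u \<longleftrightarrow>
     (\<forall>t. u t \<in> schwartz) \<and>
     (\<forall>N is t. ((\<lambda>s. schwartz_seminorm N is (\<lambda>x. u s x - u t x)) \<longlongrightarrow> 0) (at t)) \<and>
     (\<forall>t x. (\<lambda>s. u s x) differentiable (at t) \<and>
        \<i> * vector_derivative (\<lambda>s. u s x) (at t) + laplacian (u t) x = 0) \<and>
     (\<forall>x. u 0 x = f x)"

text \<open>When no growth condition is placed on the fourth derivatives of \<open>\<psi>\<close>, the term with
  \<open>laplacian (laplacian \<psi>)\<close> need not be absolutely integrable even for a Schwartz function \<open>v\<close>.
  Integrals of this density are therefore to be read as Henstock-Kurzweil integrals, which
  coincide with the Lebesgue integral whenever the latter exists.\<close>

definition virial_density ::
    "(real ^ 'n::finite \<Rightarrow> real) \<Rightarrow> (real ^ 'n \<Rightarrow> complex) \<Rightarrow> real ^ 'n \<Rightarrow> complex" where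
  "virial_density \<psi> v x =
     (\<Sum>i\<in>UNIV. \<Sum>j\<in>UNIV.
        partial i (\<lambda>y. cnj (v y)) x * of_real (hessian \<psi> x $ i $ j) * partial j v x)
     - 1 / 4 * of_real ((norm (v x))\<^sup>2 * laplacian (laplacian \<psi>) x)"

end

theory Submission
  imports Defs "HOL-Probability.Probability"
begin

text \<open>With the skew-adjoint operator \<open>A = \<nabla>\<psi> \<cdot> \<nabla> + \<Delta>\<psi>/2\<close> and the momentum
  \<open>M(t) = 1/2 Im \<integral> cnj u A u = 1/2 Im \<integral> cnj u \<nabla>\<psi> \<cdot> \<nabla>u\<close>, the virial density differs from
  \<open>- Re (cnj (A u) \<Delta>u)\<close>, whose integral is \<open>M'(t)\<close>, by the divergence of a rapidly decreasing field.
  The bounds on the first three derivatives of \<open>\<psi>\<close> control this field, although not its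
  divergence, so the Henstock-Kurzweil integral of the divergence vanishes and the time integral
  equals \<open>M(T) - M(-T)\<close>.

  For the limit one uses that \<open>u(t,x) = (4\<pi>it)\<^sup>-\<^sup>n\<^sup>/\<^sup>2 e(x) F(x / 4\<pi>t)\<close>, where \<open>e(x) = exp (i |x|\<^sup>2 / 4t)\<close> and
  \<open>F\<close> is the Fourier transform of \<open>e f\<close>. In the variable \<open>\<xi> = x / 4\<pi>t\<close> the integrand of
  \<open>M(t)\<close> converges pointwise, \<open>\<nabla>\<psi>(4\<pi>t\<xi>)\<close> tending to \<open>\<plusminus> \<psi>'(\<infinity>) \<xi> / |\<xi>|\<close> as \<open>t\<close> tends to \<open>\<plusminus>\<infinity>\<close>. It is dominated because
  \<open>F\<close> decays rapidly, uniformly in \<open>t\<close>, so \<open>M(t)\<close> tends to \<open>\<plusminus> \<pi> \<psi>'(\<infinity>)\<close> times the squared norm of \<open>f\<close>.\<close>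

section \<open>Partial derivatives\<close>

text \<open>The divergence of the field contains \<Delta>\<Delta>\<psi> and admits no absolute
  bound. Its integral is therefore controlled through the faces of arbitrary boxes, where only the
  field itself has to be small.

  A solution is differentiable in time only pointwise in x, so a time derivative of \<nabla>u is
  never formed: skew-adjointness of A makes each difference quotient of the quadratic form fall on u
  alone. The closed formula for u is not part of the definition of a solution either. It follows
  because the pairing of u(s) with the heat kernel at complex time \<epsilon> + i(t - s) is constant
  in s; at s = t the kernel is an approximate identity, at s = 0 it acts on the initial data.

  The constants: the gradient of e is i x / (2t) = 2 \<pi> i \<xi> times e, and (\<xi> / |\<xi>|) .
  \<xi> = |\<xi>| produces the single power of |\<xi>| in the Sobolev norm of order 1/2. The factor
  1/2 in M turns 2 \<pi> into \<pi>, and the opposite limits at the two ends of time add up to 2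
  \<pi>.\<close>

definition c1 :: "(real ^ 'n::finite \<Rightarrow> 'b::real_normed_vector) \<Rightarrow> bool" where
  "c1 g \<longleftrightarrow> (\<forall>x. g differentiable (at x)) \<and> (\<forall>i. continuous_on UNIV (partial i g))"

lemma partial_eqI: "(f has_derivative f') (at x) \<Longrightarrow> partial i f x = f' (axis i 1)"
  unfolding partial_def using frechet_derivative_at by metis

lemma has_vector_derivative_along_axis:
  assumes "f differentiable (at (x + s *\<^sub>R axis i 1))"
  shows "((\<lambda>s. f (x + s *\<^sub>R axis i 1)) has_vector_derivative partial i f (x + s *\<^sub>R axis i 1)) (at s)"
proof -
  have d: "(f has_derivative frechet_derivative f (at (x + s *\<^sub>R axis i 1))) (at (x + s *\<^sub>R axis i 1))"
    using assms frechet_derivative_works by blast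
  have "((\<lambda>s. x + s *\<^sub>R axis i 1) has_derivative (\<lambda>h. h *\<^sub>R axis i 1)) (at s)"
    by (auto intro!: derivative_eq_intros)
  from has_derivative_compose[OF this, of f, OF d]
  show ?thesis
    unfolding has_vector_derivative_def partial_def
    using linear_scale[OF linear_frechet_derivative[OF assms]] by simp
qed

lemma partial_eq_vector_derivative:
  assumes "f differentiable (at x)" "((\<lambda>s. f (x + s *\<^sub>R axis i 1)) has_vector_derivative d) (at 0)"
  shows "partial i f x = d"
proof -
  have "((\<lambda>s. f (x + s *\<^sub>R axis i 1)) has_vector_derivative partial i f x) (at 0)"
    using has_vector_derivative_along_axis[of f x 0 i] assms(1) by simp
  then show ?thesis using assms(2) by (rule vector_derivative_unique_at)
qed

lemma partial_cong_open:
  assumes "open S" "x \<in> S" "\<And>y. y \<in> S \<Longrightarrow> f y = g y"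
  shows "partial i f x = partial i g x"
proof -
  have "(f has_derivative D) (at x) \<longleftrightarrow> (g has_derivative D) (at x)" for D
    using has_derivative_transform_within_open assms by metis
  then show ?thesis unfolding partial_def frechet_derivative_def by simp
qed

lemma
  assumes "bounded_linear L" "f differentiable (at x)"
  shows partial_bounded_linear: "partial i (\<lambda>x. L (f x)) x = L (partial i f x)"
    and differentiable_bounded_linear: "(\<lambda>x. L (f x)) differentiable (at x)"
proof -
  have *: "((\<lambda>x. L (f x)) has_derivative (\<lambda>h. L (frechet_derivative f (at x) h))) (at x)"
    using assms bounded_linear.has_derivative frechet_derivative_works by blast
  from partial_eqI[OF this] show "partial i (\<lambda>x. L (f x)) x = L (partial i f x)"
    by (simp add: partial_def)
  from * show "(\<lambda>x. L (f x)) differentiable (at x)" unfolding differentiable_def by blast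
qed

lemma partial_const [simp]: "partial i (\<lambda>x. c) x = 0"
  by (rule partial_eqI[OF has_derivative_const])

lemma partial_component: "partial i (\<lambda>y. y $ j) x = (if i = j then 1 else 0)"
  by (subst partial_eqI[OF bounded_linear_imp_has_derivative[OF bounded_linear_vec_nth]]) (auto simp: axis_def)

lemma
  assumes "f differentiable (at x)" "g differentiable (at x)"
  shows partial_add: "partial i (\<lambda>x. f x + g x) x = partial i f x + partial i g x"
    and partial_diff: "partial i (\<lambda>x. f x - g x) x = partial i f x - partial i g x"
  using partial_eqI[OF has_derivative_add[OF assms[unfolded frechet_derivative_works]]]
    partial_eqI[OF has_derivative_diff[OF assms[unfolded frechet_derivative_works]]]
  by (simp_all add: partial_def)

lemma partial_mult:
  fixes f g :: "real ^ 'n::finite \<Rightarrow> 'b::real_normed_algebra"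
  assumes "f differentiable (at x)" "g differentiable (at x)"
  shows "partial i (\<lambda>x. f x * g x) x = f x * partial i g x + partial i f x * g x"
  using partial_eqI[OF has_derivative_mult[OF assms[unfolded frechet_derivative_works]]]
  by (simp add: partial_def)

lemma partial_sum:
  assumes "\<And>k. k \<in> S \<Longrightarrow> f k differentiable (at x)"
  shows "partial i (\<lambda>x. \<Sum>k\<in>S. f k x) x = (\<Sum>k\<in>S. partial i (f k) x)"
  using partial_eqI[OF has_derivative_sum[of S f "\<lambda>k. frechet_derivative (f k) (at x)"]] assms
  by (simp add: partial_def frechet_derivative_works)

lemmas partial_cnj = partial_bounded_linear[OF bounded_linear_cnj]

section \<open>Closure properties of continuously differentiable functions\<close>

lemma c1_differentiable: "c1 g \<Longrightarrow> g differentiable (at x)"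
  by (simp add: c1_def)

lemma c1_continuous_partial: "c1 g \<Longrightarrow> continuous_on A (partial i g)"
  unfolding c1_def using continuous_on_subset by blast

lemma c1_continuous: "c1 g \<Longrightarrow> continuous_on A g"
  by (simp add: c1_def continuous_at_imp_continuous_on differentiable_imp_continuous_within)

lemma c1_const: "c1 (\<lambda>x. c)"
proof -
  have "partial i (\<lambda>x. c) = (\<lambda>x. 0)" for i by (rule ext) simp
  then show ?thesis by (simp add: c1_def)
qed

lemma c1_bounded_linear:
  assumes "bounded_linear L" "c1 f"
  shows "c1 (\<lambda>x. L (f x))"
proof -
  have "partial i (\<lambda>x. L (f x)) = (\<lambda>x. L (partial i f x))" for i
    using partial_bounded_linear[OF assms(1) c1_differentiable[OF assms(2)]] by (rule ext)
  then show ?thesis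
    using assms by (auto simp: c1_def differentiable_bounded_linear bounded_linear.continuous_on)
qed

lemma c1_add: "c1 f \<Longrightarrow> c1 g \<Longrightarrow> c1 (\<lambda>x. f x + g x)"
  and c1_diff: "c1 f \<Longrightarrow> c1 g \<Longrightarrow> c1 (\<lambda>x. f x - g x)"
proof -
  assume *: "c1 f" "c1 g"
  then have "partial i (\<lambda>x. f x + g x) = (\<lambda>x. partial i f x + partial i g x)"
    "partial i (\<lambda>x. f x - g x) = (\<lambda>x. partial i f x - partial i g x)" for i
    by (auto simp: c1_def partial_add partial_diff)
  with * show "c1 (\<lambda>x. f x + g x)" "c1 (\<lambda>x. f x - g x)"
    by (auto simp: c1_def intro!: continuous_intros)
qed

lemma c1_mult:
  fixes f g :: "real ^ 'n::finite \<Rightarrow> 'b::real_normed_algebra"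
  assumes "c1 f" "c1 g"
  shows "c1 (\<lambda>x. f x * g x)"
proof -
  have "partial i (\<lambda>x. f x * g x) = (\<lambda>x. f x * partial i g x + partial i f x * g x)" for i
    using assms by (auto simp: c1_def partial_mult)
  then show ?thesis
    using assms c1_continuous[of f UNIV] c1_continuous[of g UNIV]
    by (auto simp: c1_def intro!: continuous_intros)
qed

lemma c1_sum:
  assumes "\<And>k. k \<in> S \<Longrightarrow> c1 (f k)"
  shows "c1 (\<lambda>x. \<Sum>k\<in>S. f k x)"
  using assms by (induction S rule: infinite_finite_induct) (auto intro: c1_add c1_const)

lemmas c1_cnj = c1_bounded_linear[OF bounded_linear_cnj]
lemmas c1_of_real = c1_bounded_linear[OF bounded_linear_of_real]
lemmas c1_intros = c1_const c1_add c1_diff c1_mult c1_sum c1_cnj c1_of_real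

section \<open>Smooth functions and symmetry of second derivatives\<close>

lemma partials_append: "partials (is @ js) f = partials is (partials js f)"
  by (induction "is") auto

lemma smooth_partials: "smooth f \<Longrightarrow> smooth (partials js f)"
  unfolding smooth_def using partials_append by metis

lemma smooth_partial: "smooth f \<Longrightarrow> smooth (partial i f)"
  using smooth_partials[of f "[i]"] by simp

lemma smooth_differentiable: "smooth f \<Longrightarrow> f differentiable (at x)"
  unfolding smooth_def by (metis partials.simps(1))

lemma smooth_c1: "smooth f \<Longrightarrow> c1 f"
  unfolding c1_def
  by (meson continuous_at_imp_continuous_on differentiable_imp_continuous_within smooth_differentiable smooth_partial)

lemma smooth_continuous: "smooth f \<Longrightarrow> continuous_on A f"
  by (simp add: c1_continuous smooth_c1)

text \<open>Symmetry of second derivatives: differentiate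
  \<open>f (x + s e\<^sub>i + t e\<^sub>j) - f (x + t e\<^sub>j)\<close>, written as an integral over \<open>s\<close>, first in \<open>t\<close> and then in \<open>s\<close>.\<close>

lemma partial_commute:
  fixes f :: "real ^ 'n::finite \<Rightarrow> 'b::banach"
  assumes f: "smooth f"
  shows "partial i (partial j f) x = partial j (partial i f) x"
proof -
  let ?e = "\<lambda>k s. s *\<^sub>R axis k (1::real) :: real^'n"
  have diff: "f differentiable (at y)" "partial k f differentiable (at y)" for y k
    using f smooth_differentiable smooth_partial by auto
  have ci: "continuous_on UNIV (partial i f)" and cji: "continuous_on UNIV (partial j (partial i f))"
    using f by (auto intro!: smooth_continuous smooth_partial)
  have along: "((\<lambda>s. f (x + ?e j t + ?e i s)) has_vector_derivative partial i f (x + ?e j t + ?e i s)) (at s)" for s t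
    by (rule has_vector_derivative_along_axis) (rule diff)
  have ftc: "((\<lambda>s. partial i f (x + ?e j t + ?e i s)) has_integral f (x + ?e j t + ?e i s) - f (x + ?e j t)) {0..s}"
    if "0 \<le> s" for s t
    using fundamental_theorem_of_calculus[OF that, of "\<lambda>s. f (x + ?e j t + ?e i s)"]
      has_vector_derivative_at_within[OF along] by simp
  have key: "partial j f (x + ?e i s) - partial j f x = integral {0..s} (\<lambda>\<sigma>. partial j (partial i f) (x + ?e i \<sigma>))"
    if s: "0 \<le> s" for s
  proof -
    have "((\<lambda>t. integral (cbox 0 s) (\<lambda>\<sigma>. partial i f (x + ?e j t + ?e i \<sigma>))) has_vector_derivative
        integral (cbox 0 s) (\<lambda>\<sigma>. partial j (partial i f) (x + ?e j 0 + ?e i \<sigma>))) (at 0 within UNIV)"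
    proof (rule leibniz_rule_vector_derivative)
      fix t \<sigma>
      have "((\<lambda>t. partial i f ((x + ?e i \<sigma>) + ?e j t)) has_vector_derivative
         partial j (partial i f) ((x + ?e i \<sigma>) + ?e j t)) (at t)"
        by (rule has_vector_derivative_along_axis) (rule diff)
      then show "((\<lambda>t. partial i f (x + ?e j t + ?e i \<sigma>)) has_vector_derivative
         partial j (partial i f) (x + ?e j t + ?e i \<sigma>)) (at t within UNIV)"
        by (simp add: algebra_simps)
    next
      show "(\<lambda>\<sigma>. partial i f (x + ?e j t + ?e i \<sigma>)) integrable_on cbox 0 s" for t
        using ftc[OF s] by (auto simp: integrable_on_def)
    next
      show "continuous_on (UNIV \<times> cbox 0 s) (\<lambda>(t, \<sigma>). partial j (partial i f) (x + ?e j t + ?e i \<sigma>))"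
        unfolding split_beta by (intro continuous_on_compose2[OF cji] continuous_intros) auto
    qed auto
    then have 1: "((\<lambda>t. f (x + ?e j t + ?e i s) - f (x + ?e j t)) has_vector_derivative
        integral {0..s} (\<lambda>\<sigma>. partial j (partial i f) (x + ?e i \<sigma>))) (at 0)"
      using integral_unique[OF ftc[OF s]] by simp
    have "((\<lambda>t. f ((x + ?e i s) + ?e j t) - f (x + ?e j t)) has_vector_derivative
        (partial j f ((x + ?e i s) + ?e j 0) - partial j f (x + ?e j 0))) (at 0)"
      by (intro has_vector_derivative_diff has_vector_derivative_along_axis diff)
    then have "((\<lambda>t. f (x + ?e j t + ?e i s) - f (x + ?e j t)) has_vector_derivative
        (partial j f (x + ?e i s) - partial j f x)) (at 0)"
      by (simp add: algebra_simps)
    then show ?thesis using 1 by (rule vector_derivative_unique_at)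
  qed
  \<comment> \<open>The formula \<open>key\<close> covers only \<open>s \<ge> 0\<close>, so the two
    derivatives at 0 are compared within \<open>{0..1}\<close>, where a derivative is still
    unique.\<close>
  have "((\<lambda>s. integral {0..s} (\<lambda>\<sigma>. partial j (partial i f) (x + ?e i \<sigma>))) has_vector_derivative
     partial j (partial i f) (x + ?e i 0)) (at 0 within {0..1})"
    by (rule integral_has_vector_derivative) (auto intro!: continuous_on_compose2[OF cji] continuous_intros)
  then have "((\<lambda>s. integral {0..s} (\<lambda>\<sigma>. partial j (partial i f) (x + ?e i \<sigma>))) has_vector_derivative
     partial j (partial i f) x) (at 0 within {0..1})"
    by simp
  then have 1: "((\<lambda>s. partial j f (x + ?e i s) - partial j f x) has_vector_derivative
     partial j (partial i f) x) (at 0 within {0..1})"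
    by (rule has_vector_derivative_transform[rotated 2]) (use key in \<open>auto simp del: One_nat_def\<close>)
  have "((\<lambda>s. partial j f (x + ?e i s) - partial j f x) has_vector_derivative
     partial i (partial j f) (x + ?e i 0) - 0) (at 0)"
    by (intro has_vector_derivative_diff has_vector_derivative_along_axis diff has_vector_derivative_const)
  then have "((\<lambda>s. partial j f (x + ?e i s) - partial j f x) has_vector_derivative
     partial i (partial j f) x) (at 0 within {0..1})"
    by (simp add: has_vector_derivative_at_within)
  then show ?thesis using 1 by (rule vector_derivative_unique_within_closed_interval[of 0 1 0, unfolded box_real, rotated 2]) auto
qed

section \<open>Rapid decay and integration by parts\<close>

text \<open>The parameter \<open>s\<close> will be a time: in a compact interval when integrals are
  differentiated, and in \<open>{t. 1 \<le> \<bar>t\<bar>}\<close> for the asymptotics. The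
  constants are uniform in \<open>s\<close>, which is what domination requires. A single function is
  a family over \<open>unit\<close>.\<close>

definition rapid_on :: "'s set \<Rightarrow> ('s \<Rightarrow> 'a::real_normed_vector \<Rightarrow> 'b::real_normed_vector) \<Rightarrow> bool" where
  "rapid_on S g \<longleftrightarrow> (\<forall>N. \<exists>C. \<forall>s\<in>S. \<forall>x. (1 + norm x) ^ N * norm (g s x) \<le> C)"

definition slow_on :: "'s set \<Rightarrow> ('s \<Rightarrow> 'a::real_normed_vector \<Rightarrow> 'b::real_normed_vector) \<Rightarrow> bool" where
  "slow_on S h \<longleftrightarrow> (\<exists>N C. \<forall>s\<in>S. \<forall>x. norm (h s x) \<le> C * (1 + norm x) ^ N)"

abbreviation rapid :: "('a::real_normed_vector \<Rightarrow> 'b::real_normed_vector) \<Rightarrow> bool" where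
  "rapid g \<equiv> rapid_on (UNIV :: unit set) (\<lambda>_. g)"

abbreviation slow :: "('a::real_normed_vector \<Rightarrow> 'b::real_normed_vector) \<Rightarrow> bool" where
  "slow g \<equiv> slow_on (UNIV :: unit set) (\<lambda>_. g)"

lemma slow_onE:
  assumes "slow_on S h"
  obtains N C where "C > 0" "\<And>s x. s \<in> S \<Longrightarrow> norm (h s x) \<le> C * (1 + norm x) ^ N"
proof -
  obtain N C where *: "\<And>s x. s \<in> S \<Longrightarrow> norm (h s x) \<le> C * (1 + norm x) ^ N"
    using assms unfolding slow_on_def by blast
  have "norm (h s x) \<le> max C 1 * (1 + norm x) ^ N" if "s \<in> S" for s x
    using *[OF that, of x] mult_right_mono[of C "max C 1" "(1 + norm x) ^ N"] by simp
  then show ?thesis using that[of "max C 1" N] by auto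
qed

lemma rapid_onE:
  assumes "rapid_on S g"
  obtains C where "C > 0" "\<And>s x. s \<in> S \<Longrightarrow> (1 + norm x) ^ N * norm (g s x) \<le> C"
proof -
  obtain C where "\<And>s x. s \<in> S \<Longrightarrow> (1 + norm x) ^ N * norm (g s x) \<le> C"
    using assms unfolding rapid_on_def by blast
  then show ?thesis using that[of "max C 1"] by (simp add: le_max_iff_disj)
qed

text \<open>The \<open>M\<close> powers of \<open>1 + norm x\<close> lost to the growth of
  \<open>h\<close> are paid for by decay of \<open>g\<close> of order \<open>N + M\<close>.\<close>

lemma rapid_on_slow_le:
  assumes "rapid_on S g" "slow_on S h" "\<And>s x. s \<in> S \<Longrightarrow> norm (f s x) \<le> norm (h s x) * norm (g s x)"
  shows "rapid_on S f"
  unfolding rapid_on_def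
proof
  fix N
  obtain M C where C: "C > 0" "\<And>s x. s \<in> S \<Longrightarrow> norm (h s x) \<le> C * (1 + norm x) ^ M"
    by (rule slow_onE[OF assms(2)]) blast
  obtain D where D: "D > 0" "\<And>s x. s \<in> S \<Longrightarrow> (1 + norm x) ^ (N + M) * norm (g s x) \<le> D"
    by (rule rapid_onE[OF assms(1)]) blast
  have "(1 + norm x) ^ N * norm (f s x) \<le> C * D" if s: "s \<in> S" for s x
  proof -
    have "(1 + norm x) ^ N * norm (f s x) \<le> (1 + norm x) ^ N * ((C * (1 + norm x) ^ M) * norm (g s x))"
      by (intro mult_left_mono order_trans[OF assms(3)] mult_right_mono C s) auto
    also have "\<dots> = C * ((1 + norm x) ^ (N + M) * norm (g s x))"
      by (simp add: power_add algebra_simps)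
    also have "\<dots> \<le> C * D" using C D s by (intro mult_left_mono) auto
    finally show ?thesis .
  qed
  then show "\<exists>C. \<forall>s\<in>S. \<forall>x. (1 + norm x) ^ N * norm (f s x) \<le> C" by blast
qed

lemma slow_on_const: "slow_on S (\<lambda>s x. c)"
  unfolding slow_on_def by (rule exI[of _ 0], rule exI[of _ "norm c"]) auto

lemma slow_on_bounded: "(\<And>s x. s \<in> S \<Longrightarrow> norm (h s x) \<le> C) \<Longrightarrow> slow_on S h"
  unfolding slow_on_def by (rule exI[of _ 0], rule exI[of _ C]) auto

lemma slow_on_le:
  assumes "slow_on S g" "\<And>s x. s \<in> S \<Longrightarrow> norm (f s x) \<le> C * norm (g s x)"
  shows "slow_on S f"
proof -
  obtain N D where D: "D > 0" "\<And>s x. s \<in> S \<Longrightarrow> norm (g s x) \<le> D * (1 + norm x) ^ N"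
    by (rule slow_onE[OF assms(1)]) blast
  have "norm (f s x) \<le> (\<bar>C\<bar> * D) * (1 + norm x) ^ N" if "s \<in> S" for s x
  proof -
    have "norm (f s x) \<le> \<bar>C\<bar> * norm (g s x)"
      using assms(2)[OF that, of x] mult_right_mono[OF abs_ge_self[of C], of "norm (g s x)"] by simp
    also have "\<dots> \<le> \<bar>C\<bar> * (D * (1 + norm x) ^ N)" using D that by (intro mult_left_mono) auto
    finally show ?thesis by (simp add: mult.assoc)
  qed
  then show ?thesis unfolding slow_on_def by blast
qed

lemma rapid_on_le:
  assumes "rapid_on S g" "\<And>s x. s \<in> S \<Longrightarrow> norm (f s x) \<le> C * norm (g s x)"
  shows "rapid_on S f"
proof (rule rapid_on_slow_le[OF assms(1) slow_on_const[of _ C]])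
  fix s x assume "s \<in> S"
  show "norm (f s x) \<le> norm C * norm (g s x)"
    using assms(2)[OF \<open>s \<in> S\<close>, of x] mult_right_mono[OF abs_ge_self[of C], of "norm (g s x)"] by simp
qed

lemma rapid_on_add:
  assumes "rapid_on S f" "rapid_on S g"
  shows "rapid_on S (\<lambda>s x. f s x + g s x)"
  unfolding rapid_on_def
proof
  fix N
  obtain C where C: "\<And>s x. s \<in> S \<Longrightarrow> (1 + norm x) ^ N * norm (f s x) \<le> C"
    by (rule rapid_onE[OF assms(1)]) blast
  obtain D where D: "\<And>s x. s \<in> S \<Longrightarrow> (1 + norm x) ^ N * norm (g s x) \<le> D"
    by (rule rapid_onE[OF assms(2)]) blast
  have "(1 + norm x) ^ N * norm (f s x + g s x) \<le> C + D" if "s \<in> S" for s x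
  proof -
    have "(1 + norm x) ^ N * norm (f s x + g s x) \<le> (1 + norm x) ^ N * (norm (f s x) + norm (g s x))"
      by (intro mult_left_mono norm_triangle_ineq) auto
    then show ?thesis using C[OF that, of x] D[OF that, of x] by (simp add: algebra_simps)
  qed
  then show "\<exists>C. \<forall>s\<in>S. \<forall>x. (1 + norm x) ^ N * norm (f s x + g s x) \<le> C" by blast
qed

lemma rapid_on_zero: "rapid_on S (\<lambda>s x. 0)"
  unfolding rapid_on_def by auto

lemma rapid_on_sum:
  assumes "\<And>k. k \<in> K \<Longrightarrow> rapid_on S (f k)"
  shows "rapid_on S (\<lambda>s x. \<Sum>k\<in>K. f k s x)"
  using assms
proof (induction K rule: infinite_finite_induct)
  case (insert a K)
  then have "rapid_on S (\<lambda>s x. f a s x + (\<Sum>k\<in>K. f k s x))" by (intro rapid_on_add) auto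
  with insert show ?case by simp
qed (auto intro: rapid_on_zero)

lemma slow_on_add:
  assumes "slow_on S f" "slow_on S g"
  shows "slow_on S (\<lambda>s x. f s x + g s x)"
proof -
  obtain N C where C: "C > 0" "\<And>s x. s \<in> S \<Longrightarrow> norm (f s x) \<le> C * (1 + norm x) ^ N"
    by (rule slow_onE[OF assms(1)]) blast
  obtain M D where D: "D > 0" "\<And>s x. s \<in> S \<Longrightarrow> norm (g s x) \<le> D * (1 + norm x) ^ M"
    by (rule slow_onE[OF assms(2)]) blast
  have "norm (f s x + g s x) \<le> (C + D) * (1 + norm x) ^ (N + M)" if "s \<in> S" for s x
  proof -
    have "C * (1 + norm x) ^ N \<le> C * (1 + norm x) ^ (N + M)"
      "D * (1 + norm x) ^ M \<le> D * (1 + norm x) ^ (N + M)"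
      using C D by (auto intro!: mult_left_mono power_increasing)
    then show ?thesis
      using C(2)[OF that, of x] D(2)[OF that, of x] norm_triangle_ineq[of "f s x" "g s x"]
      by (simp add: algebra_simps)
  qed
  then show ?thesis unfolding slow_on_def by blast
qed

lemma slow_on_sum:
  assumes "\<And>k. k \<in> K \<Longrightarrow> slow_on S (f k)"
  shows "slow_on S (\<lambda>s x. \<Sum>k\<in>K. f k s x)"
  using assms
proof (induction K rule: infinite_finite_induct)
  case (insert a K)
  then have "slow_on S (\<lambda>s x. f a s x + (\<Sum>k\<in>K. f k s x))" by (intro slow_on_add) auto
  with insert show ?case by simp
qed (auto intro: slow_on_const)

lemma slow_on_mult:
  fixes f g :: "'s \<Rightarrow> 'a::real_normed_vector \<Rightarrow> 'b::real_normed_algebra"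
  assumes "slow_on S f" "slow_on S g"
  shows "slow_on S (\<lambda>s x. f s x * g s x)"
proof -
  obtain N C where C: "C > 0" "\<And>s x. s \<in> S \<Longrightarrow> norm (f s x) \<le> C * (1 + norm x) ^ N"
    by (rule slow_onE[OF assms(1)]) blast
  obtain M D where D: "D > 0" "\<And>s x. s \<in> S \<Longrightarrow> norm (g s x) \<le> D * (1 + norm x) ^ M"
    by (rule slow_onE[OF assms(2)]) blast
  have "norm (f s x * g s x) \<le> (C * D) * (1 + norm x) ^ (N + M)" if "s \<in> S" for s x
  proof -
    have "norm (f s x * g s x) \<le> (C * (1 + norm x) ^ N) * (D * (1 + norm x) ^ M)"
      using C D that by (intro order_trans[OF norm_mult_ineq] mult_mono) auto
    then show ?thesis by (simp add: power_add algebra_simps)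
  qed
  then show ?thesis unfolding slow_on_def by blast
qed

lemma rapid_on_slow: "rapid_on S g \<Longrightarrow> slow_on S g"
  by (erule rapid_onE[where N=0], rule slow_on_bounded) simp

lemma rapid_on_mult_left:
  fixes f g :: "'s \<Rightarrow> 'a::real_normed_vector \<Rightarrow> 'b::real_normed_algebra"
  shows "slow_on S f \<Longrightarrow> rapid_on S g \<Longrightarrow> rapid_on S (\<lambda>s x. f s x * g s x)"
  by (rule rapid_on_slow_le) (auto simp: norm_mult_ineq)

lemma rapid_on_bounded_linear:
  assumes "bounded_linear L" "rapid_on S f"
  shows "rapid_on S (\<lambda>s x. L (f s x))"
proof -
  obtain K where "\<And>y. norm (L y) \<le> norm y * K"
    using bounded_linear.bounded[OF assms(1)] by blast
  then show ?thesis by (intro rapid_on_le[OF assms(2), where C=K]) (simp add: mult.commute)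
qed

lemma slow_on_bounded_linear:
  assumes "bounded_linear L" "slow_on S f"
  shows "slow_on S (\<lambda>s x. L (f s x))"
proof -
  obtain K where "\<And>y. norm (L y) \<le> norm y * K"
    using bounded_linear.bounded[OF assms(1)] by blast
  then show ?thesis by (intro slow_on_le[OF assms(2), where C=K]) (simp add: mult.commute)
qed

lemma slow_on_component: "slow_on S (\<lambda>s (x :: real ^ 'n::finite). x $ i)"
  unfolding slow_on_def
  by (rule exI[of _ 1], rule exI[of _ 1]) (auto intro: order_trans[OF component_le_norm_cart])

lemma rapid_on_diff: "rapid_on S f \<Longrightarrow> rapid_on S g \<Longrightarrow> rapid_on S (\<lambda>s x. f s x - g s x)"
  using rapid_on_add[of S f "\<lambda>s x. - g s x"] rapid_on_le[of S g "\<lambda>s x. - g s x" 1] by simp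

lemma slow_on_diff: "slow_on S f \<Longrightarrow> slow_on S g \<Longrightarrow> slow_on S (\<lambda>s x. f s x - g s x)"
  using slow_on_add[of S f "\<lambda>s x. - g s x"] slow_on_le[of S g "\<lambda>s x. - g s x" 1] by simp

lemmas rapid_on_cnj = rapid_on_bounded_linear[OF bounded_linear_cnj]
lemmas slow_on_of_real = slow_on_bounded_linear[OF bounded_linear_of_real]

lemma rapid_on_reindex:
  assumes "rapid_on S g" "\<And>s. s \<in> S' \<Longrightarrow> k s \<in> S"
  shows "rapid_on S' (\<lambda>s. g (k s))"
  using assms unfolding rapid_on_def by metis

lemma slow_on_reindex:
  assumes "slow_on S g" "\<And>s. s \<in> S' \<Longrightarrow> k s \<in> S"
  shows "slow_on S' (\<lambda>s. g (k s))"
  using assms unfolding slow_on_def by metis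

text \<open>The common dominating function. A product over coordinates is chosen instead of a power
  of the norm, so that its integrals over the whole space and over slabs factor into one-dimensional
  ones.\<close>

definition weight :: "real ^ 'n::finite \<Rightarrow> real" where
  "weight x = (\<Prod>i\<in>UNIV. inverse (1 + (x $ i)\<^sup>2))"

lemma weight_pos: "weight x > 0"
  unfolding weight_def by (intro prod_pos) (simp add: add_pos_nonneg)

lemma weight_measurable [measurable]: "weight \<in> borel_measurable borel"
  unfolding weight_def by measurable

lemma inverse_weight_le: "inverse (weight (x :: real ^ 'n::finite)) \<le> (1 + norm x) ^ (2 * CARD('n))"
proof -
  have "1 + (x $ i)\<^sup>2 \<le> (1 + norm x)\<^sup>2" for i
  proof -
    have "\<bar>x $ i\<bar>\<^sup>2 \<le> (norm x)\<^sup>2" by (intro power_mono component_le_norm_cart) auto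
    moreover have "(1 + norm x)\<^sup>2 = 1 + (norm x)\<^sup>2 + 2 * norm x" by (simp add: power2_sum)
    moreover have "\<bar>x $ i\<bar>\<^sup>2 = (x $ i)\<^sup>2" by simp
    ultimately show ?thesis using norm_ge_zero[of x] by linarith
  qed
  then have "(\<Prod>i\<in>UNIV. 1 + (x $ i)\<^sup>2) \<le> (\<Prod>i\<in>(UNIV::'n set). (1 + norm x)\<^sup>2)"
    by (intro prod_mono) auto
  then show ?thesis by (simp add: weight_def prod_inversef[symmetric] power_mult comp_def)
qed

lemma rapid_on_weight:
  fixes g :: "'s \<Rightarrow> real ^ 'n::finite \<Rightarrow> 'b::real_normed_vector"
  assumes "rapid_on S g"
  obtains C where "C > 0" "\<And>s x. s \<in> S \<Longrightarrow> norm (g s x) \<le> C * weight x"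
proof -
  obtain C where C: "C > 0" "\<And>s x. s \<in> S \<Longrightarrow> (1 + norm x) ^ (2 * CARD('n)) * norm (g s x) \<le> C"
    by (rule rapid_onE[OF assms]) blast
  have "norm (g s x) \<le> C * weight x" if "s \<in> S" for s x
  proof -
    have "inverse (weight x) * norm (g s x) \<le> (1 + norm x) ^ (2 * CARD('n)) * norm (g s x)"
      by (intro mult_right_mono inverse_weight_le) auto
    also have "\<dots> \<le> C" using C that by blast
    finally show ?thesis using weight_pos[of x] by (simp add: field_simps)
  qed
  with C(1) that show ?thesis by blast
qed

lemma Basis_vec_eq: "(Basis :: (real ^ 'n::finite) set) = range (\<lambda>i. axis i 1)"
  by (auto simp: Basis_vec_def)

lemma nn_integral_lborel_vec_prod:
  fixes h :: "'n::finite \<Rightarrow> real \<Rightarrow> ennreal"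
  assumes "\<And>i. h i \<in> borel_measurable borel"
  shows "(\<integral>\<^sup>+x. (\<Prod>i\<in>UNIV. h i (x $ i)) \<partial>(lborel :: (real ^ 'n) measure)) = (\<Prod>i\<in>UNIV. \<integral>\<^sup>+y. h i y \<partial>lborel)"
proof -
  have inj: "inj (\<lambda>i. axis i 1 :: real ^ 'n)" by (simp add: inj_def axis_eq_axis)
  define k where "k b = h (inv (\<lambda>i. axis i 1) b)" for b :: "real ^ 'n"
  have k: "k (axis i 1) = h i" for i by (simp add: k_def inv_f_f[OF inj])
  have "(\<integral>\<^sup>+x. (\<Prod>b\<in>Basis. k b (x \<bullet> b)) \<partial>(lborel :: (real ^ 'n) measure)) = (\<Prod>b\<in>Basis. \<integral>\<^sup>+y. k b y \<partial>lborel)"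
    by (rule nn_integral_lborel_prod) (auto simp: k_def assms)
  then show ?thesis
    unfolding Basis_vec_eq by (simp add: prod.reindex[OF inj] k inner_axis)
qed

lemma nn_integral_inverse_1_plus_square: "(\<integral>\<^sup>+y. ennreal (inverse (1 + y\<^sup>2)) \<partial>lborel) = ennreal pi"
proof -
  have "integrable lborel (\<lambda>y::real. inverse (1 + y\<^sup>2))"
    using integrable_inverse_1_plus_square by (simp add: set_integrable_def einterval_def)
  moreover have "(LINT y|lborel. inverse (1 + y\<^sup>2)) = pi"
    using LBINT_inverse_1_plus_square
    by (simp add: interval_lebesgue_integral_def set_lebesgue_integral_def einterval_def)
  ultimately show ?thesis by (subst nn_integral_eq_integral) (auto intro: add_nonneg_nonneg)
qed

lemma ennreal_weight: "ennreal (weight x) = (\<Prod>i\<in>UNIV. ennreal (inverse (1 + (x $ i)\<^sup>2)))"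
  unfolding weight_def by (rule prod_ennreal[symmetric]) (simp add: add_nonneg_nonneg)

lemma nn_integral_weight: "(\<integral>\<^sup>+x. ennreal (weight (x :: real ^ 'n::finite)) \<partial>lborel) = ennreal (pi ^ CARD('n))"
proof -
  have "(\<integral>\<^sup>+x. ennreal (weight (x :: real ^ 'n::finite)) \<partial>lborel) =
    (\<Prod>i\<in>(UNIV :: 'n set). \<integral>\<^sup>+y. ennreal (inverse (1 + y\<^sup>2)) \<partial>lborel)"
    unfolding ennreal_weight by (rule nn_integral_lborel_vec_prod) simp
  then show ?thesis unfolding nn_integral_inverse_1_plus_square by (simp add: ennreal_power)
qed

lemma integrable_weight: "integrable lborel (weight :: real ^ 'n::finite \<Rightarrow> real)"
  by (intro integrableI_nonneg) (auto simp: nn_integral_weight less_imp_le[OF weight_pos])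

lemma integrable_of_weight:
  fixes f :: "real ^ 'n::finite \<Rightarrow> 'b::{banach, second_countable_topology}"
  assumes "f \<in> borel_measurable borel" "\<And>x. norm (f x) \<le> C * weight x"
  shows "integrable lborel f"
proof (rule Bochner_Integration.integrable_bound)
  show "integrable lborel (\<lambda>x :: real ^ 'n. C * weight x)" by (simp add: integrable_weight)
qed (use assms in \<open>auto intro: order_trans[OF _ abs_ge_self]\<close>)

lemma rapid_integrable:
  fixes f :: "real ^ 'n::finite \<Rightarrow> 'b::{banach, second_countable_topology}"
  assumes "rapid f" "continuous_on UNIV f"
  shows "integrable lborel f"
proof -
  obtain C where "\<And>x. norm (f x) \<le> C * weight x" by (rule rapid_on_weight[OF assms(1)]) auto
  then show ?thesis using assms(2) by (auto intro!: integrable_of_weight borel_measurable_continuous_onI)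
qed

text \<open>The thin coordinate contributes at most width times \<open>m\<close>, each other
  coordinate contributes \<pi>. The slab is unbounded in the other directions, so two such slabs
  cover the change of any box shifted along coordinate \<open>i\<close>, whatever its shape.\<close>

lemma weight_slab:
  fixes i :: "'n::finite"
  assumes "c \<le> d" "0 \<le> m" "\<And>y. c \<le> y \<Longrightarrow> y \<le> d \<Longrightarrow> inverse (1 + y\<^sup>2) \<le> m"
  shows "(LINT x|lborel. indicator {x :: real ^ 'n. c \<le> x $ i \<and> x $ i \<le> d} x * weight x)
    \<le> (d - c) * m * pi ^ (CARD('n) - 1)"
proof -
  let ?h = "\<lambda>j y. (if j = i then indicator {c..d} y else 1) * ennreal (inverse (1 + y\<^sup>2))"
  have A[measurable]: "{x :: real ^ 'n. c \<le> x $ i \<and> x $ i \<le> d} \<in> sets borel"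
    by measurable
  have "(\<Prod>j\<in>UNIV. if j = i then indicator {c..d} (x $ j) else 1) =
      (indicator {x. c \<le> x $ i \<and> x $ i \<le> d} x :: ennreal)" for x :: "real ^ 'n"
    by (simp add: indicator_def)
  then have eq: "ennreal (indicator {x. c \<le> x $ i \<and> x $ i \<le> d} x * weight x) = (\<Prod>j\<in>UNIV. ?h j (x $ j))" for x :: "real ^ 'n"
    by (simp add: prod.distrib ennreal_weight[symmetric] ennreal_mult' ennreal_indicator)
  have 1: "(\<integral>\<^sup>+y. ?h i y \<partial>lborel) \<le> ennreal ((d - c) * m)"
  proof -
    have "(\<integral>\<^sup>+y. ?h i y \<partial>lborel) \<le> (\<integral>\<^sup>+y. ennreal m * indicator {c..d} y \<partial>lborel)"
      by (intro nn_integral_mono) (auto simp: indicator_def intro!: ennreal_leI assms)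
    also have "\<dots> = ennreal ((d - c) * m)"
      using assms by (simp add: nn_integral_cmult ennreal_mult mult.commute)
    finally show ?thesis .
  qed
  have "(\<integral>\<^sup>+x. ennreal (indicator {x. c \<le> x $ i \<and> x $ i \<le> d} x * weight x) \<partial>(lborel :: (real ^ 'n) measure)) =
      (\<Prod>j\<in>UNIV. \<integral>\<^sup>+y. ?h j y \<partial>lborel)"
    unfolding eq by (rule nn_integral_lborel_vec_prod) simp
  also have "\<dots> = (\<integral>\<^sup>+y. ?h i y \<partial>lborel) * (\<Prod>j\<in>UNIV - {i}. ennreal pi)"
    by (subst prod.remove[of _ i]) (auto intro!: prod.cong arg_cong2[where f="(*)"] simp: nn_integral_inverse_1_plus_square)
  also have "\<dots> \<le> ennreal ((d - c) * m) * ennreal (pi ^ (CARD('n) - 1))"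
    by (intro mult_mono 1) (auto simp: ennreal_power card_Diff_singleton)
  also have "\<dots> = ennreal ((d - c) * m * pi ^ (CARD('n) - 1))"
    using assms by (simp add: ennreal_mult)
  finally show ?thesis
    using assms(1,2)
    by (subst integral_eq_nn_integral) (auto simp: less_imp_le[OF weight_pos] intro!: enn2real_leI)
qed

text \<open>Increments for small positive \<open>s\<close> already determine the derivative. The
  lemma serves for the integral of a function over a shifted box.\<close>

lemma vector_derivative_norm_le:
  assumes "(J has_vector_derivative I) (at 0)" "\<And>s. 0 < s \<Longrightarrow> s \<le> 1 \<Longrightarrow> norm (J s - J 0) \<le> K * s"
  shows "norm I \<le> K"
proof (rule field_le_epsilon)
  fix e :: real assume "e > 0"
  then obtain d where d: "d > 0" "\<And>y. norm (y - 0) < d \<Longrightarrow> norm (J y - J 0 - (y - 0) *\<^sub>R I) \<le> e * norm (y - 0)"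
    using assms(1) unfolding has_vector_derivative_def has_derivative_within_alt by (metis UNIV_I)
  define s where "s = min 1 (d / 2)"
  have s: "0 < s" "s \<le> 1" "s < d" using d(1) by (auto simp: s_def)
  have "norm (s *\<^sub>R I) \<le> norm (J s - J 0) + norm (J s - J 0 - s *\<^sub>R I)"
    by (metis norm_triangle_sub norm_minus_commute add.commute)
  also have "\<dots> \<le> K * s + e * s" using d(2)[of s] assms(2)[of s] s by simp
  finally have "s * norm I \<le> s * (K + e)" using s by (simp add: algebra_simps)
  then show "norm I \<le> K + e" using s by simp
qed

text \<open>On a box the integral of a partial derivative is the derivative of the integral under
  translation, and the translated box differs from the box by two thin slabs, on which the
  decay of \<open>g\<close> gives a bound that is uniform in the shape of the box.\<close>

lemma has_integral_partial_zero:
  fixes g :: "real ^ 'n::finite \<Rightarrow> 'b::euclidean_space"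
  assumes g: "c1 g" and decay: "rapid g"
  shows "(partial i g has_integral 0) UNIV"
proof -
  let ?e = "axis i (1::real) :: real ^ 'n"
  obtain C where C: "C > 0" "\<And>x. norm (g x) \<le> C * weight x"
    by (rule rapid_on_weight[OF decay]) auto
  have cg: "continuous_on A g" and ch: "continuous_on A (partial i g)" for A
    using g by (auto intro: c1_continuous c1_continuous_partial)
  have gm[measurable]: "g \<in> borel_measurable borel"
    using cg by (rule borel_measurable_continuous_onI)
  define K where "K = C * pi ^ (CARD('n) - 1)"
  have K: "K > 0" using C by (simp add: K_def)
  have box: "norm (integral (cbox a b) (partial i g)) \<le> 2 * K / (B - 1)"
    if B: "B \<ge> 2" "ball 0 B \<subseteq> cbox a b" for a b B
  proof -
    \<comment> \<open>A closed box contains the closed ball too, hence the points at distance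
      exactly \<open>B\<close> on the axis; so both faces orthogonal to it are at distance at least
      \<open>B\<close> from the origin.\<close>
    have "cball 0 B \<subseteq> cbox a b"
      using closure_minimal[OF B(2) closed_cbox] B(1) by simp
    then have "B *\<^sub>R ?e \<in> cbox a b" "(- B) *\<^sub>R ?e \<in> cbox a b"
      using B(1) by (auto simp: norm_axis_1 simp del: scaleR_minus_left)
    then have bi: "b $ i \<ge> B" "a $ i \<le> - B"
      by (auto simp: mem_box_cart axis_def dest: spec[of _ i])
    define J where "J s = integral (cbox a b) (\<lambda>x. g (x + s *\<^sub>R ?e))" for s
    have "(J has_vector_derivative integral (cbox a b) (\<lambda>x. partial i g (x + 0 *\<^sub>R ?e))) (at 0 within UNIV)"
      unfolding J_def
    proof (rule leibniz_rule_vector_derivative)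
      show "((\<lambda>s. g (x + s *\<^sub>R ?e)) has_vector_derivative partial i g (x + s *\<^sub>R ?e)) (at s within UNIV)" for x s
        by (rule has_vector_derivative_along_axis[OF c1_differentiable[OF g]])
      show "(\<lambda>x. g (x + s *\<^sub>R ?e)) integrable_on cbox a b" for s
        by (intro integrable_continuous continuous_on_compose2[OF cg[of UNIV]] continuous_intros) auto
      show "continuous_on (UNIV \<times> cbox a b) (\<lambda>(s, x). partial i g (x + s *\<^sub>R ?e))"
        unfolding split_beta by (intro continuous_on_compose2[OF ch[of UNIV]] continuous_intros) auto
    qed auto
    then have J': "(J has_vector_derivative integral (cbox a b) (partial i g)) (at 0)" by simp
    have intJ: "integrable lborel (\<lambda>y. indicator (cbox a b) (y - s *\<^sub>R ?e) *\<^sub>R g y)"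
      and Js: "J s = (LINT y|lborel. indicator (cbox a b) (y - s *\<^sub>R ?e) *\<^sub>R g y)" for s
    proof -
      show "integrable lborel (\<lambda>y. indicator (cbox a b) (y - s *\<^sub>R ?e) *\<^sub>R g y)"
        using C less_imp_le[OF weight_pos]
        by (intro integrable_of_weight[where C=C]) (auto simp: indicator_def zero_le_mult_iff)
      have "set_integrable lborel (cbox a b) (\<lambda>x. g (x + s *\<^sub>R ?e))"
        unfolding set_integrable_def
        by (intro borel_integrable_compact compact_cbox continuous_on_compose2[OF cg[of UNIV]] continuous_intros) auto
      then have "J s = (LINT x|lborel. indicator (cbox a b) x *\<^sub>R g (x + s *\<^sub>R ?e))"
        unfolding J_def by (simp add: set_borel_integral_eq_integral(2)[symmetric] set_lebesgue_integral_def)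
      also have "\<dots> = (LINT y|distr lborel borel ((+) (s *\<^sub>R ?e)). indicator (cbox a b) (y - s *\<^sub>R ?e) *\<^sub>R g y)"
        by (subst integral_distr) (auto simp: add.commute)
      finally show "J s = (LINT y|lborel. indicator (cbox a b) (y - s *\<^sub>R ?e) *\<^sub>R g y)"
        unfolding lborel_distr_plus .
    qed
    have "norm (J s - J 0) \<le> 2 * K / (B - 1) * s" if s: "0 < s" "s \<le> 1" for s
    proof -
      let ?A = "\<lambda>c. {x :: real ^ 'n. c \<le> x $ i \<and> x $ i \<le> c + s}"
      \<comment> \<open>A shift by \<open>s \<le> 1\<close> keeps a slab outside
        \<open>\<bar>y\<bar> < B - 1\<close>. As \<open>B - 1 \<ge> 1\<close>, squaring it only
        makes it larger, whence the bound \<open>inverse (B - 1)\<close>.\<close>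
      have slab: "(LINT x|lborel. indicator (?A c) x * weight x) \<le> s * inverse (B - 1) * pi ^ (CARD('n) - 1)"
        if far: "\<And>y. c \<le> y \<Longrightarrow> y \<le> c + s \<Longrightarrow> B - 1 \<le> \<bar>y\<bar>" for c
      proof -
        have "inverse (1 + y\<^sup>2) \<le> inverse (B - 1)" if "c \<le> y" "y \<le> c + s" for y
        proof (rule le_imp_inverse_le)
          have "1 * (B - 1) \<le> (B - 1) * (B - 1)" using B(1) by (intro mult_right_mono) auto
          also have "\<dots> \<le> \<bar>y\<bar> * \<bar>y\<bar>" using far[OF that] B(1) by (intro mult_mono) auto
          finally show "B - 1 \<le> 1 + y\<^sup>2" by (simp add: power2_eq_square)
        qed (use B in auto)
        then show ?thesis using weight_slab[of c "c + s" "inverse (B - 1)" i] s B(1) by simp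
      qed
      have ind: "\<bar>indicator (cbox a b) (y - s *\<^sub>R ?e) - indicator (cbox a b) y\<bar> \<le>
          (indicator (?A (b $ i)) y + indicator (?A (a $ i)) y :: real)" for y
      proof -
        \<comment> \<open>Only coordinate \<open>i\<close> moves, and by \<open>s\<close>, so
          membership can change only within \<open>s\<close> above one of the two faces orthogonal
          to the axis.\<close>
        have "y - s *\<^sub>R ?e \<in> cbox a b \<longleftrightarrow> y \<in> cbox a b" if "y \<notin> ?A (b $ i)" "y \<notin> ?A (a $ i)"
        proof -
          have "(y - s *\<^sub>R ?e) $ j = (if j = i then y $ j - s else y $ j)" for j by (simp add: axis_def)
          moreover have "a $ i \<le> b $ i" using bi B by simp
          ultimately show ?thesis using that s unfolding mem_box_cart
            by simp (smt (verit, best))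
        qed
        then show ?thesis by (auto simp: indicator_def)
      qed
      have [measurable]: "?A c \<in> sets borel" for c by measurable
      have iA: "integrable lborel (\<lambda>x. indicator (?A c) x * weight x)" for c
        by (intro integrable_of_weight[where C=1]) (auto simp: indicator_def less_imp_le[OF weight_pos])
      have "norm (J s - J 0) = norm (LINT y|lborel. (indicator (cbox a b) (y - s *\<^sub>R ?e) - indicator (cbox a b) y) *\<^sub>R g y)"
        unfolding Js using intJ[of s] intJ[of 0]
        by (simp add: scaleR_diff_left flip: Bochner_Integration.integral_diff)
      also have "\<dots> \<le> (LINT y|lborel. C * (indicator (?A (b $ i)) y * weight y + indicator (?A (a $ i)) y * weight y))"
      proof (rule Bochner_Integration.integral_norm_bound_integral)
        show "integrable lborel (\<lambda>y. (indicator (cbox a b) (y - s *\<^sub>R ?e) - indicator (cbox a b) y) *\<^sub>R g y)"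
          using intJ[of s] intJ[of 0] by (simp add: scaleR_diff_left)
        show "integrable lborel (\<lambda>y. C * (indicator (?A (b $ i)) y * weight y + indicator (?A (a $ i)) y * weight y))"
          using iA by simp
        fix y
        have "\<bar>indicator (cbox a b) (y - s *\<^sub>R ?e) - indicator (cbox a b) y\<bar> * norm (g y) \<le>
          (indicator (?A (b $ i)) y + indicator (?A (a $ i)) y) * (C * weight y)"
          by (intro mult_mono ind C) auto
        then show "norm ((indicator (cbox a b) (y - s *\<^sub>R ?e) - indicator (cbox a b) y) *\<^sub>R g y) \<le>
          C * (indicator (?A (b $ i)) y * weight y + indicator (?A (a $ i)) y * weight y)"
          unfolding norm_scaleR by (simp add: algebra_simps)
      qed
      also have "\<dots> \<le> C * (s * inverse (B - 1) * pi ^ (CARD('n) - 1) + s * inverse (B - 1) * pi ^ (CARD('n) - 1))"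
        unfolding integral_mult_right_zero Bochner_Integration.integral_add[OF iA iA]
        using C(1) bi B(1) s by (intro mult_left_mono add_mono slab) auto
      also have "\<dots> = 2 * K / (B - 1) * s"
        by (simp add: K_def divide_inverse)
      finally show ?thesis .
    qed
    then show ?thesis using vector_derivative_norm_le[OF J'] by blast
  qed
  have nb: "\<not> (\<exists>a b. (UNIV :: (real ^ 'n) set) = cbox a b)"
    using bounded_cbox not_bounded_UNIV by metis
  show ?thesis
  proof (subst has_integral_alt, subst if_not_P[OF nb], intro allI impI)
    fix e :: real assume e: "e > 0"
    \<comment> \<open>This makes \<open>B - 1\<close> exceed \<open>2 * K / e\<close>. The integral
      over the whole space tests every box containing a large ball, with no control of the ratios of
      its sides.\<close>
    define B where "B = 2 + 2 * K / e"
    have B: "B \<ge> 2" "2 * K / (B - 1) < e"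
      using K e by (auto simp: B_def field_simps)
    show "\<exists>B>0. \<forall>a b. ball 0 B \<subseteq> cbox a b \<longrightarrow>
      (\<exists>z. ((\<lambda>x. if x \<in> UNIV then partial i g x else 0) has_integral z) (cbox a b) \<and> norm (z - 0) < e)"
    proof (intro exI[of _ B] conjI allI impI)
      fix a b :: "real ^ 'n" assume "ball 0 B \<subseteq> cbox a b"
      then show "\<exists>z. ((\<lambda>x. if x \<in> UNIV then partial i g x else 0) has_integral z) (cbox a b) \<and> norm (z - 0) < e"
        using box[OF B(1), of a b] B(2) integrable_continuous[OF ch]
        by (intro exI[of _ "integral (cbox a b) (partial i g)"]) auto
    qed (use B in auto)
  qed
qed

section \<open>Radial weights\<close>

text \<open>Indexed bounded subsets of the Schwartz space: each seminorm is bounded uniformly in the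
  index.\<close>

definition schwartz_on :: "'s set \<Rightarrow> ('s \<Rightarrow> real ^ 'n::finite \<Rightarrow> complex) \<Rightarrow> bool" where
  "schwartz_on S g \<longleftrightarrow> (\<forall>s\<in>S. smooth (g s)) \<and> (\<forall>is. rapid_on S (\<lambda>s. partials is (g s)))"

lemma schwartz_on_smooth: "schwartz_on S g \<Longrightarrow> s \<in> S \<Longrightarrow> smooth (g s)"
  by (simp add: schwartz_on_def)

lemma schwartz_on_rapid: "schwartz_on S g \<Longrightarrow> rapid_on S g"
  unfolding schwartz_on_def by (metis (no_types, lifting) ext partials.simps(1))

lemma schwartz_on_partials: "schwartz_on S g \<Longrightarrow> schwartz_on S (\<lambda>s. partials js (g s))"
  unfolding schwartz_on_def by (auto simp: smooth_partials partials_append[symmetric])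

lemma schwartz_on_partial: "schwartz_on S g \<Longrightarrow> schwartz_on S (\<lambda>s. partial i (g s))"
  using schwartz_on_partials[of S g "[i]"] by simp

lemma schwartz_on_reindex:
  assumes "schwartz_on S g" "\<And>s. s \<in> S' \<Longrightarrow> k s \<in> S"
  shows "schwartz_on S' (\<lambda>s. g (k s))"
  unfolding schwartz_on_def
proof (intro conjI allI ballI)
  show "smooth (g (k s))" if "s \<in> S'" for s
    using assms that by (simp add: schwartz_on_def)
  show "rapid_on S' (\<lambda>s. partials is (g (k s)))" for "is"
    by (rule rapid_on_reindex[where S=S]) (use assms in \<open>auto simp: schwartz_on_def\<close>)
qed

lemma schwartz_schwartz_on:
  assumes "f \<in> schwartz"
  shows "schwartz_on S (\<lambda>_. f)"
proof -
  have "\<exists>C. \<forall>x. (1 + norm x) ^ N * norm (partials is f x) \<le> C" for N "is"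
  proof -
    have "bounded (range (\<lambda>x. (1 + norm x) ^ N * norm (partials is f x)))"
      using assms unfolding schwartz_def by auto
    then obtain B where B: "\<And>x. norm ((1 + norm x) ^ N * norm (partials is f x)) \<le> B"
      unfolding bounded_iff by auto
    have "(1 + norm x) ^ N * norm (partials is f x) \<le> B" for x
      using B[of x] by (auto intro: order_trans[OF abs_ge_self])
    then show ?thesis by blast
  qed
  then show ?thesis using assms by (auto simp: schwartz_on_def rapid_on_def schwartz_def)
qed

lemma laplacian_eq: "laplacian f = (\<lambda>x. \<Sum>i\<in>UNIV. partial i (partial i f) x)"
  by (rule ext) (simp add: laplacian_def)

lemma rapid_on_laplacian: "schwartz_on S g \<Longrightarrow> rapid_on S (\<lambda>s. laplacian (g s))"
  unfolding laplacian_eq by (intro rapid_on_sum schwartz_on_rapid schwartz_on_partial)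

lemma smooth_c1_laplacian: "smooth f \<Longrightarrow> c1 (laplacian f)"
  unfolding laplacian_eq by (intro c1_intros smooth_c1 smooth_partial)

lemma partial_laplacian:
  "smooth f \<Longrightarrow> partial k (laplacian f) = (\<lambda>x. \<Sum>i\<in>UNIV. partial k (partial i (partial i f)) x)"
  unfolding laplacian_eq by (rule ext, rule partial_sum) (intro smooth_differentiable smooth_partial)

lemma smooth_c1_partial_laplacian: "smooth f \<Longrightarrow> c1 (partial k (laplacian f))"
  unfolding partial_laplacian by (intro c1_intros smooth_c1 smooth_partial)

lemma slow_poly: "slow_on S (\<lambda>s x. poly P (norm x))"
proof (induction P)
  case 0 then show ?case by (simp add: slow_on_const)
next
  case (pCons a P)
  have "slow_on S (\<lambda>s (x::'b). norm x)"
    unfolding slow_on_def by (rule exI[of _ 1], rule exI[of _ 1]) auto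
  then have "slow_on S (\<lambda>s (x::'b). a + norm x * poly P (norm x))"
    by (intro slow_on_add slow_on_mult slow_on_const pCons)
  then show ?case by simp
qed

text \<open>The radial formulas divide by \<open>norm x\<close> and give usable bounds only away
  from the origin. On the remaining ball continuity and compactness take over.\<close>

lemma slow_of_far:
  fixes h :: "'a::euclidean_space \<Rightarrow> 'b::real_normed_vector"
  assumes "continuous_on UNIV h" "slow g" "\<And>x. norm x \<ge> R \<Longrightarrow> norm (h x) \<le> norm (g x)"
  shows "slow h"
proof -
  have "compact (h ` cball 0 R)"
    by (intro compact_continuous_image continuous_on_subset[OF assms(1)]) auto
  then have "bounded (h ` cball 0 R)" by (rule compact_imp_bounded)
  then obtain B where B: "\<forall>x\<in>cball 0 R. norm (h x) \<le> B" unfolding bounded_iff by auto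
  have le: "norm (h x) \<le> 1 * norm (\<bar>B\<bar> + norm (g x))" for x
  proof (cases "norm x \<ge> R")
    case True
    then show ?thesis using assms(3)[of x] by simp
  next
    case False
    then have "norm (h x) \<le> B" using B by auto
    then show ?thesis by (simp add: add_increasing2 order_trans[OF _ abs_ge_self])
  qed
  have "slow (\<lambda>x. \<bar>B\<bar> + norm (g x))"
    by (intro slow_on_add slow_on_const slow_on_le[OF assms(2), where C=1]) simp
  then show ?thesis by (rule slow_on_le[OF _ le])
qed

lemma partial_radial:
  fixes x :: "real ^ 'n::finite"
  assumes "(\<phi> has_real_derivative d) (at (norm x))" "x \<noteq> 0"
  shows "partial i (\<lambda>y. \<phi> (norm y)) x = d * (x $ i / norm x)"
    and "(\<lambda>y. \<phi> (norm y)) differentiable (at x)"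
proof -
  have "(norm has_derivative (\<lambda>h. h \<bullet> sgn x)) (at x)"
    using has_derivative_norm[OF assms(2)] .
  from has_derivative_compose[OF this assms(1)[unfolded has_field_derivative_def]]
  have *: "((\<lambda>y. \<phi> (norm y)) has_derivative (\<lambda>h. d * (h \<bullet> sgn x))) (at x)" by simp
  show "partial i (\<lambda>y. \<phi> (norm y)) x = d * (x $ i / norm x)"
    by (subst partial_eqI[OF *]) (simp add: sgn_div_norm inner_axis inner_commute divide_inverse mult.commute)
  show "(\<lambda>y. \<phi> (norm y)) differentiable (at x)" using * unfolding differentiable_def by blast
qed

text \<open>Only the values of \<open>\<rho>\<close> on the nonnegative half-line are tied to
  \<open>\<psi>\<close>, so its derivatives carry information only at \<open>r > 0\<close>.\<close>

locale radial_weight =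
  fixes \<psi> :: "real ^ 'n::finite \<Rightarrow> real" and \<rho> :: "real \<Rightarrow> real"
    and C \<psi>'_inf :: real and P :: "real poly"
  assumes smooth: "smooth \<psi>"
    and radial: "\<And>x. \<psi> x = \<rho> (norm x)"
    and bound: "\<And>k r. k \<in> {1, 2, 3} \<Longrightarrow> r > 0 \<Longrightarrow> \<bar>(deriv ^^ k) \<rho> r\<bar> \<le> C * \<bar>poly P r\<bar>"
    and limit: "(deriv \<rho> \<longlongrightarrow> \<psi>'_inf) at_top"
begin

text \<open>On a coordinate ray \<open>\<psi>\<close> coincides with \<open>\<rho>\<close>, so
  smoothness of \<open>\<psi>\<close> passes to the profile. The induction uses that a derivative at
  \<open>r > 0\<close> depends only on values near \<open>r\<close>.\<close>

lemma iterated_deriv_eq: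
  "r > 0 \<Longrightarrow> (deriv ^^ k) \<rho> r = partials (replicate k i) \<psi> (r *\<^sub>R axis i 1)"
proof (induction k arbitrary: r)
  case 0
  then show ?case by (simp add: radial norm_axis_1)
next
  case (Suc k)
  let ?g = "partials (replicate k i) \<psi>"
  have "((\<lambda>s. ?g (0 + s *\<^sub>R axis i 1)) has_vector_derivative partial i ?g (0 + r *\<^sub>R axis i 1)) (at r)"
    by (rule has_vector_derivative_along_axis) (use smooth smooth_partials smooth_differentiable in blast)
  then have "((\<lambda>s. ?g (s *\<^sub>R axis i 1)) has_real_derivative partial i ?g (r *\<^sub>R axis i 1)) (at r)"
    by (simp add: has_real_derivative_iff_has_vector_derivative)
  then have "((deriv ^^ k) \<rho> has_real_derivative partial i ?g (r *\<^sub>R axis i 1)) (at r)"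
    by (rule DERIV_cong_ev[THEN iffD1, rotated 3])
      (use Suc eventually_nhds_in_open[of "{0<..}" r] in \<open>auto elim!: eventually_mono\<close>)
  then show ?case by (simp add: DERIV_imp_deriv)
qed

text \<open>\<open>deriv\<close> is a total operator; here its values at \<open>r > 0\<close> are
  certified to be genuine derivatives. Any coordinate direction \<open>i\<close> serves for
  this.\<close>

lemma iterated_deriv_DERIV:
  assumes "r > 0"
  shows "((deriv ^^ k) \<rho> has_real_derivative (deriv ^^ Suc k) \<rho> r) (at r)"
proof -
  fix i :: 'n
  let ?g = "partials (replicate k i) \<psi>"
  have "((\<lambda>s. ?g (0 + s *\<^sub>R axis i 1)) has_vector_derivative partial i ?g (0 + r *\<^sub>R axis i 1)) (at r)"
    by (rule has_vector_derivative_along_axis) (use smooth smooth_partials smooth_differentiable in blast)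
  then have "((\<lambda>s. ?g (s *\<^sub>R axis i 1)) has_real_derivative (deriv ^^ Suc k) \<rho> r) (at r)"
    using iterated_deriv_eq[OF assms, of "Suc k" i]
    by (simp add: has_real_derivative_iff_has_vector_derivative)
  then show ?thesis
    by (rule DERIV_cong_ev[THEN iffD1, rotated 3])
      (use assms iterated_deriv_eq[of _ k i] eventually_nhds_in_open[of "{0<..}" r] in \<open>auto elim!: eventually_mono\<close>)
qed

abbreviation "\<rho>1 \<equiv> deriv \<rho>"
abbreviation "\<rho>2 \<equiv> deriv \<rho>1"
abbreviation "\<rho>3 \<equiv> deriv \<rho>2"

lemma DERIV_radial:
  assumes "r > 0"
  shows "(\<rho> has_real_derivative \<rho>1 r) (at r)" "(\<rho>1 has_real_derivative \<rho>2 r) (at r)"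
    "(\<rho>2 has_real_derivative \<rho>3 r) (at r)"
  using iterated_deriv_DERIV[OF assms, of 0] iterated_deriv_DERIV[OF assms, of 1]
    iterated_deriv_DERIV[OF assms, of 2]
  by (simp_all add: numeral_2_eq_2)

lemma partial_psi: "x \<noteq> 0 \<Longrightarrow> partial i \<psi> x = \<rho>1 (norm x) * (x $ i / norm x)"
proof -
  assume x: "x \<noteq> 0"
  have "\<psi> = (\<lambda>y. \<rho> (norm y))" by (rule ext) (rule radial)
  then show ?thesis using partial_radial(1)[OF DERIV_radial(1) x] x by simp
qed

lemma laplacian_psi:
  assumes "x \<noteq> 0"
  shows "laplacian \<psi> x = \<rho>2 (norm x) + (CARD('n) - 1) * (\<rho>1 (norm x) / norm x)"
proof -
  let ?r = "norm x"
  have r: "?r > 0" using assms by simp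
  \<comment> \<open>Writing the gradient as \<open>q (norm x)\<close> times \<open>x\<close> leaves
    a product of a radial function with a coordinate, to which the product rule applies.\<close>
  define q where "q r = \<rho>1 r / r" for r
  define q' where "q' = (\<rho>2 ?r * ?r - \<rho>1 ?r) / (?r * ?r)"
  have q: "(q has_real_derivative q') (at ?r)"
    unfolding q_def q'_def using DERIV_divide[OF DERIV_radial(2)[OF r] DERIV_ident] r by simp
  have "partial i (partial i \<psi>) x = q ?r * 1 + q' * (x $ i / ?r) * x $ i" for i
  proof -
    have "partial i (partial i \<psi>) x = partial i (\<lambda>y. q (norm y) * y $ i) x"
      by (rule partial_cong_open[of "- {0}"]) (use assms in \<open>auto simp: partial_psi q_def\<close>)
    also have "\<dots> = q ?r * partial i (\<lambda>y. y $ i) x + partial i (\<lambda>y. q (norm y)) x * x $ i"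
      by (rule partial_mult[OF partial_radial(2)[OF q assms]])
        (rule linear_imp_differentiable[OF bounded_linear.linear[OF bounded_linear_vec_nth]])
    finally show ?thesis by (simp add: partial_component partial_radial(1)[OF q assms])
  qed
  then have "laplacian \<psi> x = CARD('n) * q ?r + q' / ?r * (\<Sum>i\<in>UNIV. x $ i * x $ i)"
    by (simp add: laplacian_def sum.distrib sum_distrib_left mult.assoc)
  also have "(\<Sum>i\<in>UNIV. x $ i * x $ i) = ?r * ?r"
    using dot_square_norm[of x] by (simp add: inner_vec_def power2_eq_square)
  also have "q' / ?r * (?r * ?r) = \<rho>2 ?r - q ?r"
    using r by (simp add: q'_def q_def field_simps)
  finally show ?thesis by (simp add: q_def algebra_simps diff_divide_distrib)
qed

lemma partial_laplacian_psi:
  assumes "x \<noteq> 0"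
  shows "partial k (laplacian \<psi>) x =
    (\<rho>3 (norm x) + (CARD('n) - 1) * ((\<rho>2 (norm x) * norm x - \<rho>1 (norm x)) / (norm x * norm x))) * (x $ k / norm x)"
proof -
  have r: "norm x > 0" using assms by simp
  have "((\<lambda>r. \<rho>2 r + (CARD('n) - 1) * (\<rho>1 r / r)) has_real_derivative
    \<rho>3 (norm x) + (CARD('n) - 1) * ((\<rho>2 (norm x) * norm x - \<rho>1 (norm x)) / (norm x * norm x))) (at (norm x))"
    using DERIV_divide[OF DERIV_radial(2)[OF r] DERIV_ident] r
    by (intro DERIV_add DERIV_radial r DERIV_cmult) simp
  from partial_radial(1)[OF this assms]
  show ?thesis
    by (subst partial_cong_open[of "- {0}" x _ "\<lambda>y. \<rho>2 (norm y) + (CARD('n) - 1) * (\<rho>1 (norm y) / norm y)"])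
      (use assms in \<open>auto simp: laplacian_psi\<close>)
qed

lemma radial_bounds:
  assumes "r > 0"
  shows "\<bar>\<rho>1 r\<bar> \<le> C * \<bar>poly P r\<bar>" "\<bar>\<rho>2 r\<bar> \<le> C * \<bar>poly P r\<bar>" "\<bar>\<rho>3 r\<bar> \<le> C * \<bar>poly P r\<bar>"
  using bound[of 1 r] bound[of 2 r] bound[of 3 r] assms by (simp_all add: numeral_2_eq_2 numeral_3_eq_3)

lemma component_div_norm_le: "\<bar>x $ i / norm x\<bar> \<le> 1" for x :: "real ^ 'n"
  by (cases "x = 0") (auto simp: component_le_norm_cart)

text \<open>For \<open>norm x \<ge> 1\<close> the division by the radius only helps. In the
  constant, \<open>1\<close> pays for the second radial derivative and \<open>CARD('n)\<close> for
  the term with the first one.\<close>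

lemma slow_laplacian_psi: "slow (laplacian \<psi>)"
proof (rule slow_of_far[where R=1])
  show "continuous_on UNIV (laplacian \<psi>)" by (rule c1_continuous[OF smooth_c1_laplacian[OF smooth]])
  show "slow (\<lambda>x :: real ^ 'n. (1 + CARD('n)) * (C * poly P (norm x)))"
    by (intro slow_on_mult slow_on_const slow_poly)
  fix x :: "real ^ 'n" assume x: "1 \<le> norm x"
  then have x0: "x \<noteq> 0" and r: "norm x > 0" by auto
  have C: "C * \<bar>poly P (norm x)\<bar> \<ge> 0" using radial_bounds(1)[OF r] by linarith
  have "\<bar>\<rho>1 (norm x) / norm x\<bar> \<le> \<bar>\<rho>1 (norm x)\<bar>"
    using r x mult_left_mono[of 1 "norm x" "\<bar>\<rho>1 (norm x)\<bar>"] by (simp add: divide_le_eq)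
  then have 1: "\<bar>\<rho>1 (norm x) / norm x\<bar> \<le> C * \<bar>poly P (norm x)\<bar>" using radial_bounds(1)[OF r] by simp
  have "\<bar>(CARD('n) - 1) * (\<rho>1 (norm x) / norm x)\<bar> \<le> CARD('n) * (C * \<bar>poly P (norm x)\<bar>)"
    unfolding abs_mult by (intro mult_mono 1) auto
  then have "norm (laplacian \<psi> x) \<le> C * \<bar>poly P (norm x)\<bar> + CARD('n) * (C * \<bar>poly P (norm x)\<bar>)"
    unfolding laplacian_psi[OF x0] real_norm_def
    by (intro order_trans[OF abs_triangle_ineq] add_mono radial_bounds(2) r)
  also have "\<dots> = (1 + CARD('n)) * (C * \<bar>poly P (norm x)\<bar>)" by (simp add: algebra_simps)
  also have "\<dots> \<le> norm ((1 + CARD('n)) * (C * poly P (norm x)))"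
    using C by (auto simp: abs_mult intro!: mult_left_mono mult_right_mono)
  finally show "norm (laplacian \<psi> x) \<le> norm ((1 + CARD('n)) * (C * poly P (norm x)))" .
qed

lemma slow_partial_laplacian_psi: "slow (partial k (laplacian \<psi>))"
proof (rule slow_of_far[where R=1])
  show "continuous_on UNIV (partial k (laplacian \<psi>))"
    by (rule c1_continuous[OF smooth_c1_partial_laplacian[OF smooth]])
  show "slow (\<lambda>x :: real ^ 'n. (1 + 2 * CARD('n)) * (C * poly P (norm x)))"
    by (intro slow_on_mult slow_on_const slow_poly)
  fix x :: "real ^ 'n" assume x: "1 \<le> norm x"
  then have x0: "x \<noteq> 0" and r: "norm x > 0" by auto
  let ?r = "norm x" and ?B = "C * \<bar>poly P (norm x)\<bar>"
  have C: "?B \<ge> 0" using radial_bounds(1)[OF r] by linarith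
  have "\<bar>(\<rho>2 ?r * ?r - \<rho>1 ?r) / (?r * ?r)\<bar> \<le> (?B * ?r + ?B) / (?r * ?r)"
    unfolding abs_divide using r
    by (auto intro!: divide_right_mono order_trans[OF abs_triangle_ineq4] add_mono radial_bounds simp: abs_mult)
  also have "\<dots> \<le> 2 * ?B"
  proof -
    have "?r \<le> ?r * ?r" "1 \<le> ?r * ?r" using mult_mono[of 1 ?r 1 ?r] mult_right_mono[OF x, of ?r] x by auto
    from this[THEN mult_left_mono, OF C] show ?thesis using r by (simp add: divide_le_eq)
  qed
  finally have 1: "\<bar>(\<rho>2 ?r * ?r - \<rho>1 ?r) / (?r * ?r)\<bar> \<le> 2 * ?B" .
  have "\<bar>(CARD('n) - 1) * ((\<rho>2 ?r * ?r - \<rho>1 ?r) / (?r * ?r))\<bar> \<le> CARD('n) * (2 * ?B)"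
    unfolding abs_mult by (intro mult_mono 1) auto
  then have "\<bar>\<rho>3 ?r + (CARD('n) - 1) * ((\<rho>2 ?r * ?r - \<rho>1 ?r) / (?r * ?r))\<bar> \<le> ?B + CARD('n) * (2 * ?B)"
    by (intro order_trans[OF abs_triangle_ineq] add_mono radial_bounds(3) r)
  then have "norm (partial k (laplacian \<psi>) x) \<le> (?B + CARD('n) * (2 * ?B)) * 1"
    unfolding partial_laplacian_psi[OF x0] real_norm_def abs_mult[of _ "x $ k / norm x"]
    using C by (intro mult_mono component_div_norm_le) auto
  also have "\<dots> = (1 + 2 * CARD('n)) * ?B" by (simp add: algebra_simps)
  also have "\<dots> \<le> norm ((1 + 2 * CARD('n)) * (C * poly P (norm x)))"
    using C by (auto simp: abs_mult intro!: mult_left_mono mult_right_mono)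
  finally show "norm (partial k (laplacian \<psi>) x) \<le> norm ((1 + 2 * CARD('n)) * (C * poly P (norm x)))" .
qed

text \<open>The finite limit of the radial derivative bounds the gradient far out, compactness
  bounds it near the origin. A polynomial bound would not do for the asymptotics: there the gradient
  is evaluated at \<open>(4 * pi * t) *\<^sub>R \<xi>\<close> and has to be bounded uniformly in
  \<open>t\<close>.\<close>

lemma partial_psi_bounded: "\<exists>K. \<forall>i x. \<bar>partial i \<psi> x\<bar> \<le> K"
proof -
  have "eventually (\<lambda>r. dist (\<rho>1 r) \<psi>'_inf < 1) at_top" using limit by (rule tendstoD) simp
  then obtain R where R: "\<And>r. r \<ge> R \<Longrightarrow> \<bar>\<rho>1 r - \<psi>'_inf\<bar> < 1"
    unfolding eventually_at_top_linorder by (auto simp: dist_real_def)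
  have "\<exists>B. \<forall>x\<in>cball 0 (max R 1). norm (partial i \<psi> x) \<le> B" for i
  proof -
    have "compact (partial i \<psi> ` cball 0 (max R 1))"
      by (intro compact_continuous_image smooth_continuous smooth_partial smooth) auto
    from compact_imp_bounded[OF this] show ?thesis unfolding bounded_iff by auto
  qed
  then obtain B where B: "\<And>i x. x \<in> cball 0 (max R 1) \<Longrightarrow> norm (partial i \<psi> x) \<le> B i" by metis
  have "\<bar>partial i \<psi> x\<bar> \<le> (\<bar>\<psi>'_inf\<bar> + 1) + (\<Sum>j\<in>UNIV. \<bar>B j\<bar>)" for i x
  proof (cases "norm x \<le> max R 1")
    case True
    then have "\<bar>partial i \<psi> x\<bar> \<le> \<bar>B i\<bar>" using B[of x i] by simp
    also have "\<dots> \<le> (\<Sum>j\<in>UNIV. \<bar>B j\<bar>)" by (intro member_le_sum) auto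
    finally show ?thesis by simp
  next
    case False
    then have x: "x \<noteq> 0" and "norm x \<ge> R" by auto
    then have "\<bar>\<rho>1 (norm x)\<bar> \<le> \<bar>\<psi>'_inf\<bar> + 1" using R[of "norm x"] by simp
    then have "\<bar>partial i \<psi> x\<bar> \<le> (\<bar>\<psi>'_inf\<bar> + 1) * 1"
      unfolding partial_psi[OF x] abs_mult by (intro mult_mono component_div_norm_le) auto
    moreover have "0 \<le> (\<Sum>j\<in>UNIV. \<bar>B j\<bar>)" by (intro sum_nonneg) auto
    ultimately show ?thesis using add_mono by fastforce
  qed
  then show ?thesis by blast
qed

lemma slow_partial_psi: "slow (partial i \<psi>)"
proof -
  obtain K where "\<forall>i x. \<bar>partial i \<psi> x\<bar> \<le> K" using partial_psi_bounded by blast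
  then show ?thesis by (intro slow_on_bounded[where C=K]) auto
qed

end

section \<open>The virial identity\<close>

lemma rapid_c1_integrable:
  fixes g :: "real ^ 'n::finite \<Rightarrow> 'b::{banach, second_countable_topology}"
  shows "rapid g \<Longrightarrow> c1 g \<Longrightarrow> integrable lborel g"
  by (intro rapid_integrable c1_continuous)

text \<open>The pointwise identity behind the virial theorem, with \<open>a\<close>, \<open>H\<close>, \<open>L\<close>, \<open>d\<close>, \<open>dd\<close> for
  \<open>\<partial>\<^sub>j\<psi>\<close>, \<open>\<partial>\<^sub>k\<partial>\<^sub>j\<psi>\<close>, \<open>\<Delta>\<psi>\<close>, \<open>\<partial>\<^sub>k\<Delta>\<psi>\<close>, \<open>\<partial>\<^sub>k\<^sup>2\<Delta>\<psi>\<close>, with \<open>V\<close>, \<open>q\<close>, \<open>Q\<close> for \<open>v\<close> and its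
  derivatives, and with \<open>W\<close>, \<open>c\<close>, \<open>R\<close> for their conjugates.\<close>

lemma virial_algebra:
  fixes a q c :: "'n::finite \<Rightarrow> complex" and H Q R :: "'n \<Rightarrow> 'n \<Rightarrow> complex" and V W L :: complex
  assumes H: "\<And>j k. H j k = H k j" and Q: "\<And>j k. Q j k = Q k j" and R: "\<And>j k. R j k = R k j"
    and L: "L = (\<Sum>k\<in>UNIV. H k k)"
  shows "(\<Sum>j\<in>UNIV. \<Sum>k\<in>UNIV. c j * H j k * q k) - 1/4 * (W * V * (\<Sum>k\<in>UNIV. dd k))
    + (\<Sum>k\<in>UNIV. (\<Sum>j\<in>UNIV. - (1/2) * (H j k * (c j * q k + q j * c k)
            + a j * (R j k * q k + c j * Q k k + Q j k * c k + q j * R k k)))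
        + 1/2 * (H k k * (\<Sum>j\<in>UNIV. c j * q j) + a k * (\<Sum>j\<in>UNIV. R j k * q j + c j * Q j k))
        - 1/4 * (d k * (W * q k + V * c k) + L * (c k * q k + W * Q k k + q k * c k + V * R k k))
        + 1/4 * (dd k * (W * V) + d k * (c k * V + W * q k)))
    = - (1/2) * (((\<Sum>j\<in>UNIV. a j * c j) + 1/2 * L * W) * (\<Sum>k\<in>UNIV. Q k k)
        + ((\<Sum>j\<in>UNIV. a j * q j) + 1/2 * L * V) * (\<Sum>k\<in>UNIV. R k k))"
proof -
  let ?S = "\<lambda>f :: 'n \<Rightarrow> 'n \<Rightarrow> complex. \<Sum>k\<in>UNIV. \<Sum>j\<in>UNIV. f k j"
  \<comment> \<open>Exchanging \<open>j\<close> and \<open>k\<close>, together with the symmetry of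
    \<open>H\<close>, \<open>Q\<close> and \<open>R\<close>, reduces the mixed double sums to three:
    \<open>c j * q k * H j k\<close>, \<open>a j * (R j k * q k)\<close> and
    \<open>a j * (Q j k * c k)\<close>.\<close>
  have swap: "?S f = ?S (\<lambda>k j. f j k)" for f by (rule sum.swap)
  have e1: "?S (\<lambda>k j. q j * c k * H j k) = ?S (\<lambda>k j. c j * q k * H j k)"
    by (subst swap) (simp add: H ac_simps)
  have e1': "?S (\<lambda>j k. c j * H j k * q k) = ?S (\<lambda>k j. c j * q k * H j k)"
    by (subst swap) (simp add: H ac_simps)
  have e2: "?S (\<lambda>k j. a k * (R j k * q j)) = ?S (\<lambda>k j. a j * (R j k * q k))"
    by (subst swap) (simp add: R)
  have e3: "?S (\<lambda>k j. a k * (c j * Q j k)) = ?S (\<lambda>k j. a j * (Q j k * c k))"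
    by (subst swap) (simp add: Q ac_simps)
  have t1: "(\<Sum>k\<in>UNIV. \<Sum>j\<in>UNIV. - (1/2) * (H j k * (c j * q k + q j * c k)
            + a j * (R j k * q k + c j * Q k k + Q j k * c k + q j * R k k)))
     = - ?S (\<lambda>k j. c j * q k * H j k)
       - 1/2 * (?S (\<lambda>k j. a j * (R j k * q k)) + ?S (\<lambda>k j. a j * (Q j k * c k))
         + (\<Sum>j\<in>UNIV. a j * c j) * (\<Sum>k\<in>UNIV. Q k k) + (\<Sum>j\<in>UNIV. a j * q j) * (\<Sum>k\<in>UNIV. R k k))"
  proof -
    have "?S (\<lambda>k j. a j * c j * Q k k) = (\<Sum>j\<in>UNIV. a j * c j) * (\<Sum>k\<in>UNIV. Q k k)"
      "?S (\<lambda>k j. a j * q j * R k k) = (\<Sum>j\<in>UNIV. a j * q j) * (\<Sum>k\<in>UNIV. R k k)"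
      by (simp_all add: sum_product sum.swap[of "\<lambda>j k. a j * _ j * _ k k"] sum_distrib_left sum_distrib_right)
    moreover have "(\<Sum>k\<in>UNIV. \<Sum>j\<in>UNIV. - (1/2) * (H j k * (c j * q k + q j * c k)
            + a j * (R j k * q k + c j * Q k k + Q j k * c k + q j * R k k)))
      = - (1/2) * (?S (\<lambda>k j. c j * q k * H j k) + ?S (\<lambda>k j. q j * c k * H j k)
         + ?S (\<lambda>k j. a j * (R j k * q k)) + ?S (\<lambda>k j. a j * (Q j k * c k))
         + ?S (\<lambda>k j. a j * c j * Q k k) + ?S (\<lambda>k j. a j * q j * R k k))"
      unfolding sum_distrib_left[symmetric] sum.distrib[symmetric] by (simp add: algebra_simps)
    ultimately show ?thesis unfolding e1 by (simp add: algebra_simps)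
  qed
  \<comment> \<open>The inner sum is generalized to \<open>X\<close>, so that it stays an atom while
    the other sums are expanded.\<close>
  have t2': "(\<Sum>k\<in>UNIV. 1/2 * (H k k * X + a k * (\<Sum>j\<in>UNIV. R j k * q j + c j * Q j k)))
    = 1/2 * (L * X + ?S (\<lambda>k j. a j * (R j k * q k)) + ?S (\<lambda>k j. a j * (Q j k * c k)))" for X
    unfolding e2[symmetric] e3[symmetric] L sum_distrib_right
    by (simp add: sum.distrib sum_distrib_left algebra_simps)
  note t2 = t2'[of "\<Sum>j\<in>UNIV. c j * q j"]
  have t3: "(\<Sum>k\<in>UNIV. 1/4 * (d k * (W * q k + V * c k) + L * (c k * q k + W * Q k k + q k * c k + V * R k k)))
    = 1/4 * ((\<Sum>k\<in>UNIV. d k * (W * q k + V * c k)) + 2 * (L * (\<Sum>k\<in>UNIV. c k * q k))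
        + L * W * (\<Sum>k\<in>UNIV. Q k k) + L * V * (\<Sum>k\<in>UNIV. R k k))"
    by (simp add: sum.distrib sum_distrib_left algebra_simps)
  have t4: "(\<Sum>k\<in>UNIV. 1/4 * (dd k * (W * V) + d k * (c k * V + W * q k)))
    = 1/4 * (W * V * (\<Sum>k\<in>UNIV. dd k) + (\<Sum>k\<in>UNIV. d k * (W * q k + V * c k)))"
    by (simp add: sum.distrib sum_distrib_left algebra_simps)
  have split: "(\<Sum>k\<in>UNIV. E1 k + E2 k - E3 k + E4 k) =
      (\<Sum>k\<in>UNIV. E1 k) + (\<Sum>k\<in>UNIV. E2 k) - (\<Sum>k\<in>UNIV. E3 k) + (\<Sum>k\<in>UNIV. E4 k)"
    for E1 E2 E3 E4 :: "'n \<Rightarrow> complex"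
    by (simp add: sum.distrib sum_subtractf)
  show ?thesis
    unfolding split t1 t2 t3 t4 e1' by (simp add: algebra_simps)
qed


text \<open>Differentiability travels together with the value, so that the derivative of a long
  expression is assembled by introduction rules and compared with the expected form only at the
  end.\<close>

definition has_partial :: "'n::finite \<Rightarrow> (real ^ 'n \<Rightarrow> 'b::real_normed_vector) \<Rightarrow> 'b \<Rightarrow> real ^ 'n \<Rightarrow> bool" where
  "has_partial i f d x \<longleftrightarrow> f differentiable (at x) \<and> partial i f x = d"

lemma has_partial_c1: "c1 f \<Longrightarrow> has_partial i f (partial i f x) x"
  by (simp add: has_partial_def c1_differentiable)

lemma has_partial_const: "has_partial i (\<lambda>y. c) 0 x"
  by (simp add: has_partial_def)

lemma has_partial_add: "has_partial i f a x \<Longrightarrow> has_partial i g b x \<Longrightarrow> has_partial i (\<lambda>y. f y + g y) (a + b) x"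
  and has_partial_diff: "has_partial i f a x \<Longrightarrow> has_partial i g b x \<Longrightarrow> has_partial i (\<lambda>y. f y - g y) (a - b) x"
  by (simp_all add: has_partial_def partial_add partial_diff)

lemma has_partial_mult:
  fixes f g :: "real ^ 'n::finite \<Rightarrow> 'b::real_normed_algebra"
  shows "has_partial i f a x \<Longrightarrow> has_partial i g b x \<Longrightarrow> has_partial i (\<lambda>y. f y * g y) (a * g x + f x * b) x"
  by (simp add: has_partial_def partial_mult add.commute)

lemma has_partial_cmult:
  fixes f :: "real ^ 'n::finite \<Rightarrow> 'b::real_normed_algebra"
  shows "has_partial i f a x \<Longrightarrow> has_partial i (\<lambda>y. c * f y) (c * a) x"
  using has_partial_mult[OF has_partial_const] by fastforce

lemma has_partial_sum:
  "(\<And>k. k \<in> S \<Longrightarrow> has_partial i (f k) (d k) x) \<Longrightarrow> has_partial i (\<lambda>y. \<Sum>k\<in>S. f k y) (\<Sum>k\<in>S. d k) x"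
  by (induction S rule: infinite_finite_induct) (simp_all add: has_partial_const has_partial_add)

lemma has_partial_bounded_linear:
  "bounded_linear L \<Longrightarrow> has_partial i f a x \<Longrightarrow> has_partial i (\<lambda>y. L (f y)) (L a) x"
  by (auto simp: has_partial_def partial_bounded_linear differentiable_bounded_linear)

lemmas has_partial_cnj = has_partial_bounded_linear[OF bounded_linear_cnj]
lemmas has_partial_of_real = has_partial_bounded_linear[OF bounded_linear_of_real]
lemmas has_partial_intros = has_partial_const has_partial_add has_partial_diff has_partial_cmult has_partial_mult has_partial_sum
  has_partial_cnj has_partial_of_real

lemma partial_eq_of_has_partial: "has_partial i f d x \<Longrightarrow> d = d' \<Longrightarrow> partial i f x = d'"
  by (simp add: has_partial_def)

context radial_weight
begin

text \<open>The operator A of the overview. The Laplacian of \<open>\<psi>\<close> is the divergence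
  of its gradient, and half of it is the correction that makes the directional derivative
  skew.\<close>

definition transport :: "(real ^ 'n \<Rightarrow> complex) \<Rightarrow> real ^ 'n \<Rightarrow> complex" where
  "transport v x = (\<Sum>j\<in>UNIV. of_real (partial j \<psi> x) * partial j v x) + 1/2 * of_real (laplacian \<psi> x) * v x"

text \<open>Read off from - Re (cnj (A v) \<Delta>v) by parts. The first term takes one derivative
  off \<Delta>v; what remains is the Hessian form plus half of \<nabla>\<psi> .
  \<nabla>|\<nabla>v|^2, whose integration by parts gives the second term. The third and fourth
  terms treat the part with \<Delta>\<psi> in the same way, and the leftovers in \<Delta>\<psi>
  |\<nabla>v|^2 cancel. Derivatives of \<open>\<psi>\<close> enter up to order three.\<close>

definition flux :: "(real ^ 'n \<Rightarrow> complex) \<Rightarrow> 'n \<Rightarrow> real ^ 'n \<Rightarrow> complex" where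
  "flux v k x = (\<Sum>j\<in>UNIV. - (1/2) * (of_real (partial j \<psi> x) *
        (cnj (partial j v x) * partial k v x + partial j v x * cnj (partial k v x))))
    + 1/2 * (of_real (partial k \<psi> x) * (\<Sum>j\<in>UNIV. cnj (partial j v x) * partial j v x))
    - 1/4 * (of_real (laplacian \<psi> x) * (cnj (v x) * partial k v x + v x * cnj (partial k v x)))
    + 1/4 * (of_real (partial k (laplacian \<psi>) x) * (cnj (v x) * v x))"

lemma c1_psi: "c1 \<psi>" "c1 (partial i \<psi>)" "c1 (partial i (partial j \<psi>))" "c1 (laplacian \<psi>)"
  "c1 (partial i (laplacian \<psi>))"
  using smooth by (auto intro: smooth_c1 smooth_partial smooth_c1_laplacian smooth_c1_partial_laplacian)

lemma c1_flux: "Defs.smooth v \<Longrightarrow> c1 (flux v k)"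
  unfolding flux_def by (intro c1_intros c1_psi smooth_c1 smooth_partial) 

lemma c1_transport: "Defs.smooth v \<Longrightarrow> c1 (transport v)"
  unfolding transport_def by (intro c1_intros c1_psi smooth_c1 smooth_partial)

lemma partial_flux:
  assumes v: "Defs.smooth v"
  shows "partial k (flux v k) x =
   (\<Sum>j\<in>UNIV. - (1/2) * (of_real (partial k (partial j \<psi>) x) * (cnj (partial j v x) * partial k v x + partial j v x * cnj (partial k v x))
            + of_real (partial j \<psi> x) * (cnj (partial k (partial j v) x) * partial k v x + cnj (partial j v x) * partial k (partial k v) x
               + partial k (partial j v) x * cnj (partial k v x) + partial j v x * cnj (partial k (partial k v) x))))
        + 1/2 * (of_real (partial k (partial k \<psi>) x) * (\<Sum>j\<in>UNIV. cnj (partial j v x) * partial j v x)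
            + of_real (partial k \<psi> x) * (\<Sum>j\<in>UNIV. cnj (partial k (partial j v) x) * partial j v x + cnj (partial j v x) * partial k (partial j v) x))
        - 1/4 * (of_real (partial k (laplacian \<psi>) x) * (cnj (v x) * partial k v x + v x * cnj (partial k v x))
            + of_real (laplacian \<psi> x) * (cnj (partial k v x) * partial k v x + cnj (v x) * partial k (partial k v) x
               + partial k v x * cnj (partial k v x) + v x * cnj (partial k (partial k v) x)))
        + 1/4 * (of_real (partial k (partial k (laplacian \<psi>)) x) * (cnj (v x) * v x)
            + of_real (partial k (laplacian \<psi>) x) * (cnj (partial k v x) * v x + cnj (v x) * partial k v x))"
proof -
  have c: "c1 v" "c1 (partial j v)" for j
    using v by (auto intro: smooth_c1 smooth_partial)
  show ?thesis
    unfolding flux_def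
    apply (rule partial_eq_of_has_partial)
     apply (rule has_partial_intros | rule has_partial_c1, rule c c1_psi)+
    apply (simp only: add.assoc)
    done
qed

text \<open>The fourth derivatives of \<open>\<psi>\<close> in the density and in the divergence
  cancel; the right-hand side contains derivatives of \<open>\<psi>\<close> up to order two only,
  and is rapidly decreasing for Schwartz \<open>v\<close>.\<close>

lemma virial_density_eq:
  assumes v: "Defs.smooth v"
  shows "virial_density \<psi> v x + (\<Sum>k\<in>UNIV. partial k (flux v k) x) =
    - (1/2) * (cnj (transport v x) * laplacian v x + transport v x * cnj (laplacian v x))"
proof -
  have 1: "partial i (\<lambda>y. cnj (v y)) x = cnj (partial i v x)" for i
    by (rule partial_cnj[OF smooth_differentiable[OF v]])
  have 2: "complex_of_real ((norm (v x))\<^sup>2 * r) = cnj (v x) * v x * complex_of_real r" for r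
    by (metis complex_norm_square mult.commute of_real_mult)
  have "virial_density \<psi> v x = (\<Sum>j\<in>UNIV. \<Sum>k\<in>UNIV. cnj (partial j v x) * of_real (partial k (partial j \<psi>) x) * partial k v x)
     - 1/4 * (cnj (v x) * v x * (\<Sum>k\<in>UNIV. of_real (partial k (partial k (laplacian \<psi>)) x)))"
    unfolding virial_density_def 1 2 laplacian_def[of "laplacian \<psi>"] hessian_def vec_lambda_beta of_real_sum
    by (simp add: partial_commute[OF smooth])
  moreover have "laplacian v x = (\<Sum>k\<in>UNIV. partial k (partial k v) x)"
    "cnj (laplacian v x) = (\<Sum>k\<in>UNIV. cnj (partial k (partial k v) x))"
    by (simp_all add: laplacian_def)
  moreover have "cnj (transport v x) = (\<Sum>j\<in>UNIV. of_real (partial j \<psi> x) * cnj (partial j v x))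
      + 1/2 * of_real (laplacian \<psi> x) * cnj (v x)"
    by (simp add: transport_def)
  ultimately show ?thesis
    using virial_algebra[where a="\<lambda>j. of_real (partial j \<psi> x)" and q="\<lambda>j. partial j v x"
      and c="\<lambda>j. cnj (partial j v x)" and H="\<lambda>j k. of_real (partial k (partial j \<psi>) x)"
      and Q="\<lambda>j k. partial k (partial j v) x" and R="\<lambda>j k. cnj (partial k (partial j v) x)"
      and L="of_real (laplacian \<psi> x)" and V="v x" and W="cnj (v x)"
      and d="\<lambda>k. of_real (partial k (laplacian \<psi>) x)"
      and dd="\<lambda>k. of_real (partial k (partial k (laplacian \<psi>)) x)"]
      partial_commute[OF smooth] partial_commute[OF v]
    unfolding partial_flux[OF v] transport_def
    by (simp only: laplacian_def of_real_sum simp_thms)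
qed

end

section \<open>The time derivative of the momentum\<close>

lemma rapid_on_mult:
  fixes f g :: "'s \<Rightarrow> 'a::real_normed_vector \<Rightarrow> 'b::real_normed_algebra"
  shows "rapid_on S f \<Longrightarrow> rapid_on S g \<Longrightarrow> rapid_on S (\<lambda>s x. f s x * g s x)"
  by (intro rapid_on_mult_left rapid_on_slow)

lemma slow_slow_on: "slow h \<Longrightarrow> slow_on S (\<lambda>_. h)"
  by (rule slow_on_reindex[where k="\<lambda>_. ()"]) auto

lemma integral_zero_of_has_integral:
  fixes h :: "real ^ 'n::finite \<Rightarrow> 'b::euclidean_space"
  assumes "(h has_integral z) UNIV" "integrable lborel h"
  shows "integral\<^sup>L lborel h = z"
  using has_integral_unique[OF has_integral_integral_lborel[OF assms(2)] assms(1)] .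

context radial_weight
begin

lemma rapid_on_transport:
  assumes g: "schwartz_on S g"
  shows "rapid_on S (\<lambda>s. transport (g s))"
proof -
  have s: "slow_on S (\<lambda>s x. complex_of_real (partial j \<psi> x))" "slow_on S (\<lambda>s x. complex_of_real (laplacian \<psi> x))" for j
    by (rule slow_on_of_real, rule slow_slow_on, rule slow_partial_psi slow_laplacian_psi)+
  have "rapid_on S (\<lambda>s x. (\<Sum>j\<in>UNIV. of_real (partial j \<psi> x) * partial j (g s) x) + 1/2 * of_real (laplacian \<psi> x) * g s x)"
    by (intro rapid_on_add rapid_on_sum rapid_on_mult_left[OF s(1)] rapid_on_mult_left[OF slow_on_mult[OF slow_on_const s(2)]]
      schwartz_on_rapid schwartz_on_partial g)
  then show ?thesis unfolding transport_def .
qed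

lemma rapid_flux:
  assumes v: "schwartz_on (UNIV :: unit set) (\<lambda>_. v)"
  shows "rapid (flux v k)"
proof -
  have s: "slow (\<lambda>x. complex_of_real (partial j \<psi> x))" "slow (\<lambda>x. complex_of_real (laplacian \<psi> x))"
     "slow (\<lambda>x. complex_of_real (partial j (laplacian \<psi>) x))" for j
    by (intro slow_on_of_real slow_partial_psi slow_laplacian_psi slow_partial_laplacian_psi)+
  have r: "rapid v" "rapid (partial j v)" for j
    by (intro schwartz_on_rapid schwartz_on_partial v)+
  show ?thesis
    unfolding flux_def
    by (rule rapid_on_add rapid_on_diff rapid_on_sum | rule rapid_on_mult_left[OF slow_on_const]
       | rule rapid_on_mult_left[OF s(1)] rapid_on_mult_left[OF s(2)] rapid_on_mult_left[OF s(3)]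
       | rule rapid_on_mult | rule rapid_on_cnj | rule r)+
qed

lemma virial_has_integral:
  assumes v: "schwartz_on (UNIV :: unit set) (\<lambda>_. v)"
  shows "(virial_density \<psi> v has_integral
    complex_of_real (- Re (LINT x|lborel. cnj (transport v x) * laplacian v x))) UNIV"
proof -
  have sm: "Defs.smooth v" using schwartz_on_smooth[OF v] by simp
  let ?p = "\<lambda>x. cnj (transport v x) * laplacian v x"
  have p: "integrable lborel ?p"
    by (intro rapid_integrable rapid_on_mult rapid_on_cnj rapid_on_transport rapid_on_laplacian v
        c1_continuous c1_mult c1_cnj c1_transport smooth_c1_laplacian sm)
  have "- (1/2) * (cnj (transport v x) * laplacian v x + transport v x * cnj (laplacian v x)) = of_real (- Re (?p x))" for x
    by (simp add: complex_eq_iff field_simps)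
  moreover have "((\<lambda>x. complex_of_real (- Re (?p x))) has_integral complex_of_real (- Re (integral\<^sup>L lborel ?p))) UNIV"
    using has_integral_linear[OF has_integral_integral_lborel[OF p]
      bounded_linear_compose[OF bounded_linear_of_real bounded_linear_minus[OF bounded_linear_Re]]]
    by (simp only: comp_def)
  moreover have "((\<lambda>x. \<Sum>k\<in>UNIV. partial k (flux v k) x) has_integral (\<Sum>k\<in>(UNIV :: 'n set). 0)) UNIV"
    by (intro has_integral_sum has_integral_partial_zero c1_flux sm rapid_flux v) auto
  ultimately have "((\<lambda>x. - (1/2) * (cnj (transport v x) * laplacian v x + transport v x * cnj (laplacian v x))
      - (\<Sum>k\<in>UNIV. partial k (flux v k) x)) has_integral
      (complex_of_real (- Re (integral\<^sup>L lborel ?p)) - (\<Sum>k\<in>(UNIV :: 'n set). 0))) UNIV"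
    by (intro has_integral_diff) auto
  then show ?thesis unfolding virial_density_eq[OF sm, symmetric] by simp
qed

text \<open>The two integrands add up to the divergence of cnj v z \<nabla>\<psi>: the two halves of
  \<Delta>\<psi> supply the term in which the gradient of \<open>\<psi>\<close> is
  differentiated.\<close>

lemma transport_skew:
  assumes v: "schwartz_on (UNIV :: unit set) (\<lambda>_. v)" and z: "schwartz_on (UNIV :: unit set) (\<lambda>_. z)"
  shows "(LINT x|lborel. cnj (v x) * transport z x) = - (LINT x|lborel. cnj (transport v x) * z x)"
proof -
  have sm: "Defs.smooth v" "Defs.smooth z" using schwartz_on_smooth[OF v] schwartz_on_smooth[OF z] by auto
  have c: "c1 v" "c1 z" using sm by (auto intro: smooth_c1)
  have int: "integrable lborel (\<lambda>x. cnj (v x) * transport z x)" "integrable lborel (\<lambda>x. cnj (transport v x) * z x)"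
    by (intro rapid_integrable rapid_on_mult rapid_on_cnj rapid_on_transport schwartz_on_rapid v z
        c1_continuous c1_mult c1_cnj c1_transport smooth_c1 sm)+
  let ?g = "\<lambda>j y. complex_of_real (partial j \<psi> y) * (cnj (v y) * z y)"
  have "partial j (?g j) x = of_real (partial j (partial j \<psi>) x) * (cnj (v x) * z x)
      + of_real (partial j \<psi> x) * (cnj (partial j v x) * z x + cnj (v x) * partial j z x)" for j x
    by (rule partial_eq_of_has_partial) (rule has_partial_intros | rule has_partial_c1, rule c c1_psi | rule refl)+
  then have eq: "(\<Sum>j\<in>UNIV. partial j (?g j) x) = cnj (v x) * transport z x + cnj (transport v x) * z x" for x
    by (simp add: transport_def laplacian_def algebra_simps sum.distrib sum_distrib_left sum_divide_distrib)
  have "(partial j (?g j) has_integral 0) UNIV" for j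
    by (intro has_integral_partial_zero c1_intros c1_psi c rapid_on_mult_left slow_on_of_real slow_partial_psi
        rapid_on_mult rapid_on_cnj schwartz_on_rapid v z)
  then have "((\<lambda>x. \<Sum>j\<in>UNIV. partial j (?g j) x) has_integral (\<Sum>j\<in>(UNIV :: 'n set). 0)) UNIV"
    by (intro has_integral_sum) auto
  then have "((\<lambda>x. cnj (v x) * transport z x + cnj (transport v x) * z x) has_integral 0) UNIV"
    unfolding eq by simp
  from integral_zero_of_has_integral[OF this] int show ?thesis
    by (simp add: eq_neg_iff_add_eq_0)
qed

end

section \<open>Limits and derivatives of integrals with a real parameter\<close>

lemma integral_tendsto_at:
  fixes F :: "real \<Rightarrow> 'a \<Rightarrow> 'b::{banach, second_countable_topology}"
  assumes meas: "\<And>s. F s \<in> borel_measurable M"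
    and lim: "\<And>x. ((\<lambda>s. F s x) \<longlongrightarrow> L x) (at t)"
    and bound: "eventually (\<lambda>s. \<forall>x. norm (F s x) \<le> w x) (at t)" and w: "integrable M w"
  shows "((\<lambda>s. integral\<^sup>L M (F s)) \<longlongrightarrow> integral\<^sup>L M L) (at t)"
  unfolding tendsto_at_iff_sequentially comp_def
proof (intro allI impI)
  fix X assume X: "\<forall>i. X i \<in> UNIV - {t}" "X \<longlonglongrightarrow> t"
  then have fX: "filterlim X (at t) sequentially" by (auto simp: filterlim_at)
  \<comment> \<open>The dominating bound holds only for \<open>s\<close> near \<open>t\<close>,
    hence from some index \<open>N\<close> on; the sequence is shifted by \<open>N\<close> before
    dominated convergence.\<close>
  from eventually_compose_filterlim[OF bound fX] obtain N where
    N: "\<And>n x. n \<ge> N \<Longrightarrow> norm (F (X n) x) \<le> w x"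
    by (auto simp: eventually_sequentially)
  have lX: "(\<lambda>n. F (X n) x) \<longlonglongrightarrow> L x" for x by (rule filterlim_compose[OF lim fX])
  have L: "L \<in> borel_measurable M" by (rule borel_measurable_LIMSEQ_metric[OF meas lX])
  have "(\<lambda>n. integral\<^sup>L M (F (X (n + N)))) \<longlonglongrightarrow> integral\<^sup>L M L"
    by (rule integral_dominated_convergence[OF L meas w]) (use N in \<open>auto intro!: LIMSEQ_ignore_initial_segment[OF lX]\<close>)
  then show "(\<lambda>n. integral\<^sup>L M (F (X n))) \<longlonglongrightarrow> integral\<^sup>L M L" by (rule LIMSEQ_offset)
qed

lemma has_vector_derivative_iff_tendsto:
  "(f has_vector_derivative d) (at t) \<longleftrightarrow> ((\<lambda>s. (f s - f t) /\<^sub>R (s - t)) \<longlongrightarrow> d) (at t)"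
proof -
  have "norm (f s - f t - (s - t) *\<^sub>R d) / norm (s - t) = norm ((f s - f t) /\<^sub>R (s - t) - d)" if "s \<noteq> t" for s
  proof -
    have "(f s - f t) /\<^sub>R (s - t) - d = (f s - f t - (s - t) *\<^sub>R d) /\<^sub>R (s - t)"
      using that by (simp add: scaleR_diff_right)
    then show ?thesis by (simp add: divide_inverse mult.commute)
  qed
  then have "((\<lambda>s. norm (f s - f t - (s - t) *\<^sub>R d) / norm (s - t)) \<longlongrightarrow> 0) (at t) \<longleftrightarrow>
     ((\<lambda>s. norm ((f s - f t) /\<^sub>R (s - t) - d)) \<longlongrightarrow> 0) (at t)"
    by (intro tendsto_cong) (auto simp: eventually_at_filter)
  then show ?thesis
    unfolding has_vector_derivative_def has_derivative_iff_norm
    by (simp add: tendsto_norm_zero_iff LIM_zero_iff bounded_linear_scaleR_left)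
qed

lemma vector_derivative_bound:
  fixes f :: "real \<Rightarrow> 'b::real_normed_vector"
  assumes "\<And>s. \<bar>s - t\<bar> < d \<Longrightarrow> (f has_vector_derivative f' s) (at s)"
    "\<And>s. \<bar>s - t\<bar> < d \<Longrightarrow> norm (f' s) \<le> w" "\<bar>s - t\<bar> < d"
  shows "norm ((f s - f t) /\<^sub>R (s - t)) \<le> w"
proof (cases "s = t")
  case False
  have "norm (f s - f t) \<le> w * norm (s - t)"
  proof (rule differentiable_bound[where S="{t - d<..<t + d}" and f'="\<lambda>s h. h *\<^sub>R f' s"])
    show "(f has_derivative (\<lambda>h. h *\<^sub>R f' s)) (at s within {t - d<..<t + d})" if "s \<in> {t - d<..<t + d}" for s
      using assms(1)[of s] that by (auto simp: has_vector_derivative_def has_derivative_at_withinI)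
    show "onorm (\<lambda>h. h *\<^sub>R f' s) \<le> w" if "s \<in> {t - d<..<t + d}" for s
      using assms(2)[of s] that by (intro onorm_le) (auto simp: mult.commute[of w] intro!: mult_left_mono)
  qed (use assms(3) in auto)
  then show ?thesis using False unfolding norm_scaleR by (simp add: field_simps)
next
  \<comment> \<open>Here the quotient is 0, since the inverse of 0 is 0, and \<open>w\<close> is
    nonnegative because it bounds a norm.\<close>
  case True
  then show ?thesis using assms(3) order_trans[OF norm_ge_zero assms(2)[of t]] by simp
qed

lemma has_vector_derivative_integral:
  fixes F :: "real \<Rightarrow> 'a \<Rightarrow> 'b::{banach, second_countable_topology}"
  assumes int: "\<And>s. integrable M (F s)" and d: "d > 0"
    and der: "\<And>s x. \<bar>s - t\<bar> < d \<Longrightarrow> ((\<lambda>s. F s x) has_vector_derivative F' s x) (at s)"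
    and bound: "\<And>s x. \<bar>s - t\<bar> < d \<Longrightarrow> norm (F' s x) \<le> w x" and w: "integrable M w"
  shows "((\<lambda>s. integral\<^sup>L M (F s)) has_vector_derivative integral\<^sup>L M (F' t)) (at t)"
proof -
  let ?Q = "\<lambda>s x. (F s x - F t x) /\<^sub>R (s - t)"
  have "((\<lambda>s. integral\<^sup>L M (?Q s)) \<longlongrightarrow> integral\<^sup>L M (F' t)) (at t)"
  proof (rule integral_tendsto_at[OF _ _ _ w])
    show "?Q s \<in> borel_measurable M" for s using int by (intro borel_measurable_scaleR borel_measurable_diff) auto
    show "((\<lambda>s. ?Q s x) \<longlongrightarrow> F' t x) (at t)" for x
      using der[of t x] d by (simp add: has_vector_derivative_iff_tendsto)
    have "norm (?Q s x) \<le> w x" if s: "\<bar>s - t\<bar> < d" for s x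
      by (rule vector_derivative_bound[where f="\<lambda>s. F s x", OF der bound s])
    then show "eventually (\<lambda>s. \<forall>x. norm (?Q s x) \<le> w x) (at t)"
      unfolding eventually_at using d by (auto simp: dist_real_def)
  qed
  moreover have "integral\<^sup>L M (?Q s) = (integral\<^sup>L M (F s) - integral\<^sup>L M (F t)) /\<^sub>R (s - t)" for s
    using int by simp
  ultimately show ?thesis
    unfolding has_vector_derivative_iff_tendsto by (simp only:)
qed


section \<open>Solutions as uniformly Schwartz families\<close>

lemma partials_diff:
  assumes "smooth f" "smooth g"
  shows "partials is (\<lambda>x. f x - g x) = (\<lambda>x. partials is f x - partials is g x)"
  by (induction "is") (auto simp: partial_diff smooth_differentiable[OF smooth_partials] assms)

text \<open>A supremum of reals is an upper bound only if the set is bounded above; here this comes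
  from the decay of both functions.\<close>

lemma schwartz_seminorm_diff_bound:
  assumes f: "f \<in> schwartz" and g: "g \<in> schwartz"
  shows "(1 + norm x) ^ N * norm (partials is f x - partials is g x) \<le> schwartz_seminorm N is (\<lambda>x. f x - g x)"
proof -
  have sm: "smooth f" "smooth g" using f g by (auto simp: schwartz_def)
  have "rapid (\<lambda>x. partials is f x - partials is g x)"
    by (intro rapid_on_diff schwartz_on_rapid schwartz_on_partials schwartz_schwartz_on f g)
  then obtain C where "\<And>x. (1 + norm x) ^ N * norm (partials is f x - partials is g x) \<le> C"
    by (rule rapid_onE[where N=N]) auto
  then have "bdd_above (range (\<lambda>x. (1 + norm x) ^ N * norm (partials is f x - partials is g x)))"
    by (intro bdd_aboveI2)
  then show ?thesis
    unfolding schwartz_seminorm_def partials_diff[OF sm] by (intro cSUP_upper) auto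
qed

context
  fixes f :: "real ^ 'n::finite \<Rightarrow> complex" and u :: "real \<Rightarrow> real ^ 'n \<Rightarrow> complex"
  assumes sol: "schroedinger_solution f u"
begin

lemma solution_schwartz: "u t \<in> schwartz"
  using sol by (simp add: schroedinger_solution_def)

lemma solution_smooth: "smooth (u t)"
  using solution_schwartz by (simp add: schwartz_def)

lemma solution_initial: "u 0 = f"
  using sol by (auto simp: schroedinger_solution_def)

lemma solution_seminorm_tendsto: "((\<lambda>s. schwartz_seminorm N is (\<lambda>x. u s x - u t x)) \<longlongrightarrow> 0) (at t)"
  using sol by (simp add: schroedinger_solution_def)

lemma solution_has_vector_derivative: "((\<lambda>s. u s x) has_vector_derivative \<i> * laplacian (u t) x) (at t)"
proof -
  have d: "(\<lambda>s. u s x) differentiable (at t)"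
    and eq: "\<i> * vector_derivative (\<lambda>s. u s x) (at t) + laplacian (u t) x = 0"
    using sol by (auto simp: schroedinger_solution_def)
  from eq have "laplacian (u t) x = - (\<i> * vector_derivative (\<lambda>s. u s x) (at t))"
    by (simp add: eq_neg_iff_add_eq_0 add.commute)
  then have "\<i> * laplacian (u t) x = vector_derivative (\<lambda>s. u s x) (at t)"
    by simp
  then show ?thesis using d vector_derivative_works by metis
qed

lemma solution_partials_tendsto: "((\<lambda>s. partials is (u s) x) \<longlongrightarrow> partials is (u t) x) (at t)"
proof -
  have "norm (partials is (u s) x - partials is (u t) x) \<le> schwartz_seminorm 0 is (\<lambda>x. u s x - u t x)" for s
    using schwartz_seminorm_diff_bound[OF solution_schwartz solution_schwartz, where N=0] by simp
  then have "((\<lambda>s. partials is (u s) x - partials is (u t) x) \<longlongrightarrow> 0) (at t)"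
    by (intro Lim_null_comparison[OF _ solution_seminorm_tendsto[of 0 "is" t]]) auto
  then show ?thesis by (rule LIM_zero_cancel)
qed

text \<open>Continuity in each seminorm bounds that seminorm near every time, and finitely many such
  neighbourhoods cover the compact interval.\<close>

lemma solution_schwartz_on: "schwartz_on {a..b} u"
  unfolding schwartz_on_def rapid_on_def
proof (intro conjI ballI allI solution_smooth)
  fix N and "is" :: "'n list"
  have "\<exists>d C. d > 0 \<and> (\<forall>s x. dist t s < d \<longrightarrow> (1 + norm x) ^ N * norm (partials is (u s) x) \<le> C)" for t
  proof -
    have "rapid (partials is (u t))"
      by (intro schwartz_on_rapid schwartz_on_partials schwartz_schwartz_on solution_schwartz)
    then obtain C where C: "\<And>x. (1 + norm x) ^ N * norm (partials is (u t) x) \<le> C"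
      by (rule rapid_onE[where N=N]) auto
    have "eventually (\<lambda>s. schwartz_seminorm N is (\<lambda>x. u s x - u t x) < 1) (at t)"
      by (rule order_tendstoD(2)[OF solution_seminorm_tendsto]) simp
    then obtain d where d: "d > 0" "\<And>s. s \<noteq> t \<Longrightarrow> dist s t < d \<Longrightarrow> schwartz_seminorm N is (\<lambda>x. u s x - u t x) < 1"
      unfolding eventually_at by auto
    have "(1 + norm x) ^ N * norm (partials is (u s) x) \<le> C + 1" if s: "dist t s < d" for s x
    proof (cases "s = t")
      case True
      then show ?thesis using C[of x] by simp
    next
      case False
      have "(1 + norm x) ^ N * norm (partials is (u s) x) \<le>
        (1 + norm x) ^ N * (norm (partials is (u t) x) + norm (partials is (u s) x - partials is (u t) x))"
        by (intro mult_left_mono norm_triangle_sub) auto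
      also have "\<dots> \<le> C + 1"
        using C[of x] d(2)[OF False] s schwartz_seminorm_diff_bound[OF solution_schwartz[of s] solution_schwartz[of t], of x N "is"]
        by (simp add: distrib_left dist_commute)
      finally show ?thesis .
    qed
    with d(1) show ?thesis by blast
  qed
  then obtain d C where d: "\<And>t. d t > 0"
    and C: "\<And>t s x. dist t s < d t \<Longrightarrow> (1 + norm x) ^ N * norm (partials is (u s) x) \<le> C t"
    by metis
  obtain T where T: "T \<subseteq> {a..b}" "finite T" "{a..b} \<subseteq> (\<Union>t\<in>T. ball t (d t))"
    by (rule compactE_image[OF compact_Icc, where C="{a..b}" and f="\<lambda>t. ball t (d t)"]) (use d in auto)
  have "(1 + norm x) ^ N * norm (partials is (u s) x) \<le> (\<Sum>t\<in>T. \<bar>C t\<bar>)" if s: "s \<in> {a..b}" for s x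
  proof -
    obtain t where t: "t \<in> T" "dist t s < d t" using T(3) s by auto
    have "(1 + norm x) ^ N * norm (partials is (u s) x) \<le> \<bar>C t\<bar>"
      using C[OF t(2), of x] by simp
    also have "\<dots> \<le> (\<Sum>t\<in>T. \<bar>C t\<bar>)" using T(2) t(1) by (intro member_le_sum) auto
    finally show ?thesis .
  qed
  then show "\<exists>C. \<forall>s\<in>{a..b}. \<forall>x. (1 + norm x) ^ N * norm (partials is (u s) x) \<le> C" by blast
qed

end

context radial_weight
begin

text \<open>By skew-adjointness the increment of the form from t to s is the integral of cnj (u s -
  u t) A (u t) - cnj (A (u s)) (u s - u t). Only \<open>u\<close> itself is divided by the time
  step; of A (u s) just continuity in time is used, which the seminorms provide.\<close>

lemma transport_form_has_vector_derivative:
  assumes sol: "schroedinger_solution f u"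
  shows "((\<lambda>t. LINT x|lborel. cnj (u t x) * transport (u t) x) has_vector_derivative
    (LINT x|lborel. cnj (\<i> * laplacian (u t) x) * transport (u t) x - cnj (transport (u t) x) * (\<i> * laplacian (u t) x))) (at t)"
proof -
  have sch: "schwartz_on (S :: 's set) (\<lambda>_. u s)" for s S
    by (rule schwartz_schwartz_on[OF solution_schwartz[OF sol]])
  have sm: "Defs.smooth (u s)" for s by (rule solution_smooth[OF sol])
  have c: "continuous_on A (u s)" "continuous_on A (transport (u s))" for s A
    by (intro c1_continuous smooth_c1 c1_transport sm)+
  have r: "rapid (u s)" "rapid (transport (u s))" for s
    by (intro schwartz_on_rapid rapid_on_transport sch)+
  have int: "integrable lborel (\<lambda>x. cnj (u s x) * transport (u s') x)"
     "integrable lborel (\<lambda>x. cnj (transport (u s) x) * u s' x)" for s s'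
    by (intro rapid_integrable rapid_on_mult rapid_on_cnj r continuous_intros c)+
  let ?E = "\<lambda>t. LINT x|lborel. cnj (u t x) * transport (u t) x"
  let ?q = "\<lambda>s x. (u s x - u t x) /\<^sub>R (s - t)"
  let ?F = "\<lambda>s x. cnj (?q s x) * transport (u t) x - cnj (transport (u s) x) * ?q s x"
  have E: "(?E s - ?E t) /\<^sub>R (s - t) = integral\<^sup>L lborel (?F s)" for s
  proof -
    have "?F s = (\<lambda>x. (cnj (u s x) * transport (u t) x - cnj (u t x) * transport (u t) x
       - (cnj (transport (u s) x) * u s x - cnj (transport (u s) x) * u t x)) /\<^sub>R (s - t))"
      by (rule ext) (simp add: scaleR_conv_of_real algebra_simps)
    then have "integral\<^sup>L lborel (?F s) = ((LINT x|lborel. cnj (u s x) * transport (u t) x) - ?E t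
      - ((LINT x|lborel. cnj (transport (u s) x) * u s x) - (LINT x|lborel. cnj (transport (u s) x) * u t x))) /\<^sub>R (s - t)"
      using int by simp
    then show ?thesis
      using transport_skew[OF sch sch, of s s] transport_skew[OF sch sch, of s t] by simp
  qed
  have rL: "rapid_on {t-1..t+1} (\<lambda>s. laplacian (u s))" and rT: "rapid_on {t-1..t+1} (\<lambda>s. transport (u s))"
    by (intro rapid_on_laplacian rapid_on_transport solution_schwartz_on[OF sol])+
  obtain K where K: "\<And>s x. s \<in> {t-1..t+1} \<Longrightarrow> norm (laplacian (u s) x) \<le> K"
    by (rule rapid_onE[OF rL, where N=0]) auto
  obtain D where D: "D > 0" "\<And>s x. s \<in> {t-1..t+1} \<Longrightarrow> norm (transport (u s) x) \<le> D * weight x"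
    by (rule rapid_on_weight[OF rT]) auto
  \<comment> \<open>By the equation the time derivative is the Laplacian up to a factor of modulus
    one, so the mean value inequality gives the constant \<open>K\<close>. Integrability in
    \<open>x\<close> is left to the factor with \<open>transport\<close>.\<close>
  have q: "norm (?q s x) \<le> K" if s: "\<bar>s - t\<bar> < 1" for s x
    by (rule vector_derivative_bound[where f="\<lambda>s. u s x", OF solution_has_vector_derivative[OF sol] _ s])
      (auto simp: norm_mult intro!: K)
  have "((\<lambda>s. integral\<^sup>L lborel (?F s)) \<longlongrightarrow>
     (LINT x|lborel. cnj (\<i> * laplacian (u t) x) * transport (u t) x - cnj (transport (u t) x) * (\<i> * laplacian (u t) x))) (at t)"
  proof (rule integral_tendsto_at[where w="\<lambda>x. 2 * (K * (D * weight x))"])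
    show "?F s \<in> borel_measurable lborel" for s
      using c[of UNIV] by (auto intro!: borel_measurable_continuous_onI continuous_intros)
    show "((\<lambda>s. ?F s x) \<longlongrightarrow> cnj (\<i> * laplacian (u t) x) * transport (u t) x
        - cnj (transport (u t) x) * (\<i> * laplacian (u t) x)) (at t)" for x
    proof -
      have 1: "((\<lambda>s. ?q s x) \<longlongrightarrow> \<i> * laplacian (u t) x) (at t)"
        using solution_has_vector_derivative[OF sol, of x t] unfolding has_vector_derivative_iff_tendsto .
      have "((\<lambda>s. partial j (u s) x) \<longlongrightarrow> partial j (u t) x) (at t)" "((\<lambda>s. u s x) \<longlongrightarrow> u t x) (at t)" for j
        using solution_partials_tendsto[OF sol, of "[j]" x t] solution_partials_tendsto[OF sol, of "[]" x t] by simp_all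
      then have "((\<lambda>s. transport (u s) x) \<longlongrightarrow> transport (u t) x) (at t)"
        unfolding transport_def by (intro tendsto_intros)
      with 1 show ?thesis by (intro tendsto_intros)
    qed
    show "eventually (\<lambda>s. \<forall>x. norm (?F s x) \<le> 2 * (K * (D * weight x))) (at t)"
      unfolding eventually_at
    proof (intro exI[of _ 1] conjI ballI impI allI)
      fix s x assume "s \<noteq> t \<and> dist s t < 1"
      then have s: "\<bar>s - t\<bar> < 1" by (simp add: dist_real_def)
      have K0: "K \<ge> 0" using K[of t 0] order_trans[OF norm_ge_zero] by simp
      have "norm (cnj (?q s x) * transport (u t) x) \<le> K * (D * weight x)"
        unfolding norm_mult complex_mod_cnj using s K0 by (intro mult_mono q D) auto
      moreover have "norm (cnj (transport (u s) x) * ?q s x) \<le> K * (D * weight x)"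
        unfolding norm_mult complex_mod_cnj using s K0
        by (subst mult.commute) (intro mult_mono q D; auto)
      ultimately show "norm (?F s x) \<le> 2 * (K * (D * weight x))"
        using norm_triangle_ineq4[of "cnj (?q s x) * transport (u t) x" "cnj (transport (u s) x) * ?q s x"] by linarith
    qed auto
    show "integrable lborel (\<lambda>x :: real ^ 'n. 2 * (K * (D * weight x)))" by (simp add: integrable_weight)
  qed
  then show ?thesis unfolding has_vector_derivative_iff_tendsto E .
qed

text \<open>By \<open>transport_skew\<close> the form is purely imaginary on Schwartz functions, so
  taking \<open>Im\<close> loses nothing. The factor \<open>1/2\<close> compensates the two equal
  contributions in the derivative of a quadratic form.\<close>

definition momentum :: "(real ^ 'n \<Rightarrow> complex) \<Rightarrow> real" where
  "momentum v = 1/2 * Im (LINT x|lborel. cnj (v x) * transport v x)"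

lemma momentum_has_vector_derivative:
  assumes sol: "schroedinger_solution f u"
  shows "((\<lambda>t. momentum (u t)) has_vector_derivative
    - Re (LINT x|lborel. cnj (transport (u t) x) * laplacian (u t) x)) (at t)"
proof -
  have sch: "schwartz_on (S :: 's set) (\<lambda>_. u t)" for S
    by (rule schwartz_schwartz_on[OF solution_schwartz[OF sol]])
  have sm: "Defs.smooth (u t)" by (rule solution_smooth[OF sol])
  let ?p = "\<lambda>x. cnj (transport (u t) x) * laplacian (u t) x"
  have p: "integrable lborel ?p"
    by (intro rapid_integrable rapid_on_mult rapid_on_cnj rapid_on_transport rapid_on_laplacian sch
        c1_continuous c1_mult c1_cnj c1_transport smooth_c1_laplacian sm)
  have eq: "cnj (\<i> * laplacian (u t) x) * transport (u t) x - cnj (transport (u t) x) * (\<i> * laplacian (u t) x)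
     = - \<i> * (cnj (?p x) + ?p x)" for x
    by (simp add: algebra_simps)
  have "(LINT x|lborel. - \<i> * (cnj (?p x) + ?p x)) = - \<i> * (cnj (integral\<^sup>L lborel ?p) + integral\<^sup>L lborel ?p)"
    using p integrable_cnj[OF p] by (simp del: complex_cnj_mult)
  then have "1/2 * Im (LINT x|lborel. - \<i> * (cnj (?p x) + ?p x)) = - Re (integral\<^sup>L lborel ?p)"
    by simp
  moreover have "((\<lambda>t. momentum (u t)) has_vector_derivative 1/2 * Im (LINT x|lborel. - \<i> * (cnj (?p x) + ?p x))) (at t)"
    unfolding momentum_def
    using bounded_linear.has_vector_derivative[OF bounded_linear_compose[OF bounded_linear_mult_right bounded_linear_Im]
      transport_form_has_vector_derivative[OF sol, of t, unfolded eq], of "1/2"]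
    by simp
  ultimately show ?thesis by simp
qed

end

section \<open>Complex Gaussians\<close>

lemma has_partial_exp:
  fixes g :: "real ^ 'n::finite \<Rightarrow> complex"
  assumes "has_partial i g d x"
  shows "has_partial i (\<lambda>y. exp (g y)) (exp (g x) * d) x"
proof -
  have "(g has_derivative frechet_derivative g (at x)) (at x)"
    using assms by (auto simp: has_partial_def frechet_derivative_works)
  from has_derivative_compose[OF this, of exp "(*) (exp (g x))"]
  have *: "((\<lambda>y. exp (g y)) has_derivative (\<lambda>h. exp (g x) * frechet_derivative g (at x) h)) (at x)"
    using DERIV_exp[of "g x"] by (simp add: has_field_derivative_def)
  show ?thesis
    using partial_eqI[OF *, of i] * assms by (auto simp: has_partial_def partial_def differentiable_def)
qed

lemma c1_of_has_partial:
  assumes "\<And>i x. has_partial i f (D i x) x" "\<And>i. continuous_on UNIV (D i)"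
  shows "c1 f"
proof -
  have "partial i f = D i" for i using assms(1) by (auto simp: has_partial_def)
  then show ?thesis using assms by (auto simp: c1_def has_partial_def)
qed

lemma c1_exp:
  fixes g :: "real ^ 'n::finite \<Rightarrow> complex"
  assumes "c1 g"
  shows "c1 (\<lambda>y. exp (g y))"
  by (rule c1_of_has_partial, rule has_partial_exp, rule has_partial_c1[OF assms])
    (intro continuous_intros c1_continuous c1_continuous_partial assms)

lemma has_partial_component: "has_partial i (\<lambda>y. y $ j) (if i = j then 1 else 0) x"
  unfolding has_partial_def partial_component
  using linear_imp_differentiable[OF bounded_linear.linear[OF bounded_linear_vec_nth]] by auto

lemma c1_component: "c1 (\<lambda>y :: real ^ 'n::finite. y $ j)"
  by (rule c1_of_has_partial[OF has_partial_component]) auto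

lemma norm_sq_eq_sum: "(norm x)\<^sup>2 = (\<Sum>j\<in>UNIV. x $ j * x $ j)" for x :: "real ^ 'n::finite"
  using dot_square_norm[of x] by (simp add: inner_vec_def)

text \<open>The heat kernel at complex time \<open>z\<close> without its normalizing factor; on the
  imaginary axis it is the Schroedinger kernel. The squared norm is spelled out in coordinates so
  that the rules for partial derivatives apply.\<close>

definition gauss :: "complex \<Rightarrow> real ^ 'n::finite \<Rightarrow> real ^ 'n \<Rightarrow> complex" where
  "gauss z x y = exp (- 1 / (4 * z) * (\<Sum>j\<in>UNIV. of_real (x $ j - y $ j) * of_real (x $ j - y $ j)))"

lemma gauss_eq: "gauss z x y = exp (- of_real ((norm (x - y))\<^sup>2) / (4 * z))"
  unfolding gauss_def norm_sq_eq_sum by simp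

lemma has_partial_gauss: "has_partial k (gauss z x) (gauss z x y * (of_real (x $ k - y $ k) / (2 * z))) y"
proof -
  have "has_partial k (\<lambda>y. - 1 / (4 * z) * (\<Sum>j\<in>UNIV. of_real (x $ j - y $ j) * of_real (x $ j - y $ j)))
    (- 1 / (4 * z) * (\<Sum>j\<in>UNIV. of_real (0 - (if k = j then 1 else 0)) * of_real (x $ j - y $ j)
        + of_real (x $ j - y $ j) * of_real (0 - (if k = j then 1 else 0)))) y"
    by (rule has_partial_cmult has_partial_sum has_partial_mult has_partial_of_real has_partial_diff
      has_partial_const has_partial_component)+
  moreover have "(\<Sum>j\<in>UNIV. complex_of_real (0 - (if k = j then 1 else 0)) * of_real (x $ j - y $ j)
        + of_real (x $ j - y $ j) * of_real (0 - (if k = j then 1 else 0))) =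
     (\<Sum>j\<in>UNIV. if k = j then - 2 * of_real (x $ j - y $ j) else 0)"
    by (intro sum.cong) auto
  then have "- 1 / (4 * z) * (\<Sum>j\<in>UNIV. of_real (0 - (if k = j then 1 else 0)) * of_real (x $ j - y $ j)
        + of_real (x $ j - y $ j) * of_real (0 - (if k = j then 1 else 0))) = of_real (x $ k - y $ k) / (2 * z)"
    by (simp only: sum.delta' sum.delta finite UNIV_I if_True, cases "z = 0") (simp_all add: field_simps)
  ultimately have "has_partial k (\<lambda>y. - 1 / (4 * z) * (\<Sum>j\<in>UNIV. of_real (x $ j - y $ j) * of_real (x $ j - y $ j)))
    (of_real (x $ k - y $ k) / (2 * z)) y" by (simp only:)
  from has_partial_exp[OF this] show ?thesis unfolding gauss_def .
qed

lemma c1_gauss: "c1 (gauss z x)"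
  unfolding gauss_def by (intro c1_exp c1_intros c1_component)

lemma norm_gauss_le: "Re z \<ge> 0 \<Longrightarrow> norm (gauss z x y) \<le> 1"
proof -
  assume "Re z \<ge> 0"
  then have "Re (of_real ((norm (x - y))\<^sup>2) / (4 * z)) \<ge> 0"
    by (simp add: Re_divide)
  then show ?thesis by (simp add: gauss_eq)
qed

text \<open>Green's identity: the factor in front of \<open>v\<close> on the left is the Laplacian
  of the Gaussian in \<open>y\<close>. The field \<open>g k\<close> is the derivative of the
  Gaussian times \<open>v\<close> minus the Gaussian times the derivative of \<open>v\<close>; it
  decays because \<open>v\<close> does, so the imaginary axis is included.\<close>

lemma integral_gauss_laplacian:
  fixes v :: "real ^ 'n::finite \<Rightarrow> complex"
  assumes v: "schwartz_on (UNIV :: unit set) (\<lambda>_. v)" and z: "Re z \<ge> 0" "z \<noteq> 0"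
  shows "integrable lborel (\<lambda>y. gauss z x y * (of_real ((norm (x - y))\<^sup>2) / (4 * z\<^sup>2) - of_nat CARD('n) / (2 * z)) * v y)"
    and "integrable lborel (\<lambda>y. gauss z x y * laplacian v y)"
    and "(LINT y|lborel. gauss z x y * (of_real ((norm (x - y))\<^sup>2) / (4 * z\<^sup>2) - of_nat CARD('n) / (2 * z)) * v y)
       = (LINT y|lborel. gauss z x y * laplacian v y)"
proof -
  have sm: "smooth v" using schwartz_on_smooth[OF v] by simp
  have sg: "slow (gauss z x)" by (rule slow_on_bounded) (rule norm_gauss_le[OF z(1)])
  have sc: "slow (\<lambda>y. complex_of_real (x $ k - y $ k))" for k
    by (intro slow_on_of_real slow_on_diff slow_on_const slow_on_component)
  have c: "c1 v" "c1 (partial k v)" "c1 (\<lambda>y. complex_of_real (x $ k - y $ k))" for k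
    by (intro smooth_c1 smooth_partial sm, intro smooth_c1 smooth_partial sm, intro c1_intros c1_component)
  have r: "rapid v" "rapid (partial k v)" "rapid (laplacian v)" for k
    by (intro schwartz_on_rapid schwartz_on_partial rapid_on_laplacian v)+
  have sq: "slow (\<lambda>y. complex_of_real ((norm (x - y))\<^sup>2) / (4 * z\<^sup>2) - of_nat CARD('n) / (2 * z))"
  proof -
    have "slow (\<lambda>y. complex_of_real ((norm (x - y))\<^sup>2))"
      unfolding norm_sq_eq_sum
      by (intro slow_on_of_real slow_on_sum slow_on_mult) (auto intro!: slow_on_diff slow_on_const slow_on_component)
    then show ?thesis unfolding divide_inverse by (intro slow_on_diff slow_on_mult slow_on_const)
  qed
  show int1: "integrable lborel (\<lambda>y. gauss z x y * (of_real ((norm (x - y))\<^sup>2) / (4 * z\<^sup>2) - of_nat CARD('n) / (2 * z)) * v y)"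
  proof (rule rapid_integrable)
    show "rapid (\<lambda>y. gauss z x y * (of_real ((norm (x - y))\<^sup>2) / (4 * z\<^sup>2) - of_nat CARD('n) / (2 * z)) * v y)"
      by (rule rapid_on_mult_left[OF slow_on_mult[OF sg sq] r(1)])
    have "continuous_on UNIV (gauss z x)" "continuous_on UNIV v" by (intro c1_continuous c1_gauss c)+
    then show "continuous_on UNIV (\<lambda>y. gauss z x y * (of_real ((norm (x - y))\<^sup>2) / (4 * z\<^sup>2) - of_nat CARD('n) / (2 * z)) * v y)"
      using z(2) by (intro continuous_on_mult continuous_on_diff continuous_on_divide continuous_on_of_real
        continuous_on_power continuous_on_norm continuous_on_const continuous_on_id) auto
  qed
  show int2: "integrable lborel (\<lambda>y. gauss z x y * laplacian v y)"
    by (intro rapid_integrable rapid_on_mult_left[OF sg] continuous_intros c1_continuous c1_gauss smooth_c1_laplacian sm r)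
  define g where "g k y = gauss z x y * of_real (x $ k - y $ k) * (1 / (2 * z)) * v y - gauss z x y * partial k v y" for k y
  have "has_partial k (g k) (gauss z x y * ((of_real (x $ k - y $ k))\<^sup>2 / (4 * z\<^sup>2) - 1 / (2 * z)) * v y - gauss z x y * partial k (partial k v) y) y" for k y
  proof -
    have "has_partial k (g k) ((((gauss z x y * (of_real (x $ k - y $ k) / (2 * z))) * of_real (x $ k - y $ k)
          + gauss z x y * of_real (0 - (if k = k then 1 else 0))) * (1 / (2 * z)) + gauss z x y * of_real (x $ k - y $ k) * 0) * v y
        + gauss z x y * of_real (x $ k - y $ k) * (1 / (2 * z)) * partial k v y
        - ((gauss z x y * (of_real (x $ k - y $ k) / (2 * z))) * partial k v y + gauss z x y * partial k (partial k v) y)) y"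
      unfolding g_def
      by (rule has_partial_diff has_partial_mult has_partial_gauss has_partial_of_real has_partial_component has_partial_const
         | rule has_partial_c1, rule c)+
    then show ?thesis
      by (rule back_subst[where P="\<lambda>d. has_partial k (g k) d y"]) (use z in \<open>simp add: field_simps power2_eq_square\<close>)
  qed
  then have "(\<Sum>k\<in>UNIV. partial k (g k) y) =
     (\<Sum>k\<in>UNIV. gauss z x y * ((of_real (x $ k - y $ k))\<^sup>2 / (4 * z\<^sup>2) - 1 / (2 * z)) * v y - gauss z x y * partial k (partial k v) y)" for y
    by (simp add: has_partial_def)
  also have "\<dots> y = gauss z x y * (of_real ((norm (x - y))\<^sup>2) / (4 * z\<^sup>2) - of_nat CARD('n) / (2 * z)) * v y - gauss z x y * laplacian v y" for y
  proof -
    have "complex_of_real ((norm (x - y))\<^sup>2) = (\<Sum>k\<in>UNIV. (of_real (x $ k - y $ k))\<^sup>2)"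
      unfolding norm_sq_eq_sum by (simp add: power2_eq_square)
    then show ?thesis
      by (simp add: sum_subtractf laplacian_def sum_distrib_left[symmetric] sum_distrib_right[symmetric] sum_divide_distrib[symmetric]
        del: of_real_power of_real_diff)
  qed
  finally have eq: "(\<Sum>k\<in>UNIV. partial k (g k) y) = gauss z x y * (of_real ((norm (x - y))\<^sup>2) / (4 * z\<^sup>2) - of_nat CARD('n) / (2 * z)) * v y - gauss z x y * laplacian v y" for y .
  have "(partial k (g k) has_integral 0) UNIV" for k
    unfolding g_def
    by (intro has_integral_partial_zero c1_diff c1_mult c1_gauss c c1_const rapid_on_diff rapid_on_mult_left slow_on_mult sg sc slow_on_const r)
  then have "((\<lambda>y. \<Sum>k\<in>UNIV. partial k (g k) y) has_integral (\<Sum>k\<in>(UNIV :: 'n set). 0)) UNIV"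
    by (intro has_integral_sum) auto
  then have "((\<lambda>y. gauss z x y * (of_real ((norm (x - y))\<^sup>2) / (4 * z\<^sup>2) - of_nat CARD('n) / (2 * z)) * v y - gauss z x y * laplacian v y) has_integral 0) UNIV"
    unfolding eq by simp
  from integral_zero_of_has_integral[OF this] int1 int2
  show "(LINT y|lborel. gauss z x y * (of_real ((norm (x - y))\<^sup>2) / (4 * z\<^sup>2) - of_nat CARD('n) / (2 * z)) * v y)
       = (LINT y|lborel. gauss z x y * laplacian v y)"
    by simp
qed

text \<open>The power (4 \<pi> z)^(-n/2) with the principal logarithm, which is continuous up to the
  imaginary axis away from 0. One branch thus covers the limit of vanishing real part for both signs
  of time.\<close>

definition heat_coeff :: "nat \<Rightarrow> complex \<Rightarrow> complex" where
  "heat_coeff n z = exp (- (of_nat n / 2) * Ln (4 * of_real pi * z))"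

lemma heat_coeff_DERIV:
  assumes "Re z > 0"
  shows "(heat_coeff n has_field_derivative heat_coeff n z * (- of_nat n / (2 * z))) (at z)"
proof -
  have "4 * of_real pi * z \<notin> \<real>\<^sub>\<le>\<^sub>0" "z \<noteq> 0" using assms by (auto simp: complex_nonpos_Reals_iff mult_le_0_iff dest: leD)
  then show ?thesis
    unfolding heat_coeff_def[abs_def]
    by (auto intro!: derivative_eq_intros simp: field_simps)
qed

lemma norm_heat_coeff: "z \<noteq> 0 \<Longrightarrow> norm (heat_coeff n z) = (4 * pi * norm z) powr (- (n / 2))"
  by (simp add: heat_coeff_def powr_def norm_mult)

lemma norm_heat_coeff_mono:
  assumes "0 < e" "e \<le> norm z"
  shows "norm (heat_coeff n z) \<le> (4 * pi * e) powr (- (n / 2))"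
proof -
  have "z \<noteq> 0" using assms by auto
  then show ?thesis
    unfolding norm_heat_coeff[OF \<open>z \<noteq> 0\<close>] using assms by (intro powr_mono2') auto
qed

section \<open>The solution formula\<close>

lemma lborel_integral_affine:
  fixes h :: "'a::euclidean_space \<Rightarrow> 'b::{banach, second_countable_topology}"
  assumes "c \<noteq> 0" and h: "h \<in> borel_measurable borel"
  shows "(LINT y|lborel. h y) = \<bar>c\<bar> ^ DIM('a) *\<^sub>R (LINT w|lborel. h (x + c *\<^sub>R w))"
proof -
  have "(LINT y|lborel. h y) = (LINT y|density (distr lborel borel (\<lambda>w. x + c *\<^sub>R w)) (\<lambda>_. \<bar>c\<bar> ^ DIM('a)). h y)"
    by (subst lborel_affine[OF assms(1), of x]) (simp add: ennreal_power)
  also have "\<dots> = (LINT y|distr lborel borel (\<lambda>w. x + c *\<^sub>R w). \<bar>c\<bar> ^ DIM('a) *\<^sub>R h y)"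
    by (rule integral_density) (use h in auto)
  also have "\<dots> = (LINT w|lborel. \<bar>c\<bar> ^ DIM('a) *\<^sub>R h (x + c *\<^sub>R w))"
    by (rule integral_distr) (use h in auto)
  finally show ?thesis by simp
qed

lemma nn_integral_exp_neg_square: "(\<integral>\<^sup>+y. ennreal (exp (- (y * y))) \<partial>lborel) = ennreal (sqrt pi)"
proof -
  \<comment> \<open>Up to the factor \<open>sqrt pi\<close>, the function is the normal density of
    variance 1/2.\<close>
  have n: "normal_density 0 (1 / sqrt 2) y = exp (- (y * y)) / sqrt pi" for y
    by (simp add: normal_density_def power_divide power2_eq_square)
  have "exp (- (y * y)) = sqrt pi * normal_density 0 (1 / sqrt 2) y" for y
    by (simp add: n)
  moreover have "integrable lborel (\<lambda>y. sqrt pi * normal_density 0 (1 / sqrt 2) y)"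
    by (intro integrable_mult_right integrable_normal_density) simp
  moreover have "(LINT y|lborel. sqrt pi * normal_density 0 (1 / sqrt 2) y) = sqrt pi"
    by (simp add: integral_normal_density)
  ultimately show ?thesis
    by (subst nn_integral_eq_integral) auto
qed

lemma
  shows integrable_exp_neg_norm_sq: "integrable lborel (\<lambda>w :: real ^ 'n::finite. exp (- (norm w)\<^sup>2))"
    and integral_exp_neg_norm_sq: "(LINT w|lborel. exp (- (norm (w :: real ^ 'n))\<^sup>2)) = sqrt pi ^ CARD('n)"
proof -
  have "ennreal (exp (- (norm w)\<^sup>2)) = (\<Prod>i\<in>UNIV. ennreal (exp (- (w $ i * w $ i))))" for w :: "real ^ 'n"
    by (simp add: prod_ennreal norm_sq_eq_sum exp_sum[symmetric] sum_negf)
  then have nn: "(\<integral>\<^sup>+w. ennreal (exp (- (norm (w :: real ^ 'n))\<^sup>2)) \<partial>lborel) = ennreal (sqrt pi ^ CARD('n))"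
    using nn_integral_lborel_vec_prod[of "\<lambda>(i::'n) y. ennreal (exp (- (y * y)))"]
    by (simp add: nn_integral_exp_neg_square ennreal_power)
  show int: "integrable lborel (\<lambda>w :: real ^ 'n::finite. exp (- (norm w)\<^sup>2))"
    by (rule integrableI_nonneg) (auto simp: nn)
  show "(LINT w|lborel. exp (- (norm (w :: real ^ 'n))\<^sup>2)) = sqrt pi ^ CARD('n)"
    using nn by (subst (asm) nn_integral_eq_integral[OF int]) (auto simp: integral_nonneg_AE)
qed

text \<open>The time \<open>(c / 2)\<^sup>2\<close> is chosen so that the substitution y = x + c w
  turns the Gaussian into exp (- |w|^2). The Jacobian \<open>c ^ n\<close> then combines with the
  coefficient to a constant independent of \<open>c\<close>.\<close>

lemma heat_coeff_of_real:
  assumes "c > 0"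
  shows "complex_of_real (c ^ n) * heat_coeff n (of_real ((c / 2)\<^sup>2)) = 1 / of_real (sqrt pi ^ n)"
proof -
  have pos: "pi * c\<^sup>2 > 0" using assms by simp
  have "4 * of_real pi * of_real ((c / 2)\<^sup>2) = complex_of_real (pi * c\<^sup>2)"
    by (simp add: power_divide)
  then have "heat_coeff n (of_real ((c / 2)\<^sup>2)) = exp (- (of_nat n / 2) * of_real (ln (pi * c\<^sup>2)))"
    by (simp only: heat_coeff_def Ln_of_real[OF pos])
  also have "\<dots> = of_real (exp (- (n / 2) * ln (pi * c\<^sup>2)))"
    by (simp flip: exp_of_real)
  also have "exp (- (n / 2) * ln (pi * c\<^sup>2)) = inverse (sqrt (pi * c\<^sup>2) ^ n)"
  proof -
    have "- (n / 2) * ln (pi * c\<^sup>2) = - (n * ln (sqrt (pi * c\<^sup>2)))"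
      using pos by (simp add: ln_sqrt)
    moreover have "exp (ln (sqrt (pi * c\<^sup>2))) = sqrt (pi * c\<^sup>2)" using pos by simp
    ultimately show ?thesis by (simp only: exp_minus exp_of_nat_mult)
  qed
  also have "sqrt (pi * c\<^sup>2) = sqrt pi * c" using assms by (simp add: real_sqrt_mult)
  finally show ?thesis using assms by (simp add: power_mult_distrib field_simps)
qed

lemma heat_kernel_approximate_identity:
  fixes v :: "real ^ 'n::finite \<Rightarrow> complex"
  assumes c: "continuous_on UNIV v" and b: "\<And>y. norm (v y) \<le> B"
    and e: "e \<longlonglongrightarrow> 0" "\<And>m. e m > 0"
  shows "(\<lambda>m. LINT y|lborel. heat_coeff CARD('n) (of_real ((e m / 2)\<^sup>2)) * gauss (of_real ((e m / 2)\<^sup>2)) x y * v y)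
    \<longlonglongrightarrow> v x"
proof -
  have [measurable]: "v \<in> borel_measurable borel" by (rule borel_measurable_continuous_onI[OF c])
  have [measurable]: "gauss z x \<in> borel_measurable borel" for z
    by (rule borel_measurable_continuous_onI[OF c1_continuous[OF c1_gauss]])
  have eq: "(LINT y|lborel. heat_coeff CARD('n) (of_real ((c / 2)\<^sup>2)) * gauss (of_real ((c / 2)\<^sup>2)) x y * v y)
    = 1 / of_real (sqrt pi ^ CARD('n)) * (LINT w|lborel. of_real (exp (- (norm w)\<^sup>2)) * v (x + c *\<^sub>R w))" if "c > 0" for c
  proof -
    have g: "gauss (of_real ((c / 2)\<^sup>2)) x (x + c *\<^sub>R w) = of_real (exp (- (norm w)\<^sup>2))" for w
      using that by (simp add: gauss_eq power_mult_distrib power_divide flip: exp_of_real)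
    have "(LINT y|lborel. heat_coeff CARD('n) (of_real ((c / 2)\<^sup>2)) * gauss (of_real ((c / 2)\<^sup>2)) x y * v y)
      = \<bar>c\<bar> ^ DIM(real ^ 'n) *\<^sub>R (LINT w|lborel. heat_coeff CARD('n) (of_real ((c / 2)\<^sup>2)) * gauss (of_real ((c / 2)\<^sup>2)) x (x + c *\<^sub>R w) * v (x + c *\<^sub>R w))"
      by (rule lborel_integral_affine) (use that in auto)
    also have "\<dots> = (complex_of_real (c ^ CARD('n)) * heat_coeff CARD('n) (of_real ((c / 2)\<^sup>2))) * (LINT w|lborel. of_real (exp (- (norm w)\<^sup>2)) * v (x + c *\<^sub>R w))"
      unfolding g using that by (simp add: scaleR_conv_of_real mult.assoc)
    finally show ?thesis unfolding heat_coeff_of_real[OF that] .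
  qed
  have "(\<lambda>m. LINT w|lborel. of_real (exp (- (norm w)\<^sup>2)) * v (x + e m *\<^sub>R w)) \<longlonglongrightarrow>
    (LINT w|lborel. of_real (exp (- (norm (w :: real ^ 'n))\<^sup>2)) * v x)"
  proof (rule integral_dominated_convergence[where w="\<lambda>w. exp (- (norm w)\<^sup>2) * B"])
    show "integrable lborel (\<lambda>w :: real ^ 'n. exp (- (norm w)\<^sup>2) * B)"
      using integrable_exp_neg_norm_sq by (rule integrable_mult_left)
    have "(\<lambda>m. x + e m *\<^sub>R w) \<longlonglongrightarrow> x + 0 *\<^sub>R w" for w
      by (intro tendsto_intros e)
    then have "(\<lambda>m. v (x + e m *\<^sub>R w)) \<longlonglongrightarrow> v (x + 0 *\<^sub>R w)" for w
      by (rule continuous_on_tendsto_compose[OF c]) auto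
    then show "AE w in lborel. (\<lambda>m. of_real (exp (- (norm w)\<^sup>2)) * v (x + e m *\<^sub>R w)) \<longlonglongrightarrow> of_real (exp (- (norm w)\<^sup>2)) * v x"
      by (auto intro!: tendsto_intros)
  qed (auto simp: norm_mult intro!: mult_left_mono b)
  moreover have "(LINT w|lborel. of_real (exp (- (norm (w :: real ^ 'n))\<^sup>2)) * v x) = of_real (sqrt pi ^ CARD('n)) * v x"
    using integrable_exp_neg_norm_sq[where 'n='n] integral_exp_neg_norm_sq[where 'n='n] by simp
  ultimately show ?thesis
    unfolding eq[OF e(2)] by (auto intro!: tendsto_eq_intros)
qed

text \<open>The extra real part \<open>\<epsilon>\<close> of the complex time makes the kernel a genuine Gaussian, so that
  no oscillatory integral has to be estimated.\<close>

lemma heat_pairing_has_vector_derivative: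
  fixes u :: "real \<Rightarrow> real ^ 'n::finite \<Rightarrow> complex" and t :: real
  assumes sol: "schroedinger_solution f u" and e: "e > 0"
  defines "z s \<equiv> complex_of_real e + \<i> * of_real (t - s)"
  shows "((\<lambda>s. LINT y|lborel. heat_coeff CARD('n) (z s) * gauss (z s) x y * u s y) has_vector_derivative 0) (at r)"
proof -
  let ?n = "CARD('n)"
  have Re_z: "Re (z s) = e" for s by (simp add: z_def)
  have z: "z s \<noteq> 0" "norm (z s) \<ge> e" for s
    using Re_z[of s] e abs_Re_le_cmod[of "z s"] by auto
  have sch: "schwartz_on (S :: 's set) (\<lambda>_. u s)" for s S
    by (rule schwartz_schwartz_on[OF solution_schwartz[OF sol]])
  have cu: "continuous_on A (u s)" for s A
    by (intro c1_continuous smooth_c1 solution_smooth[OF sol])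
  \<comment> \<open>The \<open>z\<close>-derivative of the normalized kernel equals its Laplacian in
    \<open>y\<close>, which yields \<open>?A\<close>. Since the derivative of \<open>z\<close> is -i
    and the equation gives i times the Laplacian of \<open>u\<close>, the derivative of the pairing
    is a multiple of the difference in Green's identity.\<close>
  let ?A = "\<lambda>s y. gauss (z s) x y * (of_real ((norm (x - y))\<^sup>2) / (4 * (z s)\<^sup>2) - of_nat ?n / (2 * z s)) * u s y"
  let ?B = "\<lambda>s y. gauss (z s) x y * laplacian (u s) y"
  let ?F = "\<lambda>s y. heat_coeff ?n (z s) * gauss (z s) x y * u s y"
  let ?F' = "\<lambda>s y. heat_coeff ?n (z s) * (- \<i>) * (?A s y - ?B s y)"
  have dz: "(z has_vector_derivative - \<i>) (at s)" for s
    unfolding z_def[abs_def] by (auto intro!: derivative_eq_intros)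
  have der: "((\<lambda>s. ?F s y) has_vector_derivative ?F' s y) (at s)" for s y
  proof -
    have h: "((\<lambda>s. heat_coeff ?n (z s)) has_vector_derivative - \<i> * (heat_coeff ?n (z s) * (- of_nat ?n / (2 * z s)))) (at s)"
      using field_vector_diff_chain_at[OF dz heat_coeff_DERIV, of s ?n] e by (simp add: Re_z comp_def)
    have "((\<lambda>z. gauss z x y) has_field_derivative gauss (z s) x y * (of_real ((norm (x - y))\<^sup>2) / (4 * (z s)\<^sup>2))) (at (z s))"
      unfolding gauss_eq using z(1)[of s] by (auto intro!: derivative_eq_intros simp: field_simps power2_eq_square)
    from field_vector_diff_chain_at[OF dz this]
    have g: "((\<lambda>s. gauss (z s) x y) has_vector_derivative - \<i> * (gauss (z s) x y * (of_real ((norm (x - y))\<^sup>2) / (4 * (z s)\<^sup>2)))) (at s)"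
      by (simp add: comp_def)
    have "((\<lambda>s. ?F s y) has_vector_derivative
      (heat_coeff ?n (z s) * gauss (z s) x y) * (\<i> * laplacian (u s) y)
        + (heat_coeff ?n (z s) * (- \<i> * (gauss (z s) x y * (of_real ((norm (x - y))\<^sup>2) / (4 * (z s)\<^sup>2))))
          + (- \<i> * (heat_coeff ?n (z s) * (- of_nat ?n / (2 * z s)))) * gauss (z s) x y) * u s y) (at s)"
      by (intro has_vector_derivative_mult h g solution_has_vector_derivative[OF sol])
    then show ?thesis
      by (rule back_subst[where P="\<lambda>d. (_ has_vector_derivative d) (at s)"]) (simp add: algebra_simps)
  qed
  let ?S = "{r - 1..r + 1}"
  have "rapid_on ?S ?F'"
  proof -
    have 1: "slow_on ?S (\<lambda>s y. heat_coeff ?n (z s))"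
      using norm_heat_coeff_mono[OF e z(2)] by (rule slow_on_bounded)
    have 2: "slow_on ?S (\<lambda>s. gauss (z s) x)"
      by (rule slow_on_bounded[where C=1], rule norm_gauss_le) (use Re_z e in simp)
    have 3: "slow_on ?S (\<lambda>s (y :: real ^ 'n). inverse (4 * (z s)\<^sup>2))" "slow_on ?S (\<lambda>s (y :: real ^ 'n). inverse (2 * z s))"
    proof -
      have i: "inverse (norm (z s)) \<le> inverse e" for s using z(2)[of s] e by (intro le_imp_inverse_le) auto
      have "norm (inverse (4 * (z s)\<^sup>2)) \<le> 1 * (inverse e)\<^sup>2" for s
      proof -
        have "norm (inverse (4 * (z s)\<^sup>2)) = inverse 4 * (inverse (norm (z s)))\<^sup>2"
          by (simp add: norm_inverse norm_mult norm_power power_inverse)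
        also have "\<dots> \<le> 1 * (inverse e)\<^sup>2" by (intro mult_mono power_mono i) auto
        finally show ?thesis .
      qed
      then show "slow_on ?S (\<lambda>s (y :: real ^ 'n). inverse (4 * (z s)\<^sup>2))"
        by (rule slow_on_bounded)
      show "slow_on ?S (\<lambda>s (y :: real ^ 'n). inverse (2 * z s))"
      proof (rule slow_on_bounded)
        fix s
        have "norm (inverse (2 * z s)) = inverse 2 * inverse (norm (z s))"
          by (simp add: norm_inverse norm_mult)
        also have "\<dots> \<le> 1 * inverse e" by (intro mult_mono i) auto
        finally show "norm (inverse (2 * z s)) \<le> 1 * inverse e" .
      qed
    qed
    have 4: "slow_on ?S (\<lambda>s y. complex_of_real ((norm (x - y))\<^sup>2))"
      unfolding norm_sq_eq_sum
      by (intro slow_on_of_real slow_on_sum slow_on_mult) (auto intro!: slow_on_diff slow_on_const slow_on_component)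
    show ?thesis
      unfolding divide_inverse
      by (intro rapid_on_mult_left rapid_on_diff slow_on_mult slow_on_diff 1 2 3 4 slow_on_const
        rapid_on_laplacian schwartz_on_rapid solution_schwartz_on[OF sol])
  qed
  then obtain D where D: "\<And>s y. s \<in> ?S \<Longrightarrow> norm (?F' s y) \<le> D * weight y"
    by (rule rapid_on_weight) blast
  have int: "integrable lborel (?F s)" for s
  proof (rule rapid_integrable)
    show "rapid (?F s)"
      by (intro rapid_on_mult_left slow_on_mult slow_on_const schwartz_on_rapid sch
        slow_on_bounded[where h="\<lambda>_. gauss (z s) x" and C=1] norm_gauss_le) (use Re_z e in simp)
    show "continuous_on UNIV (?F s)"
      by (intro continuous_intros cu c1_continuous c1_gauss)
  qed
  have "((\<lambda>s. integral\<^sup>L lborel (?F s)) has_vector_derivative integral\<^sup>L lborel (?F' r)) (at r)"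
  proof (rule has_vector_derivative_integral[OF int, where d=1 and w="\<lambda>y. D * weight y"])
    show "norm (?F' s y) \<le> D * weight y" if "\<bar>s - r\<bar> < 1" for s y
      using that by (intro D) auto
  qed (use der in \<open>auto simp: integrable_weight\<close>)
  moreover have "integral\<^sup>L lborel (?F' r) = 0"
    using integral_gauss_laplacian[OF sch, of "z r" x r] Re_z[of r] z(1)[of r] e by simp
  ultimately show ?thesis by (simp only:)
qed

definition phase :: "real \<Rightarrow> real ^ 'n::finite \<Rightarrow> complex" where
  "phase t y = exp (\<i> * of_real ((norm y)\<^sup>2 / (4 * t)))"

text \<open>Expanding the square, the cross term becomes the Fourier character at frequency x / (4
  \<pi> t); this is the origin of the rescaling.\<close>

lemma gauss_imaginary:
  assumes "t \<noteq> 0"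
  shows "gauss (\<i> * of_real t) x y =
    phase t x * exp (- 2 * of_real pi * \<i> * of_real (y \<bullet> ((1 / (4 * pi * t)) *\<^sub>R x))) * phase t y"
proof -
  have "(norm (x - y))\<^sup>2 = (norm x)\<^sup>2 + (norm y)\<^sup>2 - 2 * (y \<bullet> x)"
    by (simp add: power2_norm_eq_inner inner_diff_left inner_diff_right inner_commute)
  then have "(norm (x - y))\<^sup>2 / (4 * t) =
      (norm x)\<^sup>2 / (4 * t) - 2 * pi * (y \<bullet> ((1 / (4 * pi * t)) *\<^sub>R x)) + (norm y)\<^sup>2 / (4 * t)"
    using assms by (simp add: field_simps)
  moreover have "- of_real r / (4 * (\<i> * of_real t)) = \<i> * of_real (r / (4 * t))" for r
    using assms by (simp add: field_simps)
  ultimately have "gauss (\<i> * of_real t) x y =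
      exp (\<i> * of_real ((norm x)\<^sup>2 / (4 * t) - 2 * pi * (y \<bullet> ((1 / (4 * pi * t)) *\<^sub>R x)) + (norm y)\<^sup>2 / (4 * t)))"
    by (simp only: gauss_eq)
  also have "\<dots> = phase t x * exp (- 2 * of_real pi * \<i> * of_real (y \<bullet> ((1 / (4 * pi * t)) *\<^sub>R x))) * phase t y"
    unfolding phase_def exp_add[symmetric]
    by (rule arg_cong[where f=exp]) (simp add: ring_distribs mult.assoc mult.left_commute)
  finally show ?thesis .
qed

text \<open>For fixed real part the pairing \<open>?\<Phi> m s\<close> does not depend on
  \<open>s\<close>. As \<open>m\<close> grows, its value at \<open>s = t\<close> tends to
  \<open>u t x\<close> by the approximate identity, and its value at \<open>s = 0\<close> tends to
  the oscillatory integral of the initial data. In particular the solution is unique.\<close>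

lemma solution_formula:
  fixes u :: "real \<Rightarrow> real ^ 'n::finite \<Rightarrow> complex"
  assumes sol: "schroedinger_solution f u" and t: "t \<noteq> 0"
  shows "u t x = heat_coeff CARD('n) (\<i> * of_real t) * phase t x * fourier (\<lambda>y. phase t y * f y) ((1 / (4 * pi * t)) *\<^sub>R x)"
proof -
  let ?n = "CARD('n)"
  define e where "e m = 1 / real (Suc m)" for m
  have e: "e \<longlonglongrightarrow> 0" "\<And>m. e m > 0"
    using LIMSEQ_inverse_real_of_nat by (simp_all add: e_def[abs_def] inverse_eq_divide)
  define w where "w m s = complex_of_real ((e m / 2)\<^sup>2) + \<i> * of_real (t - s)" for m s
  let ?\<Phi> = "\<lambda>m s. LINT y|lborel. heat_coeff ?n (w m s) * gauss (w m s) x y * u s y"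
  have sch: "schwartz_on (UNIV :: unit set) (\<lambda>_. u s)" for s
    by (rule schwartz_schwartz_on[OF solution_schwartz[OF sol]])
  have cu: "continuous_on A (u s)" for s A
    by (intro c1_continuous smooth_c1 solution_smooth[OF sol])
  have const: "?\<Phi> m 0 = ?\<Phi> m t" for m
  proof -
    have "(?\<Phi> m has_vector_derivative 0) (at r within UNIV)" for r
      unfolding w_def using e(2)[of m] by (intro heat_pairing_has_vector_derivative[OF sol]) simp
    then show ?thesis by (rule has_vector_derivative_zero_constant[of UNIV, rotated]) auto
  qed
  obtain B where B: "\<And>y. norm (u t y) \<le> B"
    by (rule rapid_onE[OF schwartz_on_rapid[OF sch], where N=0]) auto
  have "(\<lambda>m. ?\<Phi> m t) \<longlonglongrightarrow> u t x"
    using heat_kernel_approximate_identity[OF cu B e] by (simp add: w_def)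
  then have lim1: "(\<lambda>m. ?\<Phi> m 0) \<longlonglongrightarrow> u t x" unfolding const .
  have wlim: "(\<lambda>m. w m 0) \<longlonglongrightarrow> \<i> * of_real t"
  proof -
    have "(\<lambda>m. complex_of_real ((e m / 2)\<^sup>2) + \<i> * of_real (t - 0)) \<longlonglongrightarrow> complex_of_real ((0 / 2)\<^sup>2) + \<i> * of_real (t - 0)"
      by (intro tendsto_intros e) auto
    then show ?thesis by (simp add: w_def)
  qed
  \<comment> \<open>The imaginary part of \<open>w m 0\<close> is \<open>t\<close>, so the
    coefficient stays bounded while the real part vanishes; this yields the constant in the
    dominating function.\<close>
  have Re_w: "Re (w m 0) \<ge> 0" and norm_w: "\<bar>t\<bar> \<le> norm (w m 0)" for m
    using abs_Im_le_cmod[of "w m 0"] by (simp_all add: w_def)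
  have "(\<lambda>m. ?\<Phi> m 0) \<longlonglongrightarrow> (LINT y|lborel. heat_coeff ?n (\<i> * of_real t) * gauss (\<i> * of_real t) x y * u 0 y)"
  proof (rule integral_dominated_convergence[where w="\<lambda>y. (4 * pi * \<bar>t\<bar>) powr (- (?n / 2)) * 1 * norm (u 0 y)"])
    have "integrable lborel (u 0)" by (intro rapid_integrable schwartz_on_rapid sch cu)
    then show "integrable lborel (\<lambda>y. (4 * pi * \<bar>t\<bar>) powr (- (?n / 2)) * 1 * norm (u 0 y))" by simp
    have m: "(\<lambda>y. heat_coeff ?n z * gauss z x y * u 0 y) \<in> borel_measurable lborel" for z
    proof -
      have "continuous_on UNIV (\<lambda>y. heat_coeff ?n z * gauss z x y * u 0 y)"
        by (intro continuous_on_mult continuous_on_const cu c1_continuous[OF c1_gauss])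
      from borel_measurable_continuous_onI[OF this] show ?thesis by simp
    qed
    show "(\<lambda>y. heat_coeff ?n (\<i> * of_real t) * gauss (\<i> * of_real t) x y * u 0 y) \<in> borel_measurable lborel"
      "(\<lambda>y. heat_coeff ?n (w m 0) * gauss (w m 0) x y * u 0 y) \<in> borel_measurable lborel" for m
      by (rule m)+
    have "4 * of_real pi * (\<i> * of_real t) \<notin> \<real>\<^sub>\<le>\<^sub>0" using t by (simp add: complex_nonpos_Reals_iff)
    then have hc: "(\<lambda>m. heat_coeff ?n (w m 0)) \<longlonglongrightarrow> heat_coeff ?n (\<i> * of_real t)"
      unfolding heat_coeff_def by (intro tendsto_intros wlim) auto
    have "(\<lambda>m. gauss (w m 0) x y) \<longlonglongrightarrow> gauss (\<i> * of_real t) x y" for y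
      unfolding gauss_eq using t by (intro tendsto_intros wlim) auto
    with hc show "AE y in lborel. (\<lambda>m. heat_coeff ?n (w m 0) * gauss (w m 0) x y * u 0 y) \<longlonglongrightarrow>
        heat_coeff ?n (\<i> * of_real t) * gauss (\<i> * of_real t) x y * u 0 y"
      by (intro AE_I2 tendsto_intros)
    show "AE y in lborel. norm (heat_coeff ?n (w m 0) * gauss (w m 0) x y * u 0 y) \<le>
        (4 * pi * \<bar>t\<bar>) powr (- (?n / 2)) * 1 * norm (u 0 y)" for m
      unfolding norm_mult using t Re_w norm_w
      by (intro AE_I2 mult_mono norm_heat_coeff_mono norm_gauss_le) auto
  qed
  with lim1 have "u t x = (LINT y|lborel. heat_coeff ?n (\<i> * of_real t) * gauss (\<i> * of_real t) x y * u 0 y)"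
    by (rule LIMSEQ_unique)
  also have "\<dots> = (LINT y|lborel. (heat_coeff ?n (\<i> * of_real t) * phase t x) *
      (exp (- 2 * of_real pi * \<i> * of_real (y \<bullet> ((1 / (4 * pi * t)) *\<^sub>R x))) * (phase t y * f y)))"
    unfolding gauss_imaginary[OF t] solution_initial[OF sol] by (simp only: ac_simps)
  also have "\<dots> = heat_coeff ?n (\<i> * of_real t) * phase t x * fourier (\<lambda>y. phase t y * f y) ((1 / (4 * pi * t)) *\<^sub>R x)"
    unfolding fourier_def by (rule integral_mult_right_zero)
  finally show ?thesis .
qed

section \<open>Uniform decay of oscillating Fourier transforms\<close>

lemma partials_add:
  assumes "smooth f" "smooth g"
  shows "partials is (\<lambda>x. f x + g x) = (\<lambda>x. partials is f x + partials is g x)"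
  by (induction "is") (auto simp: partial_add smooth_differentiable[OF smooth_partials] assms)

lemma partials_cmult:
  fixes f :: "real ^ 'n::finite \<Rightarrow> complex"
  assumes "smooth f"
  shows "partials is (\<lambda>x. c * f x) = (\<lambda>x. c * partials is f x)"
  by (induction "is") (auto simp: partial_bounded_linear[OF bounded_linear_mult_right]
      smooth_differentiable[OF smooth_partials] assms)

lemma schwartz_on_add:
  assumes "schwartz_on S f" "schwartz_on S g"
  shows "schwartz_on S (\<lambda>s x. f s x + g s x)"
  unfolding schwartz_on_def
proof (intro conjI allI ballI)
  have sm: "smooth (f s)" "smooth (g s)" if "s \<in> S" for s
    using assms that by (auto simp: schwartz_on_def)
  show "smooth (\<lambda>x. f s x + g s x)" if "s \<in> S" for s
    unfolding smooth_def partials_add[OF sm[OF that]]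
    by (intro allI differentiable_add smooth_differentiable smooth_partials sm that)
  show "rapid_on S (\<lambda>s. partials is (\<lambda>x. f s x + g s x))" for "is"
  proof (rule rapid_on_le[where C=1])
    show "rapid_on S (\<lambda>s x. partials is (f s) x + partials is (g s) x)"
      by (intro rapid_on_add schwartz_on_rapid schwartz_on_partials assms)
  qed (use partials_add[OF sm] in auto)
qed

lemma schwartz_on_cmult:
  assumes "schwartz_on S f" "\<And>s. s \<in> S \<Longrightarrow> norm (c s) \<le> B"
  shows "schwartz_on S (\<lambda>s x. c s * f s x)"
  unfolding schwartz_on_def
proof (intro conjI allI ballI)
  have sm: "smooth (f s)" if "s \<in> S" for s
    using assms that by (auto simp: schwartz_on_def)
  show "smooth (\<lambda>x. c s * f s x)" if "s \<in> S" for s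
    unfolding smooth_def partials_cmult[OF sm[OF that]]
    by (intro allI differentiable_bounded_linear[OF bounded_linear_mult_right] smooth_differentiable smooth_partials sm that)
  show "rapid_on S (\<lambda>s. partials is (\<lambda>x. c s * f s x))" for "is"
  proof (rule rapid_on_le[where C=1])
    show "rapid_on S (\<lambda>s x. c s * partials is (f s) x)"
      by (intro rapid_on_mult_left slow_on_bounded[OF assms(2)] schwartz_on_rapid schwartz_on_partials assms)
  qed (use partials_cmult[OF sm] in auto)
qed

text \<open>Leibniz rule for a factor that is linear: \<open>L\<close> lists the index lists
  obtained by deleting one occurrence of \<open>j\<close>. That \<open>L\<close> does not depend on
  \<open>g\<close> makes the resulting bounds uniform over a family.\<close>

lemma partials_component_mult:
  "\<exists>L. \<forall>g :: real ^ 'n::finite \<Rightarrow> complex. smooth g \<longrightarrow>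
     partials is (\<lambda>y. of_real (y $ j) * g y) = (\<lambda>y. of_real (y $ j) * partials is g y + (\<Sum>l\<leftarrow>L. partials l g y))"
proof (induction "is")
  case Nil
  then show ?case by (intro exI[of _ "[]"]) simp
next
  case (Cons i "is")
  then obtain L where L: "\<And>g :: real ^ 'n \<Rightarrow> complex. smooth g \<Longrightarrow>
     partials is (\<lambda>y. of_real (y $ j) * g y) = (\<lambda>y. of_real (y $ j) * partials is g y + (\<Sum>l\<leftarrow>L. partials l g y))"
    by blast
  have "partials (i # is) (\<lambda>y. of_real (y $ j) * g y) x = of_real (x $ j) * partials (i # is) g x
      + (\<Sum>l\<leftarrow>(if i = j then [is] else []) @ map ((#) i) L. partials l g x)"
    if g: "smooth g" for g :: "real ^ 'n \<Rightarrow> complex" and x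
  proof -
    have c: "c1 (partials l g)" for l by (intro smooth_c1 smooth_partials g)
    have "has_partial i (\<lambda>y. \<Sum>l\<leftarrow>K. partials l g y) (\<Sum>l\<leftarrow>K. partials (i # l) g x) x" for K
    proof (induction K)
      case (Cons a K)
      from has_partial_add[OF has_partial_c1[OF c] this] show ?case by simp
    qed (simp add: has_partial_const)
    then have "has_partial i (\<lambda>y. of_real (y $ j) * partials is g y + (\<Sum>l\<leftarrow>L. partials l g y))
      (of_real (if i = j then 1 else 0) * partials is g x + of_real (x $ j) * partial i (partials is g) x
        + (\<Sum>l\<leftarrow>L. partials (i # l) g x)) x"
      by (intro has_partial_add has_partial_mult has_partial_of_real has_partial_component has_partial_c1[OF c])
    then show ?thesis unfolding partials.simps L[OF g] by (auto simp: has_partial_def comp_def)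
  qed
  then show ?case by (intro exI[of _ "(if i = j then [is] else []) @ map ((#) i) L"]) auto
qed

lemma schwartz_on_component_mult:
  fixes f :: "'s \<Rightarrow> real ^ 'n::finite \<Rightarrow> complex"
  assumes f: "schwartz_on S f"
  shows "schwartz_on S (\<lambda>s y. of_real (y $ j) * f s y)"
  unfolding schwartz_on_def
proof (intro conjI allI ballI)
  have sm: "smooth (f s)" if "s \<in> S" for s
    using f that by (auto simp: schwartz_on_def)
  define L where "L is = (SOME L. \<forall>g :: real ^ 'n \<Rightarrow> complex. smooth g \<longrightarrow>
     partials is (\<lambda>y. of_real (y $ j) * g y) = (\<lambda>y. of_real (y $ j) * partials is g y + (\<Sum>l\<leftarrow>L. partials l g y)))" for "is"
  have L: "partials is (\<lambda>y. of_real (y $ j) * g y) = (\<lambda>y. of_real (y $ j) * partials is g y + (\<Sum>l\<leftarrow>L is. partials l g y))"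
    if "smooth g" for "is" and g :: "real ^ 'n \<Rightarrow> complex"
    using someI_ex[OF partials_component_mult[of "is" j]] that unfolding L_def by blast
  show "smooth (\<lambda>y. of_real (y $ j) * f s y)" if "s \<in> S" for s
  proof -
    have c: "c1 (partials l (f s))" for l by (intro smooth_c1 smooth_partials sm that)
    have "c1 (\<lambda>y. \<Sum>l\<leftarrow>K. partials l (f s) y)" for K
      by (induction K) (auto intro: c1_const c1_add c)
    then show ?thesis
      unfolding smooth_def L[OF sm[OF that]]
      by (intro allI c1_differentiable c1_add c1_mult c1_of_real c1_component c)
  qed
  show "rapid_on S (\<lambda>s. partials is (\<lambda>y. of_real (y $ j) * f s y))" for "is"
  proof (rule rapid_on_le[where C=1])
    have "rapid_on S (\<lambda>s y. \<Sum>l\<leftarrow>K. partials l (f s) y)" for K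
    proof (induction K)
      case (Cons a K)
      from rapid_on_add[OF schwartz_on_rapid[OF schwartz_on_partials[OF f, of a]] this] show ?case by simp
    qed (simp add: rapid_on_zero)
    then show "rapid_on S (\<lambda>s y. of_real (y $ j) * partials is (f s) y + (\<Sum>l\<leftarrow>L is. partials l (f s) y))"
      by (rule rapid_on_add[rotated])
        (intro rapid_on_mult_left slow_on_of_real slow_on_component schwartz_on_rapid schwartz_on_partials f)
  qed (use L[OF sm] in auto)
qed

section \<open>The quadratic phase and the Fourier characters\<close>

lemma phase_eq_gauss: "phase t = gauss (\<i> * of_real t) 0"
proof
  fix y :: "real ^ 'n"
  have "\<i> * complex_of_real (r / (4 * t)) = - of_real r / (4 * (\<i> * of_real t))" for r
    by (cases "t = 0") (simp_all add: field_simps)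
  then show "phase t y = gauss (\<i> * of_real t) 0 y"
    by (simp only: phase_def gauss_eq) simp
qed

lemma norm_phase: "norm (phase t y) = 1"
  by (simp add: phase_def)

lemma c1_phase: "c1 (phase t)"
  unfolding phase_eq_gauss by (rule c1_gauss)

lemma has_partial_phase: "has_partial k (phase t) (phase t y * (\<i> / of_real (2 * t) * of_real (y $ k))) y"
  using has_partial_gauss[of k "\<i> * of_real t" 0 y] unfolding phase_eq_gauss
  by (rule back_subst[where P="\<lambda>d. has_partial k _ d y"]) (cases "t = 0"; simp add: field_simps)

definition character :: "real ^ 'n::finite \<Rightarrow> real ^ 'n \<Rightarrow> complex" where
  "character \<xi> y = exp (- 2 * of_real pi * \<i> * of_real (y \<bullet> \<xi>))"

lemma norm_character: "norm (character \<xi> y) = 1"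
  by (simp add: character_def)

lemma has_partial_inner: "has_partial k (\<lambda>y. y \<bullet> \<xi>) (\<xi> $ k) y"
  using partial_eqI[OF bounded_linear_imp_has_derivative[OF bounded_linear_inner_left]]
    bounded_linear_imp_differentiable[OF bounded_linear_inner_left]
  by (simp add: has_partial_def inner_axis' )

lemma has_partial_character: "has_partial k (character \<xi>) (character \<xi> y * (- 2 * of_real pi * \<i> * of_real (\<xi> $ k))) y"
  unfolding character_def[abs_def]
  by (rule has_partial_exp, rule has_partial_cmult, rule has_partial_of_real, rule has_partial_inner)

lemma c1_character:
  fixes \<xi> :: "real ^ 'n::finite"
  shows "c1 (character \<xi>)"
proof -
  have "c1 (\<lambda>y :: real ^ 'n. y \<bullet> \<xi>)"
    by (rule c1_of_has_partial[OF has_partial_inner]) auto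
  then show ?thesis unfolding character_def[abs_def] by (intro c1_exp c1_mult c1_const c1_of_real)
qed

text \<open>The derivative of character times phase times \<open>g\<close> has integral zero; the
  character contributes the left-hand side, the phase the term with
  \<open>1 / (2 * t)\<close>.\<close>

lemma fourier_phase_component:
  fixes g :: "real ^ 'n::finite \<Rightarrow> complex"
  assumes g: "schwartz_on (UNIV :: unit set) (\<lambda>_. g)"
  shows "2 * of_real pi * \<i> * of_real (\<xi> $ k) * fourier (\<lambda>y. phase t y * g y) \<xi> =
    fourier (\<lambda>y. phase t y * (partial k g y + \<i> / of_real (2 * t) * (of_real (y $ k) * g y))) \<xi>"
proof -
  have sm: "smooth g" using schwartz_on_smooth[OF g] by simp
  have c: "c1 g" "c1 (partial k g)" by (intro smooth_c1 smooth_partial sm)+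
  have s: "slow (character \<xi>)" "slow (phase t :: real ^ 'n \<Rightarrow> complex)"
    by (rule slow_on_bounded[where C=1], simp add: norm_character norm_phase)+
  have r: "rapid g" "rapid (partial k g)"
    by (intro schwartz_on_rapid schwartz_on_partial g)+
  have r': "rapid (\<lambda>y. of_real (y $ k) * g y)"
    by (intro schwartz_on_rapid schwartz_on_component_mult g)
  let ?h = "\<lambda>y. character \<xi> y * (phase t y * g y)"
  let ?h' = "\<lambda>y. character \<xi> y * (phase t y * (partial k g y + \<i> / of_real (2 * t) * (of_real (y $ k) * g y)))"
  have "has_partial k ?h (character \<xi> y * (- 2 * of_real pi * \<i> * of_real (\<xi> $ k)) * (phase t y * g y)
     + character \<xi> y * (phase t y * (\<i> / of_real (2 * t) * of_real (y $ k)) * g y + phase t y * partial k g y)) y" for y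
    by (intro has_partial_mult has_partial_character has_partial_phase has_partial_c1 c)
  then have eq: "partial k ?h = (\<lambda>y. ?h' y - 2 * of_real pi * \<i> * of_real (\<xi> $ k) * ?h y)"
    by (intro ext) (simp add: has_partial_def algebra_simps)
  have "(partial k ?h has_integral 0) UNIV"
    by (intro has_integral_partial_zero c1_mult c1_character c1_phase c rapid_on_mult_left s r)
  then have 0: "((\<lambda>y. ?h' y - 2 * of_real pi * \<i> * of_real (\<xi> $ k) * ?h y) has_integral 0) UNIV"
    by (simp only: eq)
  have 1: "integrable lborel ?h"
    by (intro rapid_c1_integrable c1_mult c1_character c1_phase c rapid_on_mult_left s r)
  have 2: "integrable lborel ?h'"
    by (intro rapid_c1_integrable c1_mult c1_character c1_phase c rapid_on_mult_left s r r' rapid_on_add slow_on_const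
      c1_add c1_const c1_of_real c1_component)
  from integral_zero_of_has_integral[OF 0] 1 2
  have "integral\<^sup>L lborel ?h' = 2 * of_real pi * \<i> * of_real (\<xi> $ k) * integral\<^sup>L lborel ?h"
    by simp
  then show ?thesis unfolding fourier_def character_def by simp
qed

lemma norm_fourier_le:
  assumes "integrable lborel g"
  shows "norm (fourier g \<xi>) \<le> (LINT y|lborel. norm (g y))"
proof -
  have "norm (fourier g \<xi>) \<le> (LINT y|lborel. norm (character \<xi> y * g y))"
    unfolding fourier_def character_def[symmetric] by (rule integral_norm_bound)
  then show ?thesis by (simp add: norm_mult norm_character)
qed

text \<open>Multiplication by \<open>\<xi>\<close> turns into a derivative, and the derivative of the phase only
  produces the factor \<open>y / (2 t)\<close>, which is harmless for \<open>\<bar>t\<bar> \<ge> 1\<close>. Hence the decay is uniform in \<open>t\<close>.\<close>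

lemma rapid_on_fourier_phase:
  fixes g :: "real \<Rightarrow> real ^ 'n::finite \<Rightarrow> complex"
  assumes "schwartz_on {t. 1 \<le> \<bar>t\<bar>} g"
  shows "rapid_on {t. 1 \<le> \<bar>t\<bar>} (\<lambda>t. fourier (\<lambda>y. phase t y * g t y))"
  unfolding rapid_on_def
proof
  fix N
  let ?S = "{t. 1 \<le> \<bar>t :: real\<bar>}"
  show "\<exists>C. \<forall>t\<in>?S. \<forall>\<xi>. (1 + norm \<xi>) ^ N * norm (fourier (\<lambda>y. phase t y * g t y) \<xi>) \<le> C"
    using assms
  proof (induction N arbitrary: g)
    case (0 g)
    obtain D where D: "\<And>t y. t \<in> ?S \<Longrightarrow> norm (g t y) \<le> D * weight y"
      by (rule rapid_on_weight[OF schwartz_on_rapid[OF 0]]) blast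
    have "norm (fourier (\<lambda>y. phase t y * g t y) \<xi>) \<le> (LINT y|lborel. D * weight (y :: real ^ 'n))" if t: "t \<in> ?S" for t \<xi>
    proof -
      have sch: "schwartz_on (UNIV :: unit set) (\<lambda>_. g t)"
        by (rule schwartz_on_reindex[OF 0, where k="\<lambda>_. t"]) (rule t)
      have "integrable lborel (\<lambda>y. phase t y * g t y)"
        using schwartz_on_smooth[OF sch] schwartz_on_rapid[OF sch]
        by (intro rapid_c1_integrable c1_mult c1_phase rapid_on_mult_left slow_on_bounded[where C=1] smooth_c1)
          (auto simp: norm_phase)
      moreover from this have "(LINT y|lborel. norm (phase t y * g t y)) \<le> (LINT y|lborel. D * weight (y :: real ^ 'n))"
        using D[OF t]
        by (intro Bochner_Integration.integral_mono integrable_norm) (simp_all add: integrable_weight norm_mult norm_phase)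
      ultimately show ?thesis using norm_fourier_le order_trans by blast
    qed
    then show ?case by auto
  next
    case (Suc N g)
    \<comment> \<open>The induction leaves the amplitude arbitrary: \<open>g'\<close> is again a
      uniformly Schwartz family, because \<open>1 / (2 * t)\<close> is bounded by 1 on
      \<open>?S\<close>.\<close>
    define g' where "g' k t y = partial k (g t) y + \<i> / of_real (2 * t) * (of_real (y $ k) * g t y)" for k t y
    have "schwartz_on ?S (g' k)" for k
      unfolding g'_def
      by (intro schwartz_on_add schwartz_on_partial Suc.prems schwartz_on_cmult[where B=1] schwartz_on_component_mult)
        (auto simp: norm_divide)
    from Suc.IH[OF this] have "\<forall>k. \<exists>C. \<forall>t\<in>?S. \<forall>\<xi>. (1 + norm \<xi>) ^ N * norm (fourier (\<lambda>y. phase t y * g' k t y) \<xi>) \<le> C"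
      by blast
    then obtain D where D: "\<And>k t \<xi>. t \<in> ?S \<Longrightarrow> (1 + norm \<xi>) ^ N * norm (fourier (\<lambda>y. phase t y * g' k t y) \<xi>) \<le> D k"
      by metis
    obtain C where C: "\<And>t \<xi>. t \<in> ?S \<Longrightarrow> (1 + norm \<xi>) ^ N * norm (fourier (\<lambda>y. phase t y * g t y) \<xi>) \<le> C"
      using Suc.IH[OF Suc.prems] by blast
    have "(1 + norm \<xi>) ^ Suc N * norm (fourier (\<lambda>y. phase t y * g t y) \<xi>) \<le> C + (\<Sum>k\<in>UNIV. D k)" if t: "t \<in> ?S" for t \<xi>
    proof -
      have sch: "schwartz_on (UNIV :: unit set) (\<lambda>_. g t)"
        by (rule schwartz_on_reindex[OF Suc.prems, where k="\<lambda>_. t"]) (rule t)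
      let ?F = "norm (fourier (\<lambda>y. phase t y * g t y) \<xi>)"
      have k: "\<bar>\<xi> $ k\<bar> * ?F \<le> norm (fourier (\<lambda>y. phase t y * g' k t y) \<xi>)" for k
      proof -
        have "norm (fourier (\<lambda>y. phase t y * g' k t y) \<xi>) = (2 * pi) * (\<bar>\<xi> $ k\<bar> * ?F)"
          unfolding g'_def fourier_phase_component[OF sch, symmetric] by (simp add: norm_mult)
        moreover have "1 * (\<bar>\<xi> $ k\<bar> * ?F) \<le> (2 * pi) * (\<bar>\<xi> $ k\<bar> * ?F)"
          using pi_ge_two by (intro mult_right_mono) auto
        ultimately show ?thesis by simp
      qed
      have "(1 + norm \<xi>) ^ Suc N * ?F \<le> (1 + norm \<xi>) ^ N * ((1 + (\<Sum>k\<in>UNIV. \<bar>\<xi> $ k\<bar>)) * ?F)"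
        unfolding power_Suc2 mult.assoc
        using norm_le_l1_cart[of \<xi>] by (intro mult_left_mono mult_right_mono) auto
      also have "\<dots> = (1 + norm \<xi>) ^ N * ?F + (\<Sum>k\<in>UNIV. (1 + norm \<xi>) ^ N * (\<bar>\<xi> $ k\<bar> * ?F))"
        unfolding distrib_right distrib_left sum_distrib_right sum_distrib_left by simp
      also have "\<dots> \<le> C + (\<Sum>k\<in>UNIV. D k)"
        by (intro add_mono C t sum_mono order_trans[OF mult_left_mono[OF k] D]) auto
      finally show ?thesis .
    qed
    then show ?case by blast
  qed
qed

section \<open>Asymptotics of the momentum\<close>

lemma character_commute: "character \<xi> y = character y \<xi>"
  by (simp add: character_def inner_commute)

text \<open>A directional derivative is enough for \<open>partial_solution\<close>, since
  differentiability of \<open>u t\<close> itself is known from the solution class.\<close>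

lemma fourier_has_vector_derivative:
  fixes g :: "real ^ 'n::finite \<Rightarrow> complex"
  assumes g: "schwartz_on (UNIV :: unit set) (\<lambda>_. g)"
  shows "((\<lambda>s. fourier (\<lambda>y. phase t y * g y) (\<xi> + s *\<^sub>R axis k 1)) has_vector_derivative
    fourier (\<lambda>y. phase t y * (- 2 * of_real pi * \<i> * (of_real (y $ k) * g y))) \<xi>) (at 0)"
proof -
  let ?\<xi> = "\<lambda>s. \<xi> + s *\<^sub>R axis k 1 :: real ^ 'n"
  let ?F = "\<lambda>s y. character (?\<xi> s) y * (phase t y * g y)"
  let ?F' = "\<lambda>s y. character (?\<xi> s) y * (phase t y * (- 2 * of_real pi * \<i> * (of_real (y $ k) * g y)))"
  have c: "c1 g" using schwartz_on_smooth[OF g] by (simp add: smooth_c1)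
  have s: "slow (character \<xi>)" "slow (phase t :: real ^ 'n \<Rightarrow> complex)" for \<xi> :: "real ^ 'n"
    by (rule slow_on_bounded[where C=1], simp add: norm_character norm_phase)+
  have r: "rapid g" "rapid (\<lambda>y. of_real (y $ k) * g y)"
    by (intro schwartz_on_rapid schwartz_on_component_mult g)+
  have int: "integrable lborel (?F s)" for s
    by (intro rapid_c1_integrable c1_mult c1_character c1_phase c rapid_on_mult_left s r)
  have w: "integrable lborel (\<lambda>y. 2 * pi * norm (of_real (y $ k) * g y))"
    by (intro integrable_mult_right integrable_norm rapid_c1_integrable r c1_mult c1_of_real c1_component c)
  have "((\<lambda>s. integral\<^sup>L lborel (?F s)) has_vector_derivative integral\<^sup>L lborel (?F' 0)) (at 0)"
  proof (rule has_vector_derivative_integral[where d=1 and w="\<lambda>y. 2 * pi * norm (of_real (y $ k) * g y)"])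
    fix s y
    have "partial k (character y) (?\<xi> s) = character y (?\<xi> s) * (- 2 * of_real pi * \<i> * of_real (y $ k))"
      using has_partial_character by (auto simp: has_partial_def)
    moreover have "((\<lambda>s. character y (?\<xi> s)) has_vector_derivative partial k (character y) (?\<xi> s)) (at s)"
      by (rule has_vector_derivative_along_axis[OF c1_differentiable[OF c1_character]])
    ultimately have "((\<lambda>s. character (?\<xi> s) y) has_vector_derivative
      character (?\<xi> s) y * (- 2 * of_real pi * \<i> * of_real (y $ k))) (at s)"
      by (simp only: character_commute)
    from has_vector_derivative_mult[OF this has_vector_derivative_const[of "phase t y * g y"]]
    show "((\<lambda>s. ?F s y) has_vector_derivative ?F' s y) (at s)"
      by (simp add: mult.assoc mult.left_commute)
    show "norm (?F' s y) \<le> 2 * pi * norm (of_real (y $ k) * g y)"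
      by (simp add: norm_mult norm_character norm_phase)
  qed (use int w in auto)
  then show ?thesis unfolding fourier_def character_def by simp
qed

text \<open>In the variable \<xi> the derivative of the phase is exactly the leading factor 2 \<pi>
  i \<xi>; the derivative of the transform carries 1 / (4 \<pi> t) from the chain rule and
  disappears in the limit.\<close>

lemma partial_solution:
  fixes u :: "real \<Rightarrow> real ^ 'n::finite \<Rightarrow> complex"
  assumes sol: "schroedinger_solution f u" and t: "t \<noteq> 0" and \<xi>: "x = (4 * pi * t) *\<^sub>R \<xi>"
  shows "partial k (u t) x = heat_coeff CARD('n) (\<i> * of_real t) * phase t x *
    (2 * of_real pi * \<i> * of_real (\<xi> $ k) * fourier (\<lambda>y. phase t y * f y) \<xi>
      + of_real (1 / (4 * pi * t)) * fourier (\<lambda>y. phase t y * (- 2 * of_real pi * \<i> * (of_real (y $ k) * f y))) \<xi>)"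
proof (rule partial_eq_vector_derivative)
  let ?h = "heat_coeff CARD('n) (\<i> * of_real t)" and ?c = "1 / (4 * pi * t)"
  let ?F = "fourier (\<lambda>y. phase t y * f y)"
  let ?D = "fourier (\<lambda>y. phase t y * (- 2 * of_real pi * \<i> * (of_real (y $ k) * f y))) \<xi>"
  have f: "schwartz_on (UNIV :: unit set) (\<lambda>_. f)"
    using schwartz_schwartz_on[OF solution_schwartz[OF sol, of 0]] solution_initial[OF sol] by simp
  show "u t differentiable (at x)" by (rule smooth_differentiable[OF solution_smooth[OF sol]])
  have \<xi>x: "\<xi> = ?c *\<^sub>R x" using t \<xi> by simp
  have arg: "?c *\<^sub>R (x + s *\<^sub>R axis k 1) = \<xi> + (s * ?c) *\<^sub>R axis k 1" for s
    by (simp add: \<xi>x scaleR_add_right)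
  have "((\<lambda>s. s * ?c) has_vector_derivative ?c) (at 0)"
    by (auto intro!: derivative_eq_intros)
  moreover have "((\<lambda>s. ?F (\<xi> + s *\<^sub>R axis k 1)) has_vector_derivative ?D) (at (0 * ?c))"
    using fourier_has_vector_derivative[OF f] by simp
  ultimately have F: "((\<lambda>s. ?F (\<xi> + (s * ?c) *\<^sub>R axis k 1)) has_vector_derivative ?c *\<^sub>R ?D) (at 0)"
    using vector_diff_chain_at[of "\<lambda>s. s * ?c" ?c 0 "\<lambda>s. ?F (\<xi> + s *\<^sub>R axis k 1)" ?D] by (simp add: comp_def)
  have p: "((\<lambda>s. phase t (x + s *\<^sub>R axis k 1)) has_vector_derivative phase t x * (\<i> / of_real (2 * t) * of_real (x $ k))) (at 0)"
    using has_vector_derivative_along_axis[where f="phase t" and x=x and s=0 and i=k, OF c1_differentiable[OF c1_phase]] has_partial_phase[of k t x]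
    by (simp add: has_partial_def)
  have A: "((\<lambda>s. ?h * (phase t (x + s *\<^sub>R axis k 1) * ?F (\<xi> + (s * ?c) *\<^sub>R axis k 1))) has_vector_derivative
     ?h * (phase t (x + 0 *\<^sub>R axis k 1) * (?c *\<^sub>R ?D) + phase t x * (\<i> / of_real (2 * t) * of_real (x $ k)) * ?F (\<xi> + (0 * ?c) *\<^sub>R axis k 1))) (at 0)"
    by (rule bounded_linear.has_vector_derivative[OF bounded_linear_mult_right has_vector_derivative_mult[OF p F]])
  have K: "\<i> / of_real (2 * t) * complex_of_real (x $ k) = 2 * of_real pi * \<i> * of_real (\<xi> $ k)"
    using t by (simp add: \<xi> field_simps)
  have E: "(\<lambda>s. u t (x + s *\<^sub>R axis k 1)) = (\<lambda>s. ?h * (phase t (x + s *\<^sub>R axis k 1) * ?F (\<xi> + (s * ?c) *\<^sub>R axis k 1)))"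
    by (rule ext) (simp only: solution_formula[OF sol t] arg, simp only: mult.assoc)
  show "((\<lambda>s. u t (x + s *\<^sub>R axis k 1)) has_vector_derivative ?h * phase t x *
    (2 * of_real pi * \<i> * of_real (\<xi> $ k) * ?F \<xi> + of_real ?c * ?D)) (at 0)"
    unfolding E
    by (rule back_subst[where P="\<lambda>d. (_ has_vector_derivative d) (at 0)", OF A])
      (simp only: K mult_zero_left scaleR_zero_left add_0_right, simp only: scaleR_conv_of_real ring_distribs ac_simps)
qed

text \<open>The squared modulus of the coefficient is the inverse of the Jacobian of x = 4 \<pi> t
  \<xi>, so the rescaled current has no power of \<open>t\<close> in front.\<close>

lemma heat_coeff_normalization:
  assumes "t \<noteq> 0"
  shows "\<bar>4 * pi * t\<bar> ^ n *\<^sub>R (cnj (heat_coeff n (\<i> * of_real t)) * heat_coeff n (\<i> * of_real t)) = 1"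
proof -
  let ?b = "4 * pi * \<bar>t\<bar>"
  have b: "?b > 0" using assms by simp
  have "(norm (heat_coeff n (\<i> * of_real t)))\<^sup>2 = ?b powr (- (n / 2)) * ?b powr (- (n / 2))"
    using assms norm_heat_coeff[of "\<i> * of_real t" n] by (simp add: power2_eq_square norm_mult)
  also have "\<dots> = ?b powr (- real n)" by (simp add: powr_add[symmetric])
  also have "\<dots> = inverse (?b ^ n)" using b by (simp add: powr_minus powr_realpow)
  finally have e: "(norm (heat_coeff n (\<i> * of_real t)))\<^sup>2 = inverse (?b ^ n)" .
  have 1: "?b ^ n * (norm (heat_coeff n (\<i> * of_real t)))\<^sup>2 = 1"
    unfolding e using b by (intro right_inverse) auto
  have 2: "cnj (heat_coeff n (\<i> * of_real t)) * heat_coeff n (\<i> * of_real t) = of_real ((norm (heat_coeff n (\<i> * of_real t)))\<^sup>2)"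
    by (subst complex_norm_square) (simp add: mult.commute)
  have 3: "\<bar>4 * pi * t\<bar> = ?b" by (simp add: abs_mult)
  show ?thesis unfolding 2 3 scaleR_conv_of_real of_real_mult[symmetric] 1 by simp
qed

lemma fourier_measurable:
  assumes "g \<in> borel_measurable borel"
  shows "fourier g \<in> borel_measurable borel"
proof -
  note assms[measurable]
  show ?thesis unfolding fourier_def[abs_def] by measurable
qed

lemma phase_tendsto_one: "((\<lambda>s. phase (\<sigma> * s) y) \<longlongrightarrow> 1) at_top"
proof -
  have "((\<lambda>s. (norm y)\<^sup>2 / (4 * \<sigma>) * inverse s) \<longlongrightarrow> 0) at_top"
    by (intro tendsto_mult_right_zero tendsto_inverse_0_at_top filterlim_ident)
  moreover have "(norm y)\<^sup>2 / (4 * \<sigma>) * inverse s = (norm y)\<^sup>2 / (4 * (\<sigma> * s))" for s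
    by (cases "s = 0"; cases "\<sigma> = 0") (simp_all add: field_simps)
  ultimately have "((\<lambda>s. (norm y)\<^sup>2 / (4 * (\<sigma> * s))) \<longlongrightarrow> 0) at_top"
    by (simp only:)
  then have "((\<lambda>s. exp (\<i> * of_real ((norm y)\<^sup>2 / (4 * (\<sigma> * s))))) \<longlongrightarrow> exp (\<i> * of_real 0)) at_top"
    by (intro tendsto_intros)
  then show ?thesis by (simp add: phase_def)
qed

lemma fourier_phase_tendsto:
  fixes g :: "real ^ 'n::finite \<Rightarrow> complex"
  assumes g: "integrable lborel g"
  shows "((\<lambda>s. fourier (\<lambda>y. phase (\<sigma> * s) y * g y) \<xi>) \<longlongrightarrow> fourier g \<xi>) at_top"
  unfolding fourier_def character_def[symmetric]
proof (rule integral_dominated_convergence_at_top[where w="\<lambda>y. norm (g y)"])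
  have [measurable]: "g \<in> borel_measurable borel" using borel_measurable_integrable[OF g] by simp
  have [measurable]: "character \<xi> \<in> borel_measurable borel" "phase t \<in> borel_measurable borel" for t and \<xi> :: "real ^ 'n"
    by (intro borel_measurable_continuous_onI c1_continuous c1_character c1_phase)+
  show "(\<lambda>y. character \<xi> y * g y) \<in> borel_measurable lborel"
    "(\<lambda>y. character \<xi> y * (phase (\<sigma> * s) y * g y)) \<in> borel_measurable lborel" for s
    by measurable
  have "((\<lambda>s. character \<xi> y * (phase (\<sigma> * s) y * g y)) \<longlongrightarrow> character \<xi> y * (1 * g y)) at_top" for y
    by (intro tendsto_intros phase_tendsto_one)
  then show "AE y in lborel. ((\<lambda>s. character \<xi> y * (phase (\<sigma> * s) y * g y)) \<longlongrightarrow> character \<xi> y * g y) at_top"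
    by simp
qed (use g in \<open>auto simp: norm_mult norm_character norm_phase\<close>)

section \<open>The momentum in rescaled variables\<close>

context radial_weight
begin

definition current :: "(real ^ 'n \<Rightarrow> complex) \<Rightarrow> real ^ 'n \<Rightarrow> complex" where
  "current v x = (\<Sum>j\<in>UNIV. of_real (partial j \<psi> x) * (cnj (v x) * partial j v x))"

text \<open>The zeroth-order term of \<open>transport\<close> contributes a real multiple of |v|^2,
  which \<open>Im\<close> removes.\<close>

lemma momentum_eq_current:
  assumes v: "v \<in> schwartz"
  shows "momentum v = 1/2 * Im (LINT x|lborel. current v x)"
proof -
  have sch: "schwartz_on (UNIV :: unit set) (\<lambda>_. v)" by (rule schwartz_schwartz_on[OF v])
  have sm: "Defs.smooth v" using v by (simp add: schwartz_def)
  have 1: "integrable lborel (\<lambda>x. cnj (v x) * transport v x)"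
    by (intro rapid_c1_integrable c1_mult c1_cnj c1_transport smooth_c1 sm rapid_on_mult rapid_on_cnj rapid_on_transport
        schwartz_on_rapid sch)
  have 2: "integrable lborel (current v)"
    unfolding current_def
    by (intro rapid_c1_integrable c1_sum c1_mult c1_of_real c1_psi c1_cnj smooth_c1 smooth_partial sm rapid_on_sum
      rapid_on_mult_left[OF slow_on_of_real[OF slow_partial_psi]] rapid_on_mult rapid_on_cnj schwartz_on_rapid schwartz_on_partial sch)
  have "cnj (v x) * transport v x = current v x + of_real (1/2 * laplacian \<psi> x * (norm (v x))\<^sup>2)" for x
  proof -
    have n: "cnj (v x) * v x = of_real ((norm (v x))\<^sup>2)" by (subst complex_norm_square) (rule mult.commute)
    have q: "of_real (1/2 * laplacian \<psi> x * (norm (v x))\<^sup>2) = 1/2 * of_real (laplacian \<psi> x) * (cnj (v x) * v x)"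
      unfolding n by simp
    show ?thesis unfolding q transport_def current_def by (simp add: algebra_simps sum_distrib_left)
  qed
  then have "Im (cnj (v x) * transport v x) = Im (current v x)" for x
    by (simp only: plus_complex.sel Im_complex_of_real add_0_right)
  then have "(LINT x|lborel. Im (cnj (v x) * transport v x)) = (LINT x|lborel. Im (current v x))"
    by presburger
  then show ?thesis
    unfolding momentum_def using integral_bounded_linear[OF bounded_linear_Im 1] integral_bounded_linear[OF bounded_linear_Im 2]
    by simp
qed

lemma continuous_current:
  "Defs.smooth v \<Longrightarrow> continuous_on A (current v)"
  unfolding current_def
  by (intro c1_continuous c1_sum c1_mult c1_of_real c1_psi c1_cnj smooth_c1 smooth_partial)

text \<open>The radius tends to infinity, while the direction of the argument is \<sigma> \<xi> /
  |\<xi>| for positive \<open>s\<close>; this is where the sign of time enters.\<close>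

lemma partial_psi_tendsto:
  assumes \<sigma>: "\<bar>\<sigma>\<bar> = 1" and \<xi>: "\<xi> \<noteq> 0"
  shows "((\<lambda>s. partial j \<psi> ((4 * pi * (\<sigma> * s)) *\<^sub>R \<xi>)) \<longlongrightarrow> \<psi>'_inf * (\<sigma> * (\<xi> $ j / norm \<xi>))) at_top"
proof -
  have "filterlim (\<lambda>s. (4 * pi * norm \<xi>) * s) at_top at_top"
    by (rule filterlim_tendsto_pos_mult_at_top[OF tendsto_const _ filterlim_ident]) (use \<xi> in simp)
  from filterlim_compose[OF limit this]
  have "((\<lambda>s. \<rho>1 ((4 * pi * norm \<xi>) * s) * (\<sigma> * (\<xi> $ j / norm \<xi>))) \<longlongrightarrow> \<psi>'_inf * (\<sigma> * (\<xi> $ j / norm \<xi>))) at_top"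
    by (intro tendsto_intros)
  moreover have "eventually (\<lambda>s. \<rho>1 ((4 * pi * norm \<xi>) * s) * (\<sigma> * (\<xi> $ j / norm \<xi>)) = partial j \<psi> ((4 * pi * (\<sigma> * s)) *\<^sub>R \<xi>)) at_top"
    using eventually_gt_at_top[of 0]
  proof eventually_elim
    case (elim s)
    have n: "norm ((4 * pi * (\<sigma> * s)) *\<^sub>R \<xi>) = (4 * pi * norm \<xi>) * s"
      using elim \<sigma> by (simp add: abs_mult)
    have "\<sigma> \<noteq> 0" using \<sigma> by auto
    then have "(4 * pi * (\<sigma> * s)) *\<^sub>R \<xi> \<noteq> 0" using elim \<xi> by simp
    from partial_psi[OF this] show ?case unfolding n using elim \<xi> by (simp add: field_simps)
  qed
  ultimately show ?thesis by (rule Lim_transform_eventually)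
qed

text \<open>The sign \<open>\<sigma>\<close> allows both ends of the time axis to be treated as
  limits at \<open>at_top\<close>.\<close>

lemma momentum_tendsto:
  fixes f :: "real ^ 'n \<Rightarrow> complex"
  assumes sol: "schroedinger_solution f u" and \<sigma>: "\<bar>\<sigma>\<bar> = 1"
  shows "((\<lambda>s. momentum (u (\<sigma> * s))) \<longlongrightarrow> \<sigma> * (pi * \<psi>'_inf * (LINT \<xi>|lborel. (norm (fourier f \<xi>))\<^sup>2 * norm \<xi>))) at_top"
proof -
  let ?S = "{t. 1 \<le> \<bar>t :: real\<bar>}"
  have f: "schwartz_on (S :: 's set) (\<lambda>_. f)" for S
    using schwartz_schwartz_on[OF solution_schwartz[OF sol, of 0]] solution_initial[OF sol] by simp
  have sm: "Defs.smooth f" using schwartz_on_smooth[OF f, of "()" UNIV] by simp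
  have \<sigma>0: "\<sigma> \<noteq> 0" using \<sigma> by auto
  let ?g = "\<lambda>j y. - 2 * of_real pi * \<i> * (of_real (y $ j) * f y)"
  have g: "schwartz_on (S :: 's set) (\<lambda>_. ?g j)" for S j
    by (intro schwartz_on_cmult[where B="norm (- 2 * of_real pi * \<i>)"] schwartz_on_component_mult f) simp
  define F where "F t = fourier (\<lambda>y. phase t y * f y)" for t
  define D where "D t j = fourier (\<lambda>y. phase t y * ?g j y)" for t j
  \<comment> \<open>The current after rescaling, with the Jacobian cancelled by the coefficients and
    the phases cancelled by their conjugates. Decay and pointwise limit are read off from
    \<open>J\<close>.\<close>
  define J where "J t \<xi> = (\<Sum>j\<in>UNIV. of_real (partial j \<psi> ((4 * pi * t) *\<^sub>R \<xi>)) *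
     (cnj (F t \<xi>) * (2 * of_real pi * \<i> * of_real (\<xi> $ j) * F t \<xi> + of_real (1 / (4 * pi * t)) * D t j \<xi>)))" for t \<xi>
  \<comment> \<open>The integrand delivered by the change of variables; its measurability comes from
    continuity of the current, and it agrees with \<open>J\<close> for nonzero
    \<open>t\<close>.\<close>
  define G where "G t \<xi> = \<bar>4 * pi * t\<bar> ^ CARD('n) *\<^sub>R current (u t) ((4 * pi * t) *\<^sub>R \<xi>)" for t \<xi>
  have GJ: "G t \<xi> = J t \<xi>" if t: "t \<noteq> 0" for t \<xi>
  proof -
    let ?x = "(4 * pi * t) *\<^sub>R \<xi>" and ?h = "heat_coeff CARD('n) (\<i> * of_real t)"
    have x: "(1 / (4 * pi * t)) *\<^sub>R ?x = \<xi>" using t by simp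
    have ph: "cnj (phase t ?x) * phase t ?x = 1"
      using complex_norm_square[of "phase t ?x"] by (simp add: norm_phase mult.commute)
    have "cnj (u t ?x) * partial j (u t) ?x = (cnj ?h * ?h) *
       (cnj (F t \<xi>) * (2 * of_real pi * \<i> * of_real (\<xi> $ j) * F t \<xi> + of_real (1 / (4 * pi * t)) * D t j \<xi>))" for j
    proof -
      have "cnj (u t ?x) * partial j (u t) ?x = (cnj ?h * ?h) * (cnj (phase t ?x) * phase t ?x) *
       (cnj (F t \<xi>) * (2 * of_real pi * \<i> * of_real (\<xi> $ j) * F t \<xi> + of_real (1 / (4 * pi * t)) * D t j \<xi>))"
        unfolding partial_solution[OF sol t refl, folded F_def D_def] solution_formula[OF sol t, of ?x, unfolded x, folded F_def]
          complex_cnj_mult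
        by (simp only: ac_simps)
      then show ?thesis unfolding ph by simp
    qed
    then have "current (u t) ?x = (cnj ?h * ?h) * J t \<xi>"
      unfolding current_def J_def sum_distrib_left by (simp only: mult.left_commute)
    then have "G t \<xi> = (\<bar>4 * pi * t\<bar> ^ CARD('n) *\<^sub>R (cnj ?h * ?h)) * J t \<xi>"
      unfolding G_def by simp
    then show ?thesis unfolding heat_coeff_normalization[OF t] by simp
  qed
  have cm: "current (u t) \<in> borel_measurable borel" for t
    by (intro borel_measurable_continuous_onI continuous_current solution_smooth[OF sol])
  have momentum: "momentum (u t) = 1/2 * Im (LINT \<xi>|lborel. G t \<xi>)" if t: "t \<noteq> 0" for t
    using lborel_integral_affine[of "4 * pi * t" "current (u t)" 0] t cm
    unfolding momentum_eq_current[OF solution_schwartz[OF sol]] G_def by simp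
  have "rapid_on ?S J"
  proof -
    obtain K where K: "\<And>i x. \<bar>partial i \<psi> x\<bar> \<le> K" using partial_psi_bounded by blast
    have 1: "slow_on ?S (\<lambda>t \<xi>. complex_of_real (partial j \<psi> ((4 * pi * t) *\<^sub>R \<xi>)))" for j
      by (rule slow_on_bounded[where C=K]) (simp add: K)
    have 2: "slow_on ?S (\<lambda>t (\<xi> :: real ^ 'n). complex_of_real (1 / (4 * pi * t)))"
    proof (rule slow_on_bounded[where C=1])
      fix t :: real assume "t \<in> ?S"
      then have "1 * 1 \<le> (4 * pi) * \<bar>t\<bar>" using pi_ge_two by (intro mult_mono) auto
      then show "norm (complex_of_real (1 / (4 * pi * t))) \<le> 1"
        by (simp add: norm_divide norm_mult)
    qed
    have 3: "rapid_on ?S F" "rapid_on ?S (\<lambda>t. D t j)" for j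
      unfolding F_def D_def by (rule rapid_on_fourier_phase, rule f g)+
    show ?thesis
      unfolding J_def
      by (intro rapid_on_sum rapid_on_mult_left[OF 1] rapid_on_mult[OF rapid_on_cnj[OF 3(1)]] rapid_on_add
         rapid_on_mult_left[OF 2] rapid_on_mult_left[OF slow_on_mult[OF slow_on_const]] slow_on_of_real slow_on_component 3)
  qed
  then obtain B where B: "\<And>t \<xi>. t \<in> ?S \<Longrightarrow> norm (J t \<xi>) \<le> B * weight \<xi>"
    by (rule rapid_on_weight) blast
  \<comment> \<open>In the limit the remainder with \<open>D\<close> drops out, and the sum of
    \<xi>_j \<xi>_j / |\<xi>| over j is |\<xi>|.\<close>
  let ?L = "\<lambda>\<xi>. (\<sigma> * 2 * of_real pi * \<i> * of_real \<psi>'_inf) * complex_of_real ((norm (fourier f \<xi>))\<^sup>2 * norm \<xi>)"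
  have int: "integrable lborel f" "integrable lborel (?g j)" for j
    by (intro rapid_c1_integrable smooth_c1 schwartz_on_rapid f sm)
      (intro rapid_c1_integrable smooth_c1 schwartz_on_rapid g schwartz_on_smooth[OF g[of "UNIV :: unit set" j] UNIV_I])
  have lim: "((\<lambda>s. J (\<sigma> * s) \<xi>) \<longlongrightarrow> ?L \<xi>) at_top" if \<xi>: "\<xi> \<noteq> 0" for \<xi>
  proof -
    have F: "((\<lambda>s. F (\<sigma> * s) \<xi>) \<longlongrightarrow> fourier f \<xi>) at_top" and D: "((\<lambda>s. D (\<sigma> * s) j \<xi>) \<longlongrightarrow> fourier (?g j) \<xi>) at_top" for j
      unfolding F_def D_def by (rule fourier_phase_tendsto[OF int(1)], rule fourier_phase_tendsto[OF int(2)])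
    have c: "((\<lambda>s. 1 / (4 * pi * (\<sigma> * s))) \<longlongrightarrow> 0) at_top"
    proof -
      have "((\<lambda>s. 1 / (4 * pi * \<sigma>) * inverse s) \<longlongrightarrow> 0) at_top"
        by (intro tendsto_mult_right_zero tendsto_inverse_0_at_top filterlim_ident)
      moreover have "1 / (4 * pi * \<sigma>) * inverse s = 1 / (4 * pi * (\<sigma> * s))" for s
        using \<sigma>0 by (cases "s = 0") (simp_all add: field_simps)
      ultimately show ?thesis by (simp only:)
    qed
    have "((\<lambda>s. J (\<sigma> * s) \<xi>) \<longlongrightarrow> (\<Sum>j\<in>UNIV. of_real (\<psi>'_inf * (\<sigma> * (\<xi> $ j / norm \<xi>))) *
      (cnj (fourier f \<xi>) * (2 * of_real pi * \<i> * of_real (\<xi> $ j) * fourier f \<xi> + of_real 0 * fourier (?g j) \<xi>)))) at_top"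
      unfolding J_def by (intro tendsto_intros partial_psi_tendsto \<sigma> \<xi> F D c)
    also have "(\<Sum>j\<in>UNIV. of_real (\<psi>'_inf * (\<sigma> * (\<xi> $ j / norm \<xi>))) *
      (cnj (fourier f \<xi>) * (2 * of_real pi * \<i> * of_real (\<xi> $ j) * fourier f \<xi> + of_real 0 * fourier (?g j) \<xi>))) =
      (\<Sum>j\<in>UNIV. (\<sigma> * 2 * of_real pi * \<i> * of_real \<psi>'_inf) * (fourier f \<xi> * cnj (fourier f \<xi>)) * of_real (\<xi> $ j * \<xi> $ j / norm \<xi>))"
      by (intro sum.cong) (auto simp: field_simps)
    also have "\<dots> = (\<sigma> * 2 * of_real pi * \<i> * of_real \<psi>'_inf) * (fourier f \<xi> * cnj (fourier f \<xi>)) * of_real ((\<Sum>j\<in>UNIV. \<xi> $ j * \<xi> $ j) / norm \<xi>)"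
      by (simp only: sum_distrib_left of_real_sum sum_divide_distrib)
    also have "\<dots> = ?L \<xi>"
      unfolding norm_sq_eq_sum[symmetric] complex_norm_square[symmetric] using \<xi>
      by (simp add: power2_eq_square)
    finally show ?thesis .
  qed
  have "((\<lambda>s. LINT \<xi>|lborel. G (\<sigma> * s) \<xi>) \<longlongrightarrow> (LINT \<xi>|lborel. ?L \<xi>)) at_top"
  proof (rule integral_dominated_convergence_at_top[where w="\<lambda>\<xi>. B * weight \<xi>"])
    have fm: "f \<in> borel_measurable borel" using borel_measurable_integrable[OF int(1)] by simp
    note fourier_measurable[OF fm, measurable] cm[measurable]
    show "?L \<in> borel_measurable lborel" by measurable
    show "G (\<sigma> * s) \<in> borel_measurable lborel" for s unfolding G_def[abs_def] by measurable
    show "integrable lborel (\<lambda>\<xi> :: real ^ 'n. B * weight \<xi>)" by (simp add: integrable_weight)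
    show "AE \<xi> in lborel. ((\<lambda>s. G (\<sigma> * s) \<xi>) \<longlongrightarrow> ?L \<xi>) at_top"
      \<comment> \<open>The origin, excluded in \<open>partial_psi_tendsto\<close>, is a null
        set.\<close>
      using AE_lborel_singleton[of 0]
    proof eventually_elim
      case (elim \<xi>)
      have "eventually (\<lambda>s. J (\<sigma> * s) \<xi> = G (\<sigma> * s) \<xi>) at_top"
        using eventually_gt_at_top[of 0] by eventually_elim (simp add: GJ \<sigma>0)
      with lim[OF elim] show ?case by (rule Lim_transform_eventually)
    qed
    show "eventually (\<lambda>s. AE \<xi> in lborel. norm (G (\<sigma> * s) \<xi>) \<le> B * weight \<xi>) at_top"
      using eventually_ge_at_top[of 1]
    proof eventually_elim
      case (elim s)
      then have "\<sigma> * s \<in> ?S" "\<sigma> * s \<noteq> 0" using \<sigma> \<sigma>0 by (auto simp: abs_mult)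
      then show ?case using B GJ by simp
    qed
  qed
  then have "((\<lambda>s. 1/2 * Im (LINT \<xi>|lborel. G (\<sigma> * s) \<xi>)) \<longlongrightarrow> 1/2 * Im (LINT \<xi>|lborel. ?L \<xi>)) at_top"
    by (intro tendsto_intros)
  moreover have "eventually (\<lambda>s. 1/2 * Im (LINT \<xi>|lborel. G (\<sigma> * s) \<xi>) = momentum (u (\<sigma> * s))) at_top"
    using eventually_gt_at_top[of 0] by eventually_elim (simp add: momentum \<sigma>0)
  ultimately have "((\<lambda>s. momentum (u (\<sigma> * s))) \<longlongrightarrow> 1/2 * Im (LINT \<xi>|lborel. ?L \<xi>)) at_top"
    by (rule Lim_transform_eventually)
  moreover have "1/2 * Im (LINT \<xi>|lborel. ?L \<xi>) = \<sigma> * (pi * \<psi>'_inf * (LINT \<xi>|lborel. (norm (fourier f \<xi>))\<^sup>2 * norm \<xi>))"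
    unfolding integral_mult_right_zero integral_complex_of_real by simp
  ultimately show ?thesis by (simp only:)
qed

end

section \<open>Integration in time and the limit\<close>

theorem theorem0p1:
  fixes \<psi> :: "real ^ 'n::finite \<Rightarrow> real" and \<rho> :: "real \<Rightarrow> real"
    and C \<psi>'_inf :: real and P :: "real poly"
    and f :: "real ^ 'n \<Rightarrow> complex" and u :: "real \<Rightarrow> real ^ 'n \<Rightarrow> complex"
  assumes smooth: "smooth \<psi>"
    and radial: "\<And>x. \<psi> x = \<rho> (norm x)"
    and C_pos: "C > 0"
    and bound: "\<And>k r. k \<in> {1, 2, 3} \<Longrightarrow> r > 0 \<Longrightarrow> \<bar>(deriv ^^ k) \<rho> r\<bar> \<le> C * \<bar>poly P r\<bar>"
    and limit: "(deriv \<rho> \<longlongrightarrow> \<psi>'_inf) at_top"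
    and f: "f \<in> schwartz"
    and u: "schroedinger_solution f u"
  shows "(\<forall>t. virial_density \<psi> (u t) integrable_on UNIV) \<and>
    (\<forall>T. (\<lambda>t. integral UNIV (virial_density \<psi> (u t))) integrable_on {-T..T}) \<and>
    ((\<lambda>T. integral {-T..T} (\<lambda>t. integral UNIV (virial_density \<psi> (u t))))
       \<longlongrightarrow> of_real (2 * pi * \<psi>'_inf * (hom_sobolev_norm (1 / 2) f)\<^sup>2)) at_top"
proof -
  interpret radial_weight \<psi> \<rho> C \<psi>'_inf P
    by unfold_locales (use smooth radial bound limit in auto)
  define V where "V t = - Re (LINT x|lborel. cnj (transport (u t) x) * laplacian (u t) x)" for t
  have hi: "(virial_density \<psi> (u t) has_integral complex_of_real (V t)) UNIV" for t
    unfolding V_def by (rule virial_has_integral[OF schwartz_schwartz_on[OF solution_schwartz[OF u]]])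
  then have eq: "integral UNIV (virial_density \<psi> (u t)) = complex_of_real (V t)" for t
    by (rule integral_unique)
  have "((\<lambda>t. complex_of_real (momentum (u t))) has_vector_derivative complex_of_real (V t)) (at t within A)" for t A
    using bounded_linear.has_vector_derivative[OF bounded_linear_of_real momentum_has_vector_derivative[OF u]]
      has_vector_derivative_at_within unfolding V_def by blast
  \<comment> \<open>The fundamental theorem for this integral asks only for a derivative at every
    point, so continuity of \<open>V\<close> in time never has to be shown.\<close>
  then have ftc: "((\<lambda>t. complex_of_real (V t)) has_integral of_real (momentum (u T)) - of_real (momentum (u (- T)))) {-T..T}"
    if "T \<ge> 0" for T
    using that by (intro fundamental_theorem_of_calculus) auto
  have io: "(\<lambda>t. complex_of_real (V t)) integrable_on {-T..T}" for T
    \<comment> \<open>For negative \<open>T\<close> the interval is empty.\<close>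
    using ftc[of T] by (cases "T \<ge> 0") (auto simp: integrable_on_def)
  let ?N = "LINT \<xi>|lborel. (norm (fourier f \<xi>))\<^sup>2 * norm \<xi>"
  have N: "(hom_sobolev_norm (1 / 2) f)\<^sup>2 = ?N"
    unfolding hom_sobolev_norm_def by (subst real_sqrt_pow2) (auto intro!: integral_nonneg_AE)
  \<comment> \<open>The factors \<open>1\<close> and \<open>- 1\<close> are the two choices of
    \<open>\<sigma>\<close>; the limits have opposite signs, so their difference doubles
    \<pi>.\<close>
  have "((\<lambda>T. momentum (u (1 * T)) - momentum (u (- 1 * T))) \<longlongrightarrow> 1 * (pi * \<psi>'_inf * ?N) - (- 1) * (pi * \<psi>'_inf * ?N)) at_top"
    by (intro tendsto_diff momentum_tendsto[OF u]) auto
  then have "((\<lambda>T. complex_of_real (momentum (u T) - momentum (u (- T)))) \<longlongrightarrow> of_real (2 * pi * \<psi>'_inf * ?N)) at_top"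
    by (intro tendsto_of_real) (simp add: algebra_simps)
  moreover have "eventually (\<lambda>T. complex_of_real (momentum (u T) - momentum (u (- T))) = integral {-T..T} (\<lambda>t. complex_of_real (V t))) at_top"
    using eventually_ge_at_top[of 0] by eventually_elim (simp add: integral_unique[OF ftc])
  ultimately have "((\<lambda>T. integral {-T..T} (\<lambda>t. complex_of_real (V t))) \<longlongrightarrow> of_real (2 * pi * \<psi>'_inf * ?N)) at_top"
    by (rule Lim_transform_eventually)
  then show ?thesis using hi io unfolding eq N by (auto simp: integrable_on_def)
qed

end
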